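(* Let $K$ be an algebraically closed field and $G$ a virtually abelian group of cardinality less than that of $K$. Suppose that $G$ has a normal abelian subgroup $H$ of finite index $n$. Then each simple $KG$-module has dimension at most $n$ over $K$, and so the group algebra $KG$ is CCR.
   Context: A group is virtually abelian if it contains an abelian subgroup of finite index. Modules are left modules. A module $M$ over a ring $R$ is simple if $RM\ne0$ and its only submodules are $0$ and $M$. A ring is primitive if it has a faithful simple module. A ring $R$ is simple if $R^2\neq 0$ and it has no proper non-zero two-sided ideals. A minimal left ideal is a simple submodule of the left regular module $R$. A ring is CCR if every primitive quotient ring of it is simple and has a minimal left ideal. *)

theory Defs
  imports "HOL-Algebra.Algebra" "HOL-Library.Equipollence"
begin

section \<open>Left modules\<close>

text \<open>
  The locale \<^locale>\<open>module\<close> requires a commutative scalar ring, so left modules over an arbitrary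
  ring are introduced here on the same record type.  As is usual when simplicity includes the
  condition $RM \neq 0$, modules are not assumed to be unital; a simple module over a ring with
  identity is automatically unital.
\<close>

locale left_module = R?: ring R + M?: abelian_group M
  for R :: "('a, 'x) ring_scheme" (structure) and M :: "('a, 'm, 'y) module_scheme" (structure) +
  assumes smult_closed:
      "\<lbrakk>a \<in> carrier R; x \<in> carrier M\<rbrakk> \<Longrightarrow> a \<odot>\<^bsub>M\<^esub> x \<in> carrier M"
    and smult_l_distr:
      "\<lbrakk>a \<in> carrier R; b \<in> carrier R; x \<in> carrier M\<rbrakk> \<Longrightarrow>
        (a \<oplus> b) \<odot>\<^bsub>M\<^esub> x = a \<odot>\<^bsub>M\<^esub> x \<oplus>\<^bsub>M\<^esub> b \<odot>\<^bsub>M\<^esub> x"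
    and smult_r_distr:
      "\<lbrakk>a \<in> carrier R; x \<in> carrier M; y \<in> carrier M\<rbrakk> \<Longrightarrow>
        a \<odot>\<^bsub>M\<^esub> (x \<oplus>\<^bsub>M\<^esub> y) = a \<odot>\<^bsub>M\<^esub> x \<oplus>\<^bsub>M\<^esub> a \<odot>\<^bsub>M\<^esub> y"
    and smult_assoc:
      "\<lbrakk>a \<in> carrier R; b \<in> carrier R; x \<in> carrier M\<rbrakk> \<Longrightarrow>
        (a \<otimes> b) \<odot>\<^bsub>M\<^esub> x = a \<odot>\<^bsub>M\<^esub> (b \<odot>\<^bsub>M\<^esub> x)"

definition simple_module :: "('a, 'x) ring_scheme \<Rightarrow> ('a, 'm, 'y) module_scheme \<Rightarrow> bool" where
  "simple_module R M \<longleftrightarrow>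
     left_module R M \<and>
     (\<exists>r\<in>carrier R. \<exists>x\<in>carrier M. r \<odot>\<^bsub>M\<^esub> x \<noteq> \<zero>\<^bsub>M\<^esub>) \<and>
     (\<forall>N. submodule N R M \<longrightarrow> N = {\<zero>\<^bsub>M\<^esub>} \<or> N = carrier M)"

definition faithful_module :: "('a, 'x) ring_scheme \<Rightarrow> ('a, 'm, 'y) module_scheme \<Rightarrow> bool" where
  "faithful_module R M \<longleftrightarrow>
     left_module R M \<and>
     (\<forall>r\<in>carrier R. (\<forall>x\<in>carrier M. r \<odot>\<^bsub>M\<^esub> x = \<zero>\<^bsub>M\<^esub>) \<longrightarrow> r = \<zero>\<^bsub>R\<^esub>)"

definition regular_module :: "('a, 'x) ring_scheme \<Rightarrow> ('a, 'a) module" where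
  "regular_module R =
     \<lparr>carrier = carrier R, monoid.mult = monoid.mult R, one = one R,
      ring.zero = ring.zero R, ring.add = ring.add R, smult = monoid.mult R\<rparr>"


section \<open>Primitive, simple and CCR rings\<close>

text \<open>
  A simple module $M$ equals $Rm$ for some $m \in M$, so its elements can be represented by subsets
  of $R$, namely the fibres of $r \mapsto rm$.  Hence it is no restriction that the underlying type
  of the module below is \<^typ>\<open>'a set\<close>; see the lemma \<open>primitive_ringI\<close>.
\<close>

definition primitive_ring :: "('a, 'x) ring_scheme \<Rightarrow> bool" where
  "primitive_ring R \<longleftrightarrow>
     (\<exists>M :: ('a, 'a set) module. simple_module R M \<and> faithful_module R M)"

definition transport_module :: "('m \<Rightarrow> 'n) \<Rightarrow> ('a, 'm, 'y) module_scheme \<Rightarrow> ('a, 'n) module" where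
  "transport_module \<phi> M =
     (let \<psi> = inv_into (carrier M) \<phi> in
      \<lparr>carrier = \<phi> ` carrier M,
       monoid.mult = (\<lambda>A B. \<phi> (\<psi> A \<otimes>\<^bsub>M\<^esub> \<psi> B)), one = \<phi> \<one>\<^bsub>M\<^esub>,
       ring.zero = \<phi> \<zero>\<^bsub>M\<^esub>, ring.add = (\<lambda>A B. \<phi> (\<psi> A \<oplus>\<^bsub>M\<^esub> \<psi> B)),
       smult = (\<lambda>r A. \<phi> (r \<odot>\<^bsub>M\<^esub> \<psi> A))\<rparr>)"

lemma transport_simps:
  assumes "inj_on \<phi> (carrier M)"
  shows "carrier (transport_module \<phi> M) = \<phi> ` carrier M"
    and "ring.zero (transport_module \<phi> M) = \<phi> \<zero>\<^bsub>M\<^esub>"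
    and "\<lbrakk>x \<in> carrier M; y \<in> carrier M\<rbrakk> \<Longrightarrow>
           \<phi> x \<oplus>\<^bsub>transport_module \<phi> M\<^esub> \<phi> y = \<phi> (x \<oplus>\<^bsub>M\<^esub> y)"
    and "x \<in> carrier M \<Longrightarrow> r \<odot>\<^bsub>transport_module \<phi> M\<^esub> \<phi> x = \<phi> (r \<odot>\<^bsub>M\<^esub> x)"
  using assms by (simp_all add: transport_module_def Let_def inv_into_f_f)

lemma left_module_transport:
  assumes M: "left_module R M" and inj: "inj_on \<phi> (carrier M)"
  shows "left_module R (transport_module \<phi> M)"
proof -
  interpret left_module R M by (rule M)
  note ts = transport_simps[OF inj]
  show ?thesis
  proof (intro left_module.intro left_module_axioms.intro)
    show "ring R" ..
    show "abelian_group (transport_module \<phi> M)"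
    proof (rule abelian_groupI)
      fix A assume "A \<in> carrier (transport_module \<phi> M)"
      then obtain x where x: "x \<in> carrier M" "A = \<phi> x" by (auto simp: ts)
      show "\<exists>B\<in>carrier (transport_module \<phi> M).
              B \<oplus>\<^bsub>transport_module \<phi> M\<^esub> A = \<zero>\<^bsub>transport_module \<phi> M\<^esub>"
        by (rule bexI[of _ "\<phi> (\<ominus>\<^bsub>M\<^esub> x)"]) (use x in \<open>auto simp: ts M.l_neg\<close>)
    qed (auto simp: ts M.a_assoc intro: arg_cong[OF M.a_comm])
  qed (auto simp: ts smult_closed smult_l_distr smult_r_distr smult_assoc)
qed

lemma simple_module_transport:
  assumes M: "simple_module R M" and inj: "inj_on \<phi> (carrier M)"
  shows "simple_module R (transport_module \<phi> M)"
proof -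
  interpret left_module R M using M by (simp add: simple_module_def)
  let ?N = "transport_module \<phi> M"
  note ts = transport_simps[OF inj]
  have lm: "left_module R ?N"
    by (rule left_module_transport[OF _ inj]) unfold_locales
  interpret N: left_module R ?N by (rule lm)
  obtain r x where rx: "r \<in> carrier R" "x \<in> carrier M" "r \<odot>\<^bsub>M\<^esub> x \<noteq> \<zero>\<^bsub>M\<^esub>"
    using M by (auto simp: simple_module_def)
  have nz: "r \<odot>\<^bsub>?N\<^esub> \<phi> x \<noteq> \<zero>\<^bsub>?N\<^esub>"
    using rx inj_onD[OF inj, of "r \<odot>\<^bsub>M\<^esub> x" "\<zero>\<^bsub>M\<^esub>"] by (auto simp: ts smult_closed)
  have sub: "S = {\<zero>\<^bsub>?N\<^esub>} \<or> S = carrier ?N" if S: "submodule S R ?N" for S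
  proof -
    interpret S: submodule S R ?N by (rule S)
    have sub: "S \<subseteq> \<phi> ` carrier M" using S.subset by (simp add: ts)
    define T where "T = {x \<in> carrier M. \<phi> x \<in> S}"
    have ST: "S = \<phi> ` T" using sub by (auto simp: T_def)
    have "submodule T R M"
    proof (intro submodule.intro subgroup.intro submodule_axioms.intro)
      show "T \<subseteq> carrier (add_monoid M)" by (auto simp: T_def)
      show "x \<otimes>\<^bsub>add_monoid M\<^esub> y \<in> T" if "x \<in> T" "y \<in> T" for x y
        using that S.m_closed[of "\<phi> x" "\<phi> y"] by (auto simp: T_def ts)
      show "\<one>\<^bsub>add_monoid M\<^esub> \<in> T" using S.one_closed by (auto simp: T_def ts)
      show "inv\<^bsub>add_monoid M\<^esub> x \<in> T" if "x \<in> T" for x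
      proof -
        have x: "x \<in> carrier M" "\<phi> x \<in> S" using that by (auto simp: T_def)
        have "\<ominus>\<^bsub>?N\<^esub> (\<phi> x) = \<phi> (\<ominus>\<^bsub>M\<^esub> x)"
          using x by (intro N.minus_equality) (auto simp: ts M.l_neg)
        moreover have "\<ominus>\<^bsub>?N\<^esub> (\<phi> x) \<in> S" using S.m_inv_closed[OF x(2)] by (simp add: a_inv_def)
        ultimately show ?thesis using x by (simp add: T_def a_inv_def[symmetric])
      qed
      show "a \<odot>\<^bsub>M\<^esub> x \<in> T" if "a \<in> carrier R" "x \<in> T" for a x
        using that S.smult_closed[of a "\<phi> x"] by (auto simp: T_def ts smult_closed)
    qed
    then have "T = {\<zero>\<^bsub>M\<^esub>} \<or> T = carrier M" using M by (auto simp: simple_module_def)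
    then show ?thesis by (auto simp: ST ts)
  qed
  show ?thesis unfolding simple_module_def
    using lm rx nz sub by (auto simp: ts)
qed

lemma simple_module_cyclic:
  assumes M: "simple_module R M"
  obtains m where "m \<in> carrier M" "carrier M = (\<lambda>r. r \<odot>\<^bsub>M\<^esub> m) ` carrier R"
proof -
  interpret left_module R M using M by (simp add: simple_module_def)
  obtain r m where rm: "r \<in> carrier R" "m \<in> carrier M" "r \<odot>\<^bsub>M\<^esub> m \<noteq> \<zero>\<^bsub>M\<^esub>"
    using M by (auto simp: simple_module_def)
  let ?S = "(\<lambda>r. r \<odot>\<^bsub>M\<^esub> m) ` carrier R"
  have z: "\<zero>\<^bsub>R\<^esub> \<odot>\<^bsub>M\<^esub> m = \<zero>\<^bsub>M\<^esub>"
    using smult_l_distr[of "\<zero>\<^bsub>R\<^esub>" "\<zero>\<^bsub>R\<^esub>" m] rm smult_closed[of "\<zero>\<^bsub>R\<^esub>" m]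
    by (metis M.add.l_cancel_one R.l_zero R.zero_closed)
  have "submodule ?S R M"
  proof (intro submodule.intro subgroup.intro submodule_axioms.intro)
    show "?S \<subseteq> carrier (add_monoid M)" using rm by (auto simp: smult_closed)
    show "x \<otimes>\<^bsub>add_monoid M\<^esub> y \<in> ?S" if "x \<in> ?S" "y \<in> ?S" for x y
      using that rm by (auto simp: smult_l_distr[symmetric])
    show "\<one>\<^bsub>add_monoid M\<^esub> \<in> ?S" using z by (auto intro: rev_image_eqI[of "\<zero>\<^bsub>R\<^esub>"])
    show "inv\<^bsub>add_monoid M\<^esub> x \<in> ?S" if xS: "x \<in> ?S" for x
    proof -
      obtain a where a: "a \<in> carrier R" "x = a \<odot>\<^bsub>M\<^esub> m" using xS by auto
      have "\<ominus>\<^bsub>M\<^esub> x = (\<ominus>\<^bsub>R\<^esub> a) \<odot>\<^bsub>M\<^esub> m"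
        using a rm z smult_l_distr[of "\<ominus>\<^bsub>R\<^esub> a" a m]
        by (intro M.minus_equality) (auto simp: smult_closed R.l_neg)
      then show ?thesis using a by (auto simp: a_inv_def)
    qed
    show "a \<odot>\<^bsub>M\<^esub> x \<in> ?S" if "a \<in> carrier R" "x \<in> ?S" for a x
      using that rm by (auto simp: smult_assoc[symmetric])
  qed
  then have "?S = {\<zero>\<^bsub>M\<^esub>} \<or> ?S = carrier M" using M by (auto simp: simple_module_def)
  then have "carrier M = ?S" using rm by auto
  with rm that show thesis by blast
qed

lemma primitive_ringI:
  fixes R :: "('a, 'x) ring_scheme" and M :: "('a, 'm, 'y) module_scheme"
  assumes M: "simple_module R M" and F: "faithful_module R M"
  shows "primitive_ring R"
proof -
  interpret left_module R M using M by (simp add: simple_module_def)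
  obtain m where m: "m \<in> carrier M" "carrier M = (\<lambda>r. r \<odot>\<^bsub>M\<^esub> m) ` carrier R"
    by (rule simple_module_cyclic[OF M])
  define \<phi> where "\<phi> x = {r \<in> carrier R. r \<odot>\<^bsub>M\<^esub> m = x}" for x
  have inj: "inj_on \<phi> (carrier M)"
    using m by (auto simp: inj_on_def \<phi>_def)
  let ?N = "transport_module \<phi> M"
  note ts = transport_simps[OF inj]
  have "faithful_module R ?N" unfolding faithful_module_def
  proof (intro conjI ballI impI)
    show "left_module R ?N" by (rule left_module_transport[OF _ inj]) unfold_locales
    fix r assume r: "r \<in> carrier R" and ann: "\<forall>x\<in>carrier ?N. r \<odot>\<^bsub>?N\<^esub> x = \<zero>\<^bsub>?N\<^esub>"
    have "r \<odot>\<^bsub>M\<^esub> x = \<zero>\<^bsub>M\<^esub>" if x: "x \<in> carrier M" for x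
      using ann x r by (intro inj_onD[OF inj]) (auto simp: ts smult_closed)
    then show "r = \<zero>\<^bsub>R\<^esub>" using F r by (auto simp: faithful_module_def)
  qed
  with simple_module_transport[OF M inj] show ?thesis
    by (auto simp: primitive_ring_def)
qed

definition simple_ring :: "('a, 'x) ring_scheme \<Rightarrow> bool" where
  "simple_ring R \<longleftrightarrow>
     ring R \<and>
     (\<exists>x\<in>carrier R. \<exists>y\<in>carrier R. x \<otimes>\<^bsub>R\<^esub> y \<noteq> \<zero>\<^bsub>R\<^esub>) \<and>
     (\<forall>I. ideal I R \<longrightarrow> I = {\<zero>\<^bsub>R\<^esub>} \<or> I = carrier R)"

definition minimal_left_ideal :: "'a set \<Rightarrow> ('a, 'x) ring_scheme \<Rightarrow> bool" where
  "minimal_left_ideal L R \<longleftrightarrow>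
     submodule L R (regular_module R) \<and>
     simple_module R ((regular_module R)\<lparr>carrier := L\<rparr>)"

definition CCR_ring :: "('a, 'x) ring_scheme \<Rightarrow> bool" where
  "CCR_ring R \<longleftrightarrow>
     ring R \<and>
     (\<forall>I. ideal I R \<and> primitive_ring (R Quot I) \<longrightarrow>
        simple_ring (R Quot I) \<and> (\<exists>L. minimal_left_ideal L (R Quot I)))"


section \<open>Bases and dimension\<close>

definition lin_span ::
  "('k, 'x) ring_scheme \<Rightarrow> ('k, 'm, 'y) module_scheme \<Rightarrow> 'm set \<Rightarrow> 'm set" where
  "lin_span K V B =
     {\<Oplus>\<^bsub>V\<^esub>b\<in>F. c b \<odot>\<^bsub>V\<^esub> b | F c. finite F \<and> F \<subseteq> B \<and> c \<in> F \<rightarrow> carrier K}"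

definition lin_indep ::
  "('k, 'x) ring_scheme \<Rightarrow> ('k, 'm, 'y) module_scheme \<Rightarrow> 'm set \<Rightarrow> bool" where
  "lin_indep K V B \<longleftrightarrow>
     (\<forall>F c. finite F \<and> F \<subseteq> B \<and> c \<in> F \<rightarrow> carrier K \<and> (\<Oplus>\<^bsub>V\<^esub>b\<in>F. c b \<odot>\<^bsub>V\<^esub> b) = \<zero>\<^bsub>V\<^esub> \<longrightarrow>
        (\<forall>b\<in>F. c b = \<zero>\<^bsub>K\<^esub>))"

definition lin_basis ::
  "('k, 'x) ring_scheme \<Rightarrow> ('k, 'm, 'y) module_scheme \<Rightarrow> 'm set \<Rightarrow> bool" where
  "lin_basis K V B \<longleftrightarrow> B \<subseteq> carrier V \<and> lin_indep K V B \<and> lin_span K V B = carrier V"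

definition dim_at_most ::
  "('k, 'x) ring_scheme \<Rightarrow> ('k, 'm, 'y) module_scheme \<Rightarrow> nat \<Rightarrow> bool" where
  "dim_at_most K V n \<longleftrightarrow> (\<exists>B. lin_basis K V B \<and> finite B \<and> card B \<le> n)"


section \<open>Virtually abelian groups\<close>

definition commutative_subgroup :: "'g set \<Rightarrow> ('g, 'y) monoid_scheme \<Rightarrow> bool" where
  "commutative_subgroup H G \<longleftrightarrow> subgroup H G \<and> comm_group (G\<lparr>carrier := H\<rparr>)"

definition virtually_abelian :: "('g, 'y) monoid_scheme \<Rightarrow> bool" where
  "virtually_abelian G \<longleftrightarrow> group G \<and> (\<exists>A. commutative_subgroup A G \<and> finite (rcosets\<^bsub>G\<^esub> A))"


section \<open>Group algebras\<close>

text \<open>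
  Elements are the finitely supported functions $G \to K$ (extended by \<^const>\<open>undefined\<close> outside
  $G$), multiplied by convolution; the sum runs over the support of the first factor because
  \<^const>\<open>finsum\<close> is only meaningful on finite index sets.
\<close>

definition ga_support ::
  "('k, 'x) ring_scheme \<Rightarrow> ('g, 'y) monoid_scheme \<Rightarrow> ('g \<Rightarrow> 'k) \<Rightarrow> 'g set" where
  "ga_support K G f = {x \<in> carrier G. f x \<noteq> \<zero>\<^bsub>K\<^esub>}"

definition group_algebra ::
  "('k, 'x) ring_scheme \<Rightarrow> ('g, 'y) monoid_scheme \<Rightarrow> ('g \<Rightarrow> 'k) ring" where
  "group_algebra K G =
     \<lparr>carrier = {f \<in> carrier G \<rightarrow>\<^sub>E carrier K. finite (ga_support K G f)},
      monoid.mult = (\<lambda>f g. \<lambda>x\<in>carrier G.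
        \<Oplus>\<^bsub>K\<^esub>y\<in>ga_support K G f. f y \<otimes>\<^bsub>K\<^esub> g (inv\<^bsub>G\<^esub> y \<otimes>\<^bsub>G\<^esub> x)),
      one = (\<lambda>x\<in>carrier G. if x = \<one>\<^bsub>G\<^esub> then \<one>\<^bsub>K\<^esub> else \<zero>\<^bsub>K\<^esub>),
      ring.zero = (\<lambda>x\<in>carrier G. \<zero>\<^bsub>K\<^esub>),
      ring.add = (\<lambda>f g. \<lambda>x\<in>carrier G. f x \<oplus>\<^bsub>K\<^esub> g x)\<rparr>"

definition ga_scalar ::
  "('k, 'x) ring_scheme \<Rightarrow> ('g, 'y) monoid_scheme \<Rightarrow> 'k \<Rightarrow> 'g \<Rightarrow> 'k" where
  "ga_scalar K G k = (\<lambda>x\<in>carrier G. if x = \<one>\<^bsub>G\<^esub> then k else \<zero>\<^bsub>K\<^esub>)"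

lemma (in abelian_monoid) finsum_swap:
  assumes "finite A" "finite B" "\<And>a b. \<lbrakk>a \<in> A; b \<in> B\<rbrakk> \<Longrightarrow> f a b \<in> carrier G"
  shows "(\<Oplus>a\<in>A. \<Oplus>b\<in>B. f a b) = (\<Oplus>b\<in>B. \<Oplus>a\<in>A. f a b)"
  using assms(1,3)
proof (induction A)
  case empty
  then show ?case by simp
next
  case (insert a A)
  have "(\<Oplus>a\<in>insert a A. \<Oplus>b\<in>B. f a b) = (\<Oplus>b\<in>B. f a b) \<oplus> (\<Oplus>a\<in>A. \<Oplus>b\<in>B. f a b)"
    using insert by (intro finsum_insert) (auto intro!: finsum_closed)
  also have "\<dots> = (\<Oplus>b\<in>B. f a b) \<oplus> (\<Oplus>b\<in>B. \<Oplus>a\<in>A. f a b)"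
    using insert by simp
  also have "\<dots> = (\<Oplus>b\<in>B. f a b \<oplus> (\<Oplus>a\<in>A. f a b))"
    using insert by (intro finsum_addf[symmetric]) (auto intro!: finsum_closed)
  also have "\<dots> = (\<Oplus>b\<in>B. \<Oplus>a\<in>insert a A. f a b)"
    using insert by (intro finsum_cong') (auto intro!: finsum_closed finsum_insert[symmetric])
  finally show ?case .
qed

locale group_algebra_loc = K?: ring K + G?: group G
  for K :: "('k, 'x) ring_scheme" (structure) and G :: "('g, 'y) monoid_scheme" (structure)
begin

abbreviation "KG \<equiv> group_algebra K G"
abbreviation "supp \<equiv> ga_support K G"

lemma ga_closed: "\<lbrakk>f \<in> carrier KG; x \<in> carrier G\<rbrakk> \<Longrightarrow> f x \<in> carrier K"
  by (auto simp: group_algebra_def)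

lemma ga_finite: "f \<in> carrier KG \<Longrightarrow> finite (supp f)"
  by (auto simp: group_algebra_def)

lemma ga_ext: "\<lbrakk>f \<in> carrier KG; g \<in> carrier KG; \<And>x. x \<in> carrier G \<Longrightarrow> f x = g x\<rbrakk> \<Longrightarrow> f = g"
  by (auto simp: group_algebra_def intro: PiE_ext)

lemma ga_memI:
  assumes "\<And>x. x \<in> carrier G \<Longrightarrow> f x \<in> carrier K" "finite S"
    "\<And>x. \<lbrakk>x \<in> carrier G; x \<notin> S\<rbrakk> \<Longrightarrow> f x = \<zero>\<^bsub>K\<^esub>"
  shows "(\<lambda>x\<in>carrier G. f x) \<in> carrier KG"
proof -
  have "supp (\<lambda>x\<in>carrier G. f x) \<subseteq> S" using assms by (auto simp: ga_support_def)
  with assms show ?thesis by (auto simp: group_algebra_def intro: finite_subset)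
qed

lemma ga_add: "x \<in> carrier G \<Longrightarrow> (f \<oplus>\<^bsub>KG\<^esub> g) x = f x \<oplus>\<^bsub>K\<^esub> g x"
  by (simp add: group_algebra_def)

lemma ga_zero: "x \<in> carrier G \<Longrightarrow> \<zero>\<^bsub>KG\<^esub> x = \<zero>\<^bsub>K\<^esub>"
  by (simp add: group_algebra_def)

lemma ga_one: "x \<in> carrier G \<Longrightarrow> \<one>\<^bsub>KG\<^esub> x = (if x = \<one>\<^bsub>G\<^esub> then \<one>\<^bsub>K\<^esub> else \<zero>\<^bsub>K\<^esub>)"
  by (simp add: group_algebra_def)

lemma ga_mult:
  assumes f: "f \<in> carrier KG" and g: "g \<in> carrier KG" and x: "x \<in> carrier G"
    and S: "finite S" "supp f \<subseteq> S" "S \<subseteq> carrier G"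
  shows "(f \<otimes>\<^bsub>KG\<^esub> g) x = (\<Oplus>\<^bsub>K\<^esub>y\<in>S. f y \<otimes>\<^bsub>K\<^esub> g (inv\<^bsub>G\<^esub> y \<otimes>\<^bsub>G\<^esub> x))"
proof -
  have "(f \<otimes>\<^bsub>KG\<^esub> g) x = (\<Oplus>\<^bsub>K\<^esub>y\<in>supp f. f y \<otimes>\<^bsub>K\<^esub> g (inv\<^bsub>G\<^esub> y \<otimes>\<^bsub>G\<^esub> x))"
    using x by (simp add: group_algebra_def)
  also have "\<dots> = (\<Oplus>\<^bsub>K\<^esub>y\<in>S. f y \<otimes>\<^bsub>K\<^esub> g (inv\<^bsub>G\<^esub> y \<otimes>\<^bsub>G\<^esub> x))"
    using S x by (intro K.add.finprod_mono_neutral_cong_left)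
      (auto intro!: K.m_closed ga_closed[OF f] ga_closed[OF g] simp: ga_support_def subset_iff
        K.l_null ga_closed[OF g])
  finally show ?thesis .
qed

lemma supp_sub: "supp f \<subseteq> carrier G" by (auto simp: ga_support_def)

lemma supp_mult:
  assumes f: "f \<in> carrier KG" and g: "g \<in> carrier KG"
    and x: "x \<in> carrier G" "x \<notin> (\<lambda>(y, z). y \<otimes>\<^bsub>G\<^esub> z) ` (supp f \<times> supp g)"
  shows "(f \<otimes>\<^bsub>KG\<^esub> g) x = \<zero>\<^bsub>K\<^esub>"
proof -
  have "g (inv\<^bsub>G\<^esub> y \<otimes>\<^bsub>G\<^esub> x) = \<zero>\<^bsub>K\<^esub>" if y: "y \<in> supp f" for y
  proof (rule ccontr)
    have yc: "y \<in> carrier G" using y supp_sub by auto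
    assume "g (inv\<^bsub>G\<^esub> y \<otimes>\<^bsub>G\<^esub> x) \<noteq> \<zero>\<^bsub>K\<^esub>"
    then have "inv\<^bsub>G\<^esub> y \<otimes>\<^bsub>G\<^esub> x \<in> supp g" using x yc by (simp add: ga_support_def)
    moreover have "x = y \<otimes>\<^bsub>G\<^esub> (inv\<^bsub>G\<^esub> y \<otimes>\<^bsub>G\<^esub> x)"
      using x yc by (simp add: G.m_assoc[symmetric])
    ultimately show False using x(2) y by force
  qed
  then show ?thesis
    using f x ga_closed[OF f] supp_sub[of f]
    by (subst ga_mult[OF f g x(1) ga_finite[OF f] order_refl supp_sub])
      (auto intro!: K.add.finprod_one_eqI simp: subset_iff)
qed

lemma ga_mult_closed:
  assumes f: "f \<in> carrier KG" and g: "g \<in> carrier KG"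
  shows "f \<otimes>\<^bsub>KG\<^esub> g \<in> carrier KG"
proof -
  have eq: "f \<otimes>\<^bsub>KG\<^esub> g = (\<lambda>x\<in>carrier G. (f \<otimes>\<^bsub>KG\<^esub> g) x)"
    by (simp add: group_algebra_def fun_eq_iff)
  have "(\<lambda>x\<in>carrier G. (f \<otimes>\<^bsub>KG\<^esub> g) x) \<in> carrier KG"
  proof (rule ga_memI)
    show "finite ((\<lambda>(y, z). y \<otimes>\<^bsub>G\<^esub> z) ` (supp f \<times> supp g))"
      using f g by (simp add: ga_finite)
    show "(f \<otimes>\<^bsub>KG\<^esub> g) x \<in> carrier K" if "x \<in> carrier G" for x
      using that supp_sub[of f] ga_closed[OF f] ga_closed[OF g]
      by (subst ga_mult[OF f g that ga_finite[OF f] order_refl supp_sub])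
        (auto intro!: K.finsum_closed)
  qed (rule supp_mult[OF f g])
  then show ?thesis by (subst eq)
qed

lemma ga_add_closed:
  assumes f: "f \<in> carrier KG" and g: "g \<in> carrier KG"
  shows "f \<oplus>\<^bsub>KG\<^esub> g \<in> carrier KG"
proof -
  have "(\<lambda>x\<in>carrier G. f x \<oplus>\<^bsub>K\<^esub> g x) \<in> carrier KG"
    using f g by (intro ga_memI[of _ "supp f \<union> supp g"]) (auto simp: ga_closed ga_finite, auto simp: ga_support_def)
  then show ?thesis by (simp add: group_algebra_def)
qed

lemma ga_zero_closed: "\<zero>\<^bsub>KG\<^esub> \<in> carrier KG"
  using ga_memI[of "\<lambda>_. \<zero>\<^bsub>K\<^esub>" "{}"] by (simp add: group_algebra_def)

lemma ga_one_closed: "\<one>\<^bsub>KG\<^esub> \<in> carrier KG"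
  using ga_memI[of "\<lambda>x. if x = \<one>\<^bsub>G\<^esub> then \<one>\<^bsub>K\<^esub> else \<zero>\<^bsub>K\<^esub>" "{\<one>\<^bsub>G\<^esub>}"]
  by (simp add: group_algebra_def)

lemma ga_neg:
  assumes f: "f \<in> carrier KG"
  shows "\<exists>g\<in>carrier KG. g \<oplus>\<^bsub>KG\<^esub> f = \<zero>\<^bsub>KG\<^esub>"
proof
  let ?g = "\<lambda>x\<in>carrier G. \<ominus>\<^bsub>K\<^esub> f x"
  show g: "?g \<in> carrier KG"
    using f by (intro ga_memI[of _ "supp f"]) (auto simp: ga_closed ga_finite, auto simp: ga_support_def)
  show "?g \<oplus>\<^bsub>KG\<^esub> f = \<zero>\<^bsub>KG\<^esub>"
    using f by (intro ga_ext ga_add_closed g ga_zero_closed)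
      (auto simp: ga_add ga_zero ga_closed K.l_neg)
qed

lemma ga_assoc:
  assumes f: "f \<in> carrier KG" and g: "g \<in> carrier KG" and h: "h \<in> carrier KG"
  shows "(f \<otimes>\<^bsub>KG\<^esub> g) \<otimes>\<^bsub>KG\<^esub> h = f \<otimes>\<^bsub>KG\<^esub> (g \<otimes>\<^bsub>KG\<^esub> h)"
proof (rule ga_ext)
  show "(f \<otimes>\<^bsub>KG\<^esub> g) \<otimes>\<^bsub>KG\<^esub> h \<in> carrier KG" "f \<otimes>\<^bsub>KG\<^esub> (g \<otimes>\<^bsub>KG\<^esub> h) \<in> carrier KG"
    using f g h by (auto intro!: ga_mult_closed)
  fix x assume x: "x \<in> carrier G"
  let ?S = "supp f" and ?U = "supp g"
  define T where "T = (\<lambda>(y, z). y \<otimes>\<^bsub>G\<^esub> z) ` (?S \<times> ?U)"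
  have T: "finite T" "T \<subseteq> carrier G" "supp (f \<otimes>\<^bsub>KG\<^esub> g) \<subseteq> T"
    using f g supp_sub[of f] supp_sub[of g] supp_mult[OF f g]
    by (auto simp: T_def ga_finite) (auto simp: ga_support_def)
  have Sc: "y \<in> carrier G" if "y \<in> ?S" for y using that supp_sub by auto
  have Uc: "y \<in> carrier G" if "y \<in> ?U" for y using that supp_sub by auto
  have Tc: "y \<in> carrier G" if "y \<in> T" for y using that T by auto
  note cl = ga_closed[OF f] ga_closed[OF g] ga_closed[OF h] x
  note [simp] = Sc Tc Uc
  have tc: "f y \<otimes>\<^bsub>K\<^esub> g (inv\<^bsub>G\<^esub> y \<otimes>\<^bsub>G\<^esub> z) \<otimes>\<^bsub>K\<^esub> h (inv\<^bsub>G\<^esub> z \<otimes>\<^bsub>G\<^esub> x) \<in> carrier K"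
    if "y \<in> carrier G" "z \<in> carrier G" for y z
    using that by (intro K.m_closed cl G.m_closed G.inv_closed)
  note fin = ga_finite[OF f] ga_finite[OF g] T(1)
  have "((f \<otimes>\<^bsub>KG\<^esub> g) \<otimes>\<^bsub>KG\<^esub> h) x =
      (\<Oplus>\<^bsub>K\<^esub>z\<in>T. (f \<otimes>\<^bsub>KG\<^esub> g) z \<otimes>\<^bsub>K\<^esub> h (inv\<^bsub>G\<^esub> z \<otimes>\<^bsub>G\<^esub> x))"
    by (rule ga_mult[OF ga_mult_closed[OF f g] h x T(1,3,2)])
  also have "\<dots> = (\<Oplus>\<^bsub>K\<^esub>z\<in>T. \<Oplus>\<^bsub>K\<^esub>y\<in>?S.
      f y \<otimes>\<^bsub>K\<^esub> g (inv\<^bsub>G\<^esub> y \<otimes>\<^bsub>G\<^esub> z) \<otimes>\<^bsub>K\<^esub> h (inv\<^bsub>G\<^esub> z \<otimes>\<^bsub>G\<^esub> x))"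
  proof (rule K.finsum_cong')
    fix z assume z: "z \<in> T"
    show "(f \<otimes>\<^bsub>KG\<^esub> g) z \<otimes>\<^bsub>K\<^esub> h (inv\<^bsub>G\<^esub> z \<otimes>\<^bsub>G\<^esub> x) = (\<Oplus>\<^bsub>K\<^esub>y\<in>?S.
      f y \<otimes>\<^bsub>K\<^esub> g (inv\<^bsub>G\<^esub> y \<otimes>\<^bsub>G\<^esub> z) \<otimes>\<^bsub>K\<^esub> h (inv\<^bsub>G\<^esub> z \<otimes>\<^bsub>G\<^esub> x))"
      using z by (subst ga_mult[OF f g Tc[OF z] fin(1) order_refl supp_sub])
        (auto intro!: K.finsum_ldistr cl fin)
  qed (auto intro!: K.finsum_closed K.m_closed cl)
  also have "\<dots> = (\<Oplus>\<^bsub>K\<^esub>y\<in>?S. \<Oplus>\<^bsub>K\<^esub>z\<in>T.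
      f y \<otimes>\<^bsub>K\<^esub> g (inv\<^bsub>G\<^esub> y \<otimes>\<^bsub>G\<^esub> z) \<otimes>\<^bsub>K\<^esub> h (inv\<^bsub>G\<^esub> z \<otimes>\<^bsub>G\<^esub> x))"
    using fin tc by (intro K.finsum_swap) simp_all
  also have "\<dots> = (\<Oplus>\<^bsub>K\<^esub>y\<in>?S. f y \<otimes>\<^bsub>K\<^esub> (g \<otimes>\<^bsub>KG\<^esub> h) (inv\<^bsub>G\<^esub> y \<otimes>\<^bsub>G\<^esub> x))"
  proof (rule K.finsum_cong')
    fix y assume y: "y \<in> ?S"
    have yc: "y \<in> carrier G" using y by (rule Sc)
    let ?t = "\<lambda>z. f y \<otimes>\<^bsub>K\<^esub> g (inv\<^bsub>G\<^esub> y \<otimes>\<^bsub>G\<^esub> z) \<otimes>\<^bsub>K\<^esub> h (inv\<^bsub>G\<^esub> z \<otimes>\<^bsub>G\<^esub> x)"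
    let ?Y = "(\<lambda>w. y \<otimes>\<^bsub>G\<^esub> w) ` ?U"
    note tcl = tc[OF yc]
    have YT: "?Y \<subseteq> T" using y by (auto simp: T_def)
    have "(\<Oplus>\<^bsub>K\<^esub>z\<in>T. ?t z) = (\<Oplus>\<^bsub>K\<^esub>z\<in>?Y. ?t z)"
    proof (rule K.add.finprod_mono_neutral_cong_right)
      fix z assume z: "z \<in> T - ?Y"
      then have zc: "z \<in> carrier G" by (auto intro: Tc)
      have "z = y \<otimes>\<^bsub>G\<^esub> (inv\<^bsub>G\<^esub> y \<otimes>\<^bsub>G\<^esub> z)" using yc zc by (simp add: G.m_assoc[symmetric])
      then have "inv\<^bsub>G\<^esub> y \<otimes>\<^bsub>G\<^esub> z \<notin> ?U" using z by blast
      then have "g (inv\<^bsub>G\<^esub> y \<otimes>\<^bsub>G\<^esub> z) = \<zero>\<^bsub>K\<^esub>" using yc zc by (simp add: ga_support_def del: Sc Tc Uc)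
      then show "?t z = \<zero>\<^bsub>K\<^esub>" using zc yc by (simp add: cl)
    qed (use YT fin tcl Tc in \<open>simp_all add: Pi_iff\<close>)
    also have "\<dots> = (\<Oplus>\<^bsub>K\<^esub>w\<in>?U. ?t (y \<otimes>\<^bsub>G\<^esub> w))"
    proof (rule K.finsum_reindex)
      show "?t \<in> ?Y \<rightarrow> carrier K" using yc tcl Uc by (intro Pi_I) (auto simp del: G.inv_mult_group)
      show "inj_on (\<lambda>w. y \<otimes>\<^bsub>G\<^esub> w) ?U" using yc Uc by (intro inj_onI) simp
    qed
    also have "\<dots> = (\<Oplus>\<^bsub>K\<^esub>w\<in>?U. f y \<otimes>\<^bsub>K\<^esub> (g w \<otimes>\<^bsub>K\<^esub> h (inv\<^bsub>G\<^esub> w \<otimes>\<^bsub>G\<^esub> (inv\<^bsub>G\<^esub> y \<otimes>\<^bsub>G\<^esub> x))))"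
    proof (rule K.finsum_cong')
      fix w assume w: "w \<in> ?U"
      have wc: "w \<in> carrier G" using w by (rule Uc)
      show "?t (y \<otimes>\<^bsub>G\<^esub> w) = f y \<otimes>\<^bsub>K\<^esub> (g w \<otimes>\<^bsub>K\<^esub> h (inv\<^bsub>G\<^esub> w \<otimes>\<^bsub>G\<^esub> (inv\<^bsub>G\<^esub> y \<otimes>\<^bsub>G\<^esub> x)))"
        using wc yc x G.inv_solve_left'[of w y "y \<otimes>\<^bsub>G\<^esub> w"]
        by (simp add: G.inv_mult_group G.m_assoc cl K.m_assoc)
    qed (use yc in \<open>simp_all add: cl Pi_iff\<close>)
    also have "\<dots> = f y \<otimes>\<^bsub>K\<^esub> (g \<otimes>\<^bsub>KG\<^esub> h) (inv\<^bsub>G\<^esub> y \<otimes>\<^bsub>G\<^esub> x)"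
      using yc x by (subst ga_mult[OF g h _ fin(2) order_refl supp_sub])
        (auto intro!: K.finsum_rdistr[symmetric] cl fin)
    finally show "(\<Oplus>\<^bsub>K\<^esub>z\<in>T. ?t z) = f y \<otimes>\<^bsub>K\<^esub> (g \<otimes>\<^bsub>KG\<^esub> h) (inv\<^bsub>G\<^esub> y \<otimes>\<^bsub>G\<^esub> x)" .
  qed (auto intro!: K.m_closed ga_closed[OF ga_mult_closed[OF g h]] cl)
  also have "\<dots> = (f \<otimes>\<^bsub>KG\<^esub> (g \<otimes>\<^bsub>KG\<^esub> h)) x"
    by (rule ga_mult[OF f ga_mult_closed[OF g h] x fin(1) order_refl supp_sub, symmetric])
  finally show "((f \<otimes>\<^bsub>KG\<^esub> g) \<otimes>\<^bsub>KG\<^esub> h) x = (f \<otimes>\<^bsub>KG\<^esub> (g \<otimes>\<^bsub>KG\<^esub> h)) x" .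
qed

lemma ga_l_one:
  assumes f: "f \<in> carrier KG"
  shows "\<one>\<^bsub>KG\<^esub> \<otimes>\<^bsub>KG\<^esub> f = f"
proof (rule ga_ext)
  fix x assume x: "x \<in> carrier G"
  show "(\<one>\<^bsub>KG\<^esub> \<otimes>\<^bsub>KG\<^esub> f) x = f x"
    by (subst ga_mult[OF ga_one_closed f x, of "{\<one>\<^bsub>G\<^esub>}"])
      (auto simp: ga_support_def ga_one x ga_closed[OF f] split: if_splits)
qed (auto intro!: ga_mult_closed ga_one_closed f)

lemma ga_r_one:
  assumes f: "f \<in> carrier KG"
  shows "f \<otimes>\<^bsub>KG\<^esub> \<one>\<^bsub>KG\<^esub> = f"
proof (rule ga_ext)
  fix x assume x: "x \<in> carrier G"
  have S: "finite (insert x (supp f))" "supp f \<subseteq> insert x (supp f)" "insert x (supp f) \<subseteq> carrier G"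
    using x ga_finite[OF f] supp_sub by auto
  have "(f \<otimes>\<^bsub>KG\<^esub> \<one>\<^bsub>KG\<^esub>) x =
      (\<Oplus>\<^bsub>K\<^esub>y\<in>insert x (supp f). f y \<otimes>\<^bsub>K\<^esub> \<one>\<^bsub>KG\<^esub> (inv\<^bsub>G\<^esub> y \<otimes>\<^bsub>G\<^esub> x))"
    by (rule ga_mult[OF f ga_one_closed x S])
  also have "\<dots> = (\<Oplus>\<^bsub>K\<^esub>y\<in>insert x (supp f). if x = y then f y else \<zero>\<^bsub>K\<^esub>)"
  proof (rule K.finsum_cong')
    fix y assume "y \<in> insert x (supp f)"
    then have y: "y \<in> carrier G" using S by auto
    have "inv\<^bsub>G\<^esub> y \<otimes>\<^bsub>G\<^esub> x = \<one>\<^bsub>G\<^esub> \<longleftrightarrow> x = y"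
      using x y by (metis G.inv_closed G.inv_equality G.inv_inv G.l_inv)
    then show "f y \<otimes>\<^bsub>K\<^esub> \<one>\<^bsub>KG\<^esub> (inv\<^bsub>G\<^esub> y \<otimes>\<^bsub>G\<^esub> x) = (if x = y then f y else \<zero>\<^bsub>K\<^esub>)"
      using x y by (simp add: ga_one ga_closed[OF f])
  qed (use S in \<open>auto simp: ga_closed[OF f]\<close>)
  also have "\<dots> = f x"
    using S x by (intro K.finsum_singleton) (auto simp: ga_closed[OF f])
  finally show "(f \<otimes>\<^bsub>KG\<^esub> \<one>\<^bsub>KG\<^esub>) x = f x" .
qed (auto intro!: ga_mult_closed ga_one_closed f)

lemma ga_l_distr:
  assumes f: "f \<in> carrier KG" and g: "g \<in> carrier KG" and h: "h \<in> carrier KG"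
  shows "(f \<oplus>\<^bsub>KG\<^esub> g) \<otimes>\<^bsub>KG\<^esub> h = f \<otimes>\<^bsub>KG\<^esub> h \<oplus>\<^bsub>KG\<^esub> g \<otimes>\<^bsub>KG\<^esub> h"
proof (rule ga_ext)
  fix x assume x: "x \<in> carrier G"
  let ?S = "supp f \<union> supp g"
  have S: "finite ?S" "supp f \<subseteq> ?S" "supp g \<subseteq> ?S" "?S \<subseteq> carrier G" "supp (f \<oplus>\<^bsub>KG\<^esub> g) \<subseteq> ?S"
    using f g supp_sub by (auto simp: ga_finite) (auto simp: ga_support_def ga_add)
  have Sc: "y \<in> carrier G" if "y \<in> ?S" for y using that S by auto
  have "((f \<oplus>\<^bsub>KG\<^esub> g) \<otimes>\<^bsub>KG\<^esub> h) x =
      (\<Oplus>\<^bsub>K\<^esub>y\<in>?S. (f \<oplus>\<^bsub>KG\<^esub> g) y \<otimes>\<^bsub>K\<^esub> h (inv\<^bsub>G\<^esub> y \<otimes>\<^bsub>G\<^esub> x))"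
    by (rule ga_mult[OF ga_add_closed[OF f g] h x S(1,5,4)])
  also have "\<dots> = (\<Oplus>\<^bsub>K\<^esub>y\<in>?S. f y \<otimes>\<^bsub>K\<^esub> h (inv\<^bsub>G\<^esub> y \<otimes>\<^bsub>G\<^esub> x) \<oplus>\<^bsub>K\<^esub> g y \<otimes>\<^bsub>K\<^esub> h (inv\<^bsub>G\<^esub> y \<otimes>\<^bsub>G\<^esub> x))"
    using S(4) x f g h
    by (intro K.finsum_cong') (auto simp: ga_add ga_closed K.l_distr subset_iff)
  also have "\<dots> = (f \<otimes>\<^bsub>KG\<^esub> h \<oplus>\<^bsub>KG\<^esub> g \<otimes>\<^bsub>KG\<^esub> h) x"
    unfolding ga_add[OF x] ga_mult[OF f h x S(1,2,4)] ga_mult[OF g h x S(1,3,4)]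
    using S(4) x f g h by (intro K.finsum_addf) (auto simp: ga_closed subset_iff)
  finally show "((f \<oplus>\<^bsub>KG\<^esub> g) \<otimes>\<^bsub>KG\<^esub> h) x = (f \<otimes>\<^bsub>KG\<^esub> h \<oplus>\<^bsub>KG\<^esub> g \<otimes>\<^bsub>KG\<^esub> h) x" .
qed (auto intro!: ga_mult_closed ga_add_closed f g h)

lemma ga_r_distr:
  assumes f: "f \<in> carrier KG" and g: "g \<in> carrier KG" and h: "h \<in> carrier KG"
  shows "h \<otimes>\<^bsub>KG\<^esub> (f \<oplus>\<^bsub>KG\<^esub> g) = h \<otimes>\<^bsub>KG\<^esub> f \<oplus>\<^bsub>KG\<^esub> h \<otimes>\<^bsub>KG\<^esub> g"
proof (rule ga_ext)
  fix x assume x: "x \<in> carrier G"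
  let ?S = "supp h"
  have S: "finite ?S" "?S \<subseteq> ?S" "?S \<subseteq> carrier G"
    using h supp_sub by (auto simp: ga_finite)
  have "(h \<otimes>\<^bsub>KG\<^esub> (f \<oplus>\<^bsub>KG\<^esub> g)) x =
      (\<Oplus>\<^bsub>K\<^esub>y\<in>?S. h y \<otimes>\<^bsub>K\<^esub> (f \<oplus>\<^bsub>KG\<^esub> g) (inv\<^bsub>G\<^esub> y \<otimes>\<^bsub>G\<^esub> x))"
    by (rule ga_mult[OF h ga_add_closed[OF f g] x S])
  also have "\<dots> = (\<Oplus>\<^bsub>K\<^esub>y\<in>?S. h y \<otimes>\<^bsub>K\<^esub> f (inv\<^bsub>G\<^esub> y \<otimes>\<^bsub>G\<^esub> x) \<oplus>\<^bsub>K\<^esub> h y \<otimes>\<^bsub>K\<^esub> g (inv\<^bsub>G\<^esub> y \<otimes>\<^bsub>G\<^esub> x))"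
    using S(3) x f g h
    by (intro K.finsum_cong') (auto simp: ga_add ga_closed K.r_distr subset_iff)
  also have "\<dots> = (h \<otimes>\<^bsub>KG\<^esub> f \<oplus>\<^bsub>KG\<^esub> h \<otimes>\<^bsub>KG\<^esub> g) x"
    unfolding ga_add[OF x] ga_mult[OF h f x S] ga_mult[OF h g x S]
    using S(3) x f g h by (intro K.finsum_addf) (auto simp: ga_closed subset_iff)
  finally show "(h \<otimes>\<^bsub>KG\<^esub> (f \<oplus>\<^bsub>KG\<^esub> g)) x = (h \<otimes>\<^bsub>KG\<^esub> f \<oplus>\<^bsub>KG\<^esub> h \<otimes>\<^bsub>KG\<^esub> g) x" .
qed (auto intro!: ga_mult_closed ga_add_closed f g h)

lemma group_algebra_ring: "ring (group_algebra K G)"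
proof (rule ringI)
  show "abelian_group KG"
  proof (rule abelian_groupI)
    show "(f \<oplus>\<^bsub>KG\<^esub> g) \<oplus>\<^bsub>KG\<^esub> h = f \<oplus>\<^bsub>KG\<^esub> (g \<oplus>\<^bsub>KG\<^esub> h)"
      if "f \<in> carrier KG" "g \<in> carrier KG" "h \<in> carrier KG" for f g h
      using that by (intro ga_ext ga_add_closed) (auto simp: ga_add ga_closed K.a_assoc)
    show "f \<oplus>\<^bsub>KG\<^esub> g = g \<oplus>\<^bsub>KG\<^esub> f" if "f \<in> carrier KG" "g \<in> carrier KG" for f g
      using that by (intro ga_ext ga_add_closed) (auto simp: ga_add ga_closed K.a_comm)
    show "\<zero>\<^bsub>KG\<^esub> \<oplus>\<^bsub>KG\<^esub> f = f" if "f \<in> carrier KG" for f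
      using that by (intro ga_ext ga_add_closed ga_zero_closed) (auto simp: ga_add ga_zero ga_closed)
  qed (auto intro: ga_add_closed ga_zero_closed ga_neg)
  show "Group.monoid KG"
    by (rule monoidI) (auto intro: ga_mult_closed ga_one_closed ga_assoc ga_l_one ga_r_one)
qed (auto intro: ga_l_distr ga_r_distr)

end

text \<open>$K$ acts on a module over the group algebra through $k \mapsto k \cdot 1$.\<close>

definition underlying_space ::
  "('k, 'x) ring_scheme \<Rightarrow> ('g, 'y) monoid_scheme \<Rightarrow> ('g \<Rightarrow> 'k, 'm, 'z) module_scheme \<Rightarrow>
   ('k, 'm) module" where
  "underlying_space K G M =
     \<lparr>carrier = carrier M, monoid.mult = monoid.mult M, one = one M,
      ring.zero = ring.zero M, ring.add = ring.add M,
      smult = (\<lambda>k x. ga_scalar K G k \<odot>\<^bsub>M\<^esub> x)\<rparr>"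

end

theory Submission
  imports Defs
begin

text \<open>
  A simple $KG$-module $V$ is generated over $KH$ by finitely many vectors, one for each coset, so it
  has a maximal proper $H$-stable subspace $W$.  Each $h \in H$ acts on $V/W$ by a scalar.  Otherwise
  $h - c$ would be invertible on $V/W$ for every $c \in K$; since polynomials over $K$ split, the
  vectors $(h - c)^{-1} v$ would then be linearly independent modulo $W$, although $V$ is spanned by an
  orbit of $G$, which has fewer than $|K|$ elements.  Hence $V/W$ is one-dimensional and gives a
  functional $\lambda$ on $V$ with $\lambda(hx) = \chi(h) \lambda(x)$.  The $n$ functionals
  $x \mapsto \lambda(tx)$, with $t$ running over a transversal of $H$, have a $G$-stable common kernel,
  which is therefore zero, and so $\dim V \le n$.

  If $A$ is a primitive quotient of $KG$ with faithful simple module $M$, then some finite set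
  $B \subseteq M$, namely a $K$-basis, has zero annihilator in $A$.  A non-zero ideal of $A$ contains
  an element fixing every $b \in B$, which can only be $1$; and the annihilator of a suitable subset of
  $B$ is a left ideal isomorphic to $M$.
\<close>

section \<open>Linear algebra\<close>

lemma (in module) finsum_smult_rdistr:
  assumes "finite I" "f \<in> I \<rightarrow> carrier R" "x \<in> carrier M"
  shows "(\<Oplus>i\<in>I. f i) \<odot>\<^bsub>M\<^esub> x = (\<Oplus>\<^bsub>M\<^esub>i\<in>I. f i \<odot>\<^bsub>M\<^esub> x)"
  using assms
  by (induction I) (auto simp: Pi_def smult_l_distr)

text \<open>Coefficients on a subset extend by zero. With one fixed index set, combinations can be
  added and compared term by term.\<close>

lemma (in module) lin_span_finite:
  assumes B: "finite B" "B \<subseteq> carrier M"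
  shows "lin_span R M B = {\<Oplus>\<^bsub>M\<^esub>b\<in>B. c b \<odot>\<^bsub>M\<^esub> b | c. c \<in> B \<rightarrow> carrier R}" (is "_ = ?T")
proof
  show "?T \<subseteq> lin_span R M B" using B by (auto simp: lin_span_def)
  show "lin_span R M B \<subseteq> ?T"
  proof
    fix x assume "x \<in> lin_span R M B"
    then obtain F c where F: "finite F" "F \<subseteq> B" "c \<in> F \<rightarrow> carrier R"
      "x = (\<Oplus>\<^bsub>M\<^esub>b\<in>F. c b \<odot>\<^bsub>M\<^esub> b)" by (auto simp: lin_span_def)
    let ?c = "\<lambda>b. if b \<in> F then c b else \<zero>"
    have "x = (\<Oplus>\<^bsub>M\<^esub>b\<in>B. ?c b \<odot>\<^bsub>M\<^esub> b)"
      unfolding F(4) using B F(1-3)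
      by (intro M.add.finprod_mono_neutral_cong_left) (auto simp: Pi_iff subset_iff)
    moreover have "?c \<in> B \<rightarrow> carrier R" using F by auto
    ultimately show "x \<in> ?T" by (intro CollectI exI[of _ ?c] conjI)
  qed
qed

lemma (in module) lin_indep_finiteI:
  assumes B: "finite B" "B \<subseteq> carrier M"
    and ind: "\<And>c. c \<in> B \<rightarrow> carrier R \<Longrightarrow> (\<Oplus>\<^bsub>M\<^esub>b\<in>B. c b \<odot>\<^bsub>M\<^esub> b) = \<zero>\<^bsub>M\<^esub> \<Longrightarrow> \<forall>b\<in>B. c b = \<zero>"
  shows "lin_indep R M B"
  unfolding lin_indep_def
proof (intro allI impI, elim conjE)
  fix F c assume F: "finite F" "F \<subseteq> B" "c \<in> F \<rightarrow> carrier R"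
    "(\<Oplus>\<^bsub>M\<^esub>b\<in>F. c b \<odot>\<^bsub>M\<^esub> b) = \<zero>\<^bsub>M\<^esub>"
  let ?c = "\<lambda>b. if b \<in> F then c b else \<zero>"
  have "(\<Oplus>\<^bsub>M\<^esub>b\<in>F. c b \<odot>\<^bsub>M\<^esub> b) = (\<Oplus>\<^bsub>M\<^esub>b\<in>B. ?c b \<odot>\<^bsub>M\<^esub> b)"
    using B F(1-3) by (intro M.add.finprod_mono_neutral_cong_left) (auto simp: Pi_iff subset_iff)
  then have "\<forall>b\<in>B. ?c b = \<zero>" using F by (intro ind) auto
  then show "\<forall>b\<in>F. c b = \<zero>" using F(2) by (metis subsetD)
qed

lemma (in module) submodule_finsum:
  assumes U: "submodule U R M" and I: "finite I" and f: "\<And>i. i \<in> I \<Longrightarrow> f i \<in> U"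
  shows "(\<Oplus>\<^bsub>M\<^esub>i\<in>I. f i) \<in> U"
  using I f
proof (induction I)
  case empty
  then show ?case using submodule.axioms(1)[OF U] subgroup.one_closed by force
next
  case (insert i I)
  note c = submoduleE[OF U]
  have "(\<Oplus>\<^bsub>M\<^esub>j\<in>insert i I. f j) = f i \<oplus>\<^bsub>M\<^esub> (\<Oplus>\<^bsub>M\<^esub>j\<in>I. f j)"
    using insert c(1) by (intro M.finsum_insert) auto
  then show ?case using insert c(5) by auto
qed

lemma (in module) lin_span_submodule:
  assumes S: "S \<subseteq> carrier M"
  shows "submodule (lin_span R M S) R M"
proof (rule submoduleI)
  show "lin_span R M S \<subseteq> carrier M"
    using S by (fastforce simp: lin_span_def intro!: M.finsum_closed)
  show "\<zero>\<^bsub>M\<^esub> \<in> lin_span R M S"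
    by (auto simp: lin_span_def intro!: exI[of _ "{}"])
  have sm: "a \<odot>\<^bsub>M\<^esub> x \<in> lin_span R M S" if a: "a \<in> carrier R" and x: "x \<in> lin_span R M S" for a x
  proof -
    obtain F c where F: "finite F" "F \<subseteq> S" "c \<in> F \<rightarrow> carrier R"
      "x = (\<Oplus>\<^bsub>M\<^esub>b\<in>F. c b \<odot>\<^bsub>M\<^esub> b)" using x by (auto simp: lin_span_def)
    have "a \<odot>\<^bsub>M\<^esub> x = (\<Oplus>\<^bsub>M\<^esub>b\<in>F. a \<odot>\<^bsub>M\<^esub> (c b \<odot>\<^bsub>M\<^esub> b))"
      unfolding F(4) using F S a by (intro finsum_smult_ldistr) auto
    also have "\<dots> = (\<Oplus>\<^bsub>M\<^esub>b\<in>F. (a \<otimes> c b) \<odot>\<^bsub>M\<^esub> b)"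
      using F S a by (intro M.finsum_cong') (auto simp: smult_assoc1 Pi_iff subset_iff)
    finally show ?thesis using F a unfolding lin_span_def
      by (intro CollectI exI[of _ F] exI[of _ "\<lambda>b. a \<otimes> c b"]) auto
  qed
  then show "\<And>a x. a \<in> carrier R \<Longrightarrow> x \<in> lin_span R M S \<Longrightarrow> a \<odot>\<^bsub>M\<^esub> x \<in> lin_span R M S" .
  show "\<ominus>\<^bsub>M\<^esub> x \<in> lin_span R M S" if "x \<in> lin_span R M S" for x
    using sm[of "\<ominus> \<one>" x] that \<open>lin_span R M S \<subseteq> carrier M\<close> by (auto simp: smult_l_minus)
  show "x \<oplus>\<^bsub>M\<^esub> y \<in> lin_span R M S" if x: "x \<in> lin_span R M S" and y: "y \<in> lin_span R M S" for x y
  proof -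
    obtain F c where F: "finite F" "F \<subseteq> S" "c \<in> F \<rightarrow> carrier R"
      "x = (\<Oplus>\<^bsub>M\<^esub>b\<in>F. c b \<odot>\<^bsub>M\<^esub> b)" using x by (auto simp: lin_span_def)
    obtain E d where E: "finite E" "E \<subseteq> S" "d \<in> E \<rightarrow> carrier R"
      "y = (\<Oplus>\<^bsub>M\<^esub>b\<in>E. d b \<odot>\<^bsub>M\<^esub> b)" using y by (auto simp: lin_span_def)
    \<comment> \<open>The two combinations may have different supports; over the common finite set
      \<open>F \<union> E\<close> their coefficients add pointwise.\<close>
    have FE: "finite (F \<union> E)" "F \<union> E \<subseteq> carrier M" using F E S by auto
    have "x \<in> lin_span R M (F \<union> E)" "y \<in> lin_span R M (F \<union> E)"
      unfolding F(4) E(4) lin_span_def using F E by blast+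
    then obtain a b where ab: "a \<in> F \<union> E \<rightarrow> carrier R" "b \<in> F \<union> E \<rightarrow> carrier R"
      "x = (\<Oplus>\<^bsub>M\<^esub>z\<in>F\<union>E. a z \<odot>\<^bsub>M\<^esub> z)" "y = (\<Oplus>\<^bsub>M\<^esub>z\<in>F\<union>E. b z \<odot>\<^bsub>M\<^esub> z)"
      unfolding lin_span_finite[OF FE] by blast
    have "x \<oplus>\<^bsub>M\<^esub> y = (\<Oplus>\<^bsub>M\<^esub>z\<in>F\<union>E. a z \<odot>\<^bsub>M\<^esub> z \<oplus>\<^bsub>M\<^esub> b z \<odot>\<^bsub>M\<^esub> z)"
      unfolding ab(3,4) using ab(1,2) FE by (intro M.finsum_addf[symmetric]) auto
    also have "\<dots> = (\<Oplus>\<^bsub>M\<^esub>z\<in>F\<union>E. (a z \<oplus> b z) \<odot>\<^bsub>M\<^esub> z)"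
      using ab(1,2) FE by (intro M.finsum_cong') (auto simp: smult_l_distr Pi_iff subset_iff)
    finally show ?thesis using FE(1) F(2) E(2) ab(1,2) unfolding lin_span_def
      by (intro CollectI exI[of _ "F \<union> E"] exI[of _ "\<lambda>z. a z \<oplus> b z"]) auto
  qed
qed

lemma (in module) lin_span_incl:
  assumes S: "S \<subseteq> carrier M"
  shows "S \<subseteq> lin_span R M S"
proof
  fix s assume "s \<in> S"
  then show "s \<in> lin_span R M S" using S unfolding lin_span_def
    by (intro CollectI exI[of _ "{s}"] exI[of _ "\<lambda>_. \<one>"]) auto
qed

lemma (in module) lin_span_insertE:
  assumes F: "finite F" "insert f F \<subseteq> carrier M" "f \<notin> F" and x: "x \<in> lin_span R M (insert f F)"
  obtains k w where "k \<in> carrier R" "w \<in> lin_span R M F" "x = k \<odot>\<^bsub>M\<^esub> f \<oplus>\<^bsub>M\<^esub> w"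
proof -
  obtain c where c: "c \<in> insert f F \<rightarrow> carrier R" "x = (\<Oplus>\<^bsub>M\<^esub>b\<in>insert f F. c b \<odot>\<^bsub>M\<^esub> b)"
    using x F by (auto simp: lin_span_finite)
  have "x = c f \<odot>\<^bsub>M\<^esub> f \<oplus>\<^bsub>M\<^esub> (\<Oplus>\<^bsub>M\<^esub>b\<in>F. c b \<odot>\<^bsub>M\<^esub> b)"
    unfolding c(2) using F c(1) by (intro M.finsum_insert) auto
  moreover have "(\<Oplus>\<^bsub>M\<^esub>b\<in>F. c b \<odot>\<^bsub>M\<^esub> b) \<in> lin_span R M F"
    using F c by (subst lin_span_finite) auto
  ultimately show thesis using c(1) that by auto
qed

section \<open>Dependent families, and bases obtained from separating functionals\<close>

locale vector_space_over = K?: field K + module K V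
  for K :: "('k, 'x) ring_scheme" (structure) and V :: "('k, 'm, 'y) module_scheme" (structure)
begin

text \<open>Dependence is stated for indexed families, not for sets, so a repeated vector counts as
  a relation. The family of interest is indexed by the scalars $c$ and is not known to be
  injective.\<close>

definition family_dependent :: "'i set \<Rightarrow> ('i \<Rightarrow> 'm) \<Rightarrow> bool" where
  "family_dependent C u \<longleftrightarrow>
     (\<exists>D c. finite D \<and> D \<subseteq> C \<and> c \<in> D \<rightarrow> carrier K \<and>
       (\<Oplus>\<^bsub>V\<^esub>d\<in>D. c d \<odot>\<^bsub>V\<^esub> u d) = \<zero>\<^bsub>V\<^esub> \<and> (\<exists>d\<in>D. c d \<noteq> \<zero>))"

lemma family_dependentI:
  assumes "finite D" "D \<subseteq> C" "c \<in> D \<rightarrow> carrier K"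
    "(\<Oplus>\<^bsub>V\<^esub>d\<in>D. c d \<odot>\<^bsub>V\<^esub> u d) = \<zero>\<^bsub>V\<^esub>" "\<exists>d\<in>D. c d \<noteq> \<zero>"
  shows "family_dependent C u"
  unfolding family_dependent_def using assms by (intro exI[of _ D] exI[of _ c] conjI)

lemma family_dependentE:
  assumes "family_dependent C u"
  obtains D c where "finite D" "D \<subseteq> C" "c \<in> D \<rightarrow> carrier K"
    "(\<Oplus>\<^bsub>V\<^esub>d\<in>D. c d \<odot>\<^bsub>V\<^esub> u d) = \<zero>\<^bsub>V\<^esub>" "\<exists>d\<in>D. c d \<noteq> \<zero>"
  using assms unfolding family_dependent_def by (elim exE conjE)

lemma family_dependent_mono:
  assumes "family_dependent C u" "C \<subseteq> C'"
  shows "family_dependent C' u"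
  using assms(1) by (rule family_dependentE) (rule family_dependentI, use assms(2) in auto)

text \<open>Gaussian elimination, one spanning vector \<open>f\<close> at a time: a pivot
  \<open>u c0\<close> clears the \<open>f\<close>-component of all other members. Working with
  infinite index sets makes the count trivial, since dropping the pivot leaves the set
  infinite.\<close>

lemma infinite_family_dependent:
  assumes "finite F" "F \<subseteq> carrier V" "infinite C" "u \<in> C \<rightarrow> lin_span K V F"
  shows "family_dependent C u"
  using assms
proof (induction F arbitrary: C u)
  case empty
  then obtain d where d: "d \<in> C" by (metis finite.emptyI ex_in_conv)
  have "u d = \<zero>\<^bsub>V\<^esub>" using empty d by (auto simp: lin_span_def)
  then show ?case using d
    by (intro family_dependentI[of "{d}" _ "\<lambda>_. \<one>"]) auto
next
  case (insert f F)
  have Fc: "F \<subseteq> carrier V" "f \<in> carrier V" using insert by auto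
  note SF = submoduleE[OF lin_span_submodule[OF Fc(1)]]
  have "\<exists>k w. k \<in> carrier K \<and> w \<in> lin_span K V F \<and> u x = k \<odot>\<^bsub>V\<^esub> f \<oplus>\<^bsub>V\<^esub> w" if "x \<in> C" for x
    by (rule lin_span_insertE[OF insert(1,4,2) Pi_mem[OF insert(6) that]]) blast
  then obtain \<alpha> w where \<alpha>: "\<And>x. x \<in> C \<Longrightarrow> \<alpha> x \<in> carrier K"
    and w: "\<And>x. x \<in> C \<Longrightarrow> w x \<in> lin_span K V F"
    and u: "\<And>x. x \<in> C \<Longrightarrow> u x = \<alpha> x \<odot>\<^bsub>V\<^esub> f \<oplus>\<^bsub>V\<^esub> w x" by metis
  have wc: "\<And>x. x \<in> C \<Longrightarrow> w x \<in> carrier V" using w SF(1) by blast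
  show ?case
  proof (cases "\<exists>c\<in>C. \<alpha> c \<noteq> \<zero>")
    \<comment> \<open>No member has an \<open>f\<close>-component, so the whole family already lies
      in the span of \<open>F\<close>.\<close>
    case False
    then have "u \<in> C \<rightarrow> lin_span K V F" using u w wc Fc by auto
    then show ?thesis by (rule insert.IH[OF Fc(1) insert(5)])
  next
    case True
    then obtain c0 where c0: "c0 \<in> C" "\<alpha> c0 \<noteq> \<zero>" by blast
    \<comment> \<open>The ratio of \<open>f\<close>-components: subtracting this multiple of the
      pivot from \<open>u x\<close> cancels \<open>f\<close>.\<close>
    define \<beta> where "\<beta> x = \<alpha> x \<otimes> inv\<^bsub>K\<^esub> \<alpha> c0" for x
    have unit: "\<alpha> c0 \<in> Units K" using c0 \<alpha> by (simp add: field_Units)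
    have \<beta>: "\<beta> x \<in> carrier K" "\<beta> x \<otimes> \<alpha> c0 = \<alpha> x" if "x \<in> C" for x
      using \<alpha>[OF that] unit K.Units_closed[OF unit] K.Units_inv_closed[OF unit] K.Units_l_inv[OF unit]
      by (simp_all add: \<beta>_def K.m_assoc)
    define u' where "u' x = u x \<ominus>\<^bsub>V\<^esub> \<beta> x \<odot>\<^bsub>V\<^esub> u c0" for x
    have uc: "u x \<in> carrier V" if "x \<in> C" for x using u[OF that] \<alpha>[OF that] wc[OF that] Fc by auto
    have u': "u' x = w x \<oplus>\<^bsub>V\<^esub> (\<ominus> \<beta> x) \<odot>\<^bsub>V\<^esub> w c0" if x: "x \<in> C" for x
    proof -
      have "\<beta> x \<odot>\<^bsub>V\<^esub> u c0 = \<alpha> x \<odot>\<^bsub>V\<^esub> f \<oplus>\<^bsub>V\<^esub> \<beta> x \<odot>\<^bsub>V\<^esub> w c0"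
        using \<beta>[OF x] wc[OF c0(1)] \<alpha>[OF c0(1)] Fc
        by (simp add: u[OF c0(1)] smult_r_distr smult_assoc1[symmetric])
      then show ?thesis unfolding u'_def u[OF x]
        using \<beta>[OF x] wc[OF c0(1)] wc[OF x] \<alpha>[OF x] Fc
        by (simp add: M.minus_eq M.minus_add smult_l_minus M.a_ac M.r_neg1 M.r_neg2)
    qed
    have "u' \<in> C - {c0} \<rightarrow> lin_span K V F"
      using u' w \<beta> c0(1) by (auto intro!: SF)
    moreover have "infinite (C - {c0})" using insert(5) by simp
    ultimately have "family_dependent (C - {c0}) u'"
      using insert.IH[OF Fc(1)] by blast
    then obtain D b where D: "finite D" "D \<subseteq> C - {c0}" "b \<in> D \<rightarrow> carrier K"
      "(\<Oplus>\<^bsub>V\<^esub>d\<in>D. b d \<odot>\<^bsub>V\<^esub> u' d) = \<zero>\<^bsub>V\<^esub>" "\<exists>d\<in>D. b d \<noteq> \<zero>"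
      by (rule family_dependentE)
    have Dc: "\<And>d. d \<in> D \<Longrightarrow> d \<in> C" "\<And>d. d \<in> D \<Longrightarrow> b d \<in> carrier K" "c0 \<notin> D" using D by auto
    \<comment> \<open>Undoing the elimination in the relation among the \<open>u' d\<close> collects
      the pivot with total coefficient \<open>\<ominus> s\<close>. As \<open>c0\<close> is not in
      \<open>D\<close>, the non-zero coefficient found on \<open>D\<close> survives.\<close>
    define s where "s = (\<Oplus>d\<in>D. b d \<otimes> \<beta> d)"
    have s: "s \<in> carrier K" unfolding s_def using Dc \<beta> by auto
    let ?c = "\<lambda>d. if d = c0 then \<ominus> s else b d"
    have "\<zero>\<^bsub>V\<^esub> = (\<Oplus>\<^bsub>V\<^esub>d\<in>D. b d \<odot>\<^bsub>V\<^esub> u d \<oplus>\<^bsub>V\<^esub> (\<ominus> (b d \<otimes> \<beta> d)) \<odot>\<^bsub>V\<^esub> u c0)"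
      unfolding D(4)[symmetric] using Dc uc c0 \<beta>
      by (intro M.finsum_cong') (auto simp: u'_def M.minus_eq smult_r_distr smult_r_minus smult_l_minus smult_assoc1)
    also have "\<dots> = (\<Oplus>\<^bsub>V\<^esub>d\<in>D. b d \<odot>\<^bsub>V\<^esub> u d) \<oplus>\<^bsub>V\<^esub> (\<Oplus>\<^bsub>V\<^esub>d\<in>D. (\<ominus> (b d \<otimes> \<beta> d)) \<odot>\<^bsub>V\<^esub> u c0)"
      using Dc uc c0 \<beta> by (intro M.finsum_addf) auto
    also have "(\<Oplus>\<^bsub>V\<^esub>d\<in>D. (\<ominus> (b d \<otimes> \<beta> d)) \<odot>\<^bsub>V\<^esub> u c0) = (\<Oplus>d\<in>D. \<ominus> (b d \<otimes> \<beta> d)) \<odot>\<^bsub>V\<^esub> u c0"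
      using Dc D(1) uc c0 \<beta> by (intro finsum_smult_rdistr[symmetric]) auto
    also have "(\<Oplus>d\<in>D. \<ominus> (b d \<otimes> \<beta> d)) = \<ominus> s"
    proof -
      have "(\<Oplus>d\<in>D. \<ominus> \<one> \<otimes> (b d \<otimes> \<beta> d)) = \<ominus> \<one> \<otimes> s"
        unfolding s_def using D(1) Dc \<beta> by (intro K.finsum_rdistr[symmetric]) auto
      moreover have "(\<Oplus>d\<in>D. \<ominus> (b d \<otimes> \<beta> d)) = (\<Oplus>d\<in>D. \<ominus> \<one> \<otimes> (b d \<otimes> \<beta> d))"
        using Dc \<beta> by (intro K.finsum_cong') (auto simp: K.l_minus)
      ultimately show ?thesis using s by (simp add: K.l_minus)
    qed
    also have "(\<Oplus>\<^bsub>V\<^esub>d\<in>D. b d \<odot>\<^bsub>V\<^esub> u d) \<oplus>\<^bsub>V\<^esub> \<ominus> s \<odot>\<^bsub>V\<^esub> u c0 = (\<Oplus>\<^bsub>V\<^esub>d\<in>insert c0 D. ?c d \<odot>\<^bsub>V\<^esub> u d)"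
    proof -
      have "(\<Oplus>\<^bsub>V\<^esub>d\<in>D. ?c d \<odot>\<^bsub>V\<^esub> u d) = (\<Oplus>\<^bsub>V\<^esub>d\<in>D. b d \<odot>\<^bsub>V\<^esub> u d)"
        using Dc uc by (intro M.finsum_cong') auto
      moreover have "(\<Oplus>\<^bsub>V\<^esub>d\<in>insert c0 D. ?c d \<odot>\<^bsub>V\<^esub> u d) = ?c c0 \<odot>\<^bsub>V\<^esub> u c0 \<oplus>\<^bsub>V\<^esub> (\<Oplus>\<^bsub>V\<^esub>d\<in>D. ?c d \<odot>\<^bsub>V\<^esub> u d)"
        using D(1) Dc uc s c0 by (intro M.finsum_insert) auto
      ultimately show ?thesis using D(1) Dc uc s c0 by (simp add: M.a_comm)
    qed
    finally have "(\<Oplus>\<^bsub>V\<^esub>d\<in>insert c0 D. ?c d \<odot>\<^bsub>V\<^esub> u d) = \<zero>\<^bsub>V\<^esub>" by simp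
    moreover have "\<exists>d\<in>insert c0 D. ?c d \<noteq> \<zero>" using D(5) Dc(3) by auto
    ultimately show ?thesis using D(1,2) Dc(2) s c0(1)
      by (intro family_dependentI[of "insert c0 D" _ ?c]) auto
  qed
qed

lemma lin_span_insert_basis:
  assumes B: "finite B" "B \<subseteq> carrier V" "lin_indep K V B" and u: "u \<in> carrier V" "u \<notin> lin_span K V B"
  shows "lin_indep K V (insert u B)"
proof (rule lin_indep_finiteI)
  note SB = submoduleE[OF lin_span_submodule[OF B(2)]]
  have uB: "u \<notin> B" using u lin_span_incl[OF B(2)] by auto
  fix c assume c: "c \<in> insert u B \<rightarrow> carrier K" and z: "(\<Oplus>\<^bsub>V\<^esub>b\<in>insert u B. c b \<odot>\<^bsub>V\<^esub> b) = \<zero>\<^bsub>V\<^esub>"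
  let ?s = "\<Oplus>\<^bsub>V\<^esub>b\<in>B. c b \<odot>\<^bsub>V\<^esub> b"
  have s: "?s \<in> lin_span K V B" using B c by (subst lin_span_finite) auto
  have sc: "?s \<in> carrier V" using s SB(1) by blast
  have e: "c u \<odot>\<^bsub>V\<^esub> u \<oplus>\<^bsub>V\<^esub> ?s = \<zero>\<^bsub>V\<^esub>"
    using z uB B c u by (subst (asm) M.finsum_insert) auto
  have cu: "c u = \<zero>"
  proof (rule ccontr)
    assume "c u \<noteq> \<zero>"
    then have unit: "c u \<in> Units K" using c by (auto simp: field_Units)
    have "c u \<odot>\<^bsub>V\<^esub> u = \<ominus>\<^bsub>V\<^esub> ?s" 
      by (rule M.minus_equality[symmetric, OF e sc smult_closed[OF Pi_mem[OF c insertI1] u(1)]])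
    then have "inv\<^bsub>K\<^esub> c u \<odot>\<^bsub>V\<^esub> (c u \<odot>\<^bsub>V\<^esub> u) \<in> lin_span K V B"
      using s unit by (auto intro!: SB)
    moreover have "inv\<^bsub>K\<^esub> c u \<odot>\<^bsub>V\<^esub> (c u \<odot>\<^bsub>V\<^esub> u) = u"
      using unit u K.Units_closed[OF unit] K.Units_inv_closed[OF unit] by (simp add: smult_assoc1[symmetric])
    ultimately show False using u by simp
  qed
  then have "?s = \<zero>\<^bsub>V\<^esub>" using e sc u by simp
  then have "\<forall>b\<in>B. c b = \<zero>" using B c unfolding lin_indep_def by blast
  with cu show "\<forall>b\<in>insert u B. c b = \<zero>" by simp
qed (use B u in auto)

lemma lin_span_subset_submodule:
  assumes U: "submodule U K V" and B: "B \<subseteq> U"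
  shows "lin_span K V B \<subseteq> U"
  using B by (auto simp: lin_span_def intro!: submodule_finsum[OF U] submoduleE(4)[OF U])

definition linear_functional :: "('m \<Rightarrow> 'k) \<Rightarrow> bool" where
  "linear_functional \<phi> \<longleftrightarrow> \<phi> \<in> carrier V \<rightarrow> carrier K \<and>
     (\<forall>x\<in>carrier V. \<forall>y\<in>carrier V. \<phi> (x \<oplus>\<^bsub>V\<^esub> y) = \<phi> x \<oplus> \<phi> y) \<and>
     (\<forall>k\<in>carrier K. \<forall>x\<in>carrier V. \<phi> (k \<odot>\<^bsub>V\<^esub> x) = k \<otimes> \<phi> x)"

lemma linear_functional_minus:
  assumes "linear_functional \<phi>" "x \<in> carrier V" "y \<in> carrier V"
  shows "\<phi> (x \<ominus>\<^bsub>V\<^esub> y) = \<phi> x \<ominus> \<phi> y"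
proof -
  have "\<phi> (x \<ominus>\<^bsub>V\<^esub> y) = \<phi> (x \<oplus>\<^bsub>V\<^esub> (\<ominus> \<one>) \<odot>\<^bsub>V\<^esub> y)"
    using assms by (simp add: smult_l_minus M.minus_eq)
  also have "\<dots> = \<phi> x \<oplus> (\<ominus> \<one>) \<otimes> \<phi> y"
    using assms unfolding linear_functional_def by simp
  also have "\<dots> = \<phi> x \<ominus> \<phi> y"
    using assms unfolding linear_functional_def by (auto simp: K.l_minus K.minus_eq Pi_iff)
  finally show ?thesis .
qed

text \<open>Separating functionals embed \<open>U\<close> into $K^I$. One functional is removed at a
  time: its kernel in \<open>U\<close> is separated by the others, and \<open>U\<close> exceeds this
  kernel by at most one vector. Keeping \<open>U\<close> arbitrary lets the induction pass to the
  kernel, and the basis and its size come out together.\<close>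

lemma basis_of_separating_functionals:
  assumes "finite I" "\<And>i. i \<in> I \<Longrightarrow> linear_functional (\<phi> i)" "submodule U K V"
    "\<And>x. x \<in> U \<Longrightarrow> (\<And>i. i \<in> I \<Longrightarrow> \<phi> i x = \<zero>) \<Longrightarrow> x = \<zero>\<^bsub>V\<^esub>"
  shows "\<exists>B. finite B \<and> card B \<le> card I \<and> B \<subseteq> U \<and> lin_indep K V B \<and> lin_span K V B = U"
  using assms
proof (induction I arbitrary: U)
  case empty
  then have "U = {\<zero>\<^bsub>V\<^esub>}" using submoduleE(2)[OF empty(2)] by fastforce
  then show ?case by (intro exI[of _ "{}"]) (auto simp: lin_indep_def lin_span_def)
next
  case (insert i I)
  note U = submoduleE[OF insert(5)]
  have lf: "linear_functional (\<phi> i)" using insert by auto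
  have lfc: "\<phi> i x \<in> carrier K" if "x \<in> U" for x using lf that U(1) by (auto simp: linear_functional_def)
  define U' where "U' = {x \<in> U. \<phi> i x = \<zero>}"
  have zU: "\<zero>\<^bsub>V\<^esub> \<in> U" using submodule.axioms(1)[OF insert(5)] subgroup.one_closed by force
  have \<phi>0: "\<phi> i \<zero>\<^bsub>V\<^esub> = \<zero>"
  proof -
    have "\<phi> i (\<zero> \<odot>\<^bsub>V\<^esub> \<zero>\<^bsub>V\<^esub>) = \<zero> \<otimes> \<phi> i \<zero>\<^bsub>V\<^esub>"
      using lf unfolding linear_functional_def by (metis K.zero_closed M.zero_closed)
    then show ?thesis using lfc[OF zU] by simp
  qed
  have U': "submodule U' K V"
  proof (rule submoduleI)
    show "U' \<subseteq> carrier V" using U by (auto simp: U'_def)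
    show "\<zero>\<^bsub>V\<^esub> \<in> U'" using zU \<phi>0 by (auto simp: U'_def)
    show sm: "a \<odot>\<^bsub>V\<^esub> x \<in> U'" if "a \<in> carrier K" "x \<in> U'" for a x
      using that lf U unfolding U'_def linear_functional_def by auto
    show "\<ominus>\<^bsub>V\<^esub> x \<in> U'" if "x \<in> U'" for x
      using sm[of "\<ominus> \<one>" x] that U by (auto simp: smult_l_minus U'_def subset_iff)
    show "x \<oplus>\<^bsub>V\<^esub> y \<in> U'" if "x \<in> U'" "y \<in> U'" for x y
      using that lf U unfolding U'_def linear_functional_def by (simp add: subset_iff)
  qed
  obtain B where B: "finite B" "card B \<le> card I" "B \<subseteq> U'" "lin_indep K V B" "lin_span K V B = U'"
    using insert.IH[OF insert(4) U'] insert(6) by (auto simp: U'_def)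
  show ?case
  proof (cases "U' = U")
    case True
    then show ?thesis using B insert(1,2) by (intro exI[of _ B]) auto
  next
    case False
    then obtain u where u: "u \<in> U" "\<phi> i u \<noteq> \<zero>" by (auto simp: U'_def)
    have uc: "u \<in> carrier V" "B \<subseteq> carrier V" using u U B by (auto simp: U'_def)
    have unit: "\<phi> i u \<in> Units K" using u lfc by (simp add: field_Units)
    have BU: "insert u B \<subseteq> carrier V" using uc by auto
    note S = submoduleE[OF lin_span_submodule[OF BU]]
    have "lin_span K V (insert u B) = U"
    proof
      show "lin_span K V (insert u B) \<subseteq> U"
        using B u by (intro lin_span_subset_submodule insert(5)) (auto simp: U'_def)
      show "U \<subseteq> lin_span K V (insert u B)"
      proof
        fix x assume x: "x \<in> U"
        \<comment> \<open>Chosen so that \<open>\<phi> i\<close> vanishes on $x - ku$, which puts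
          this difference into the span of \<open>B\<close>.\<close>
        define k where "k = \<phi> i x \<otimes> inv\<^bsub>K\<^esub> \<phi> i u"
        have k: "k \<in> carrier K" "k \<otimes> \<phi> i u = \<phi> i x"
          using lfc[OF x] K.Units_closed[OF unit] K.Units_inv_closed[OF unit] K.Units_l_inv[OF unit]
          by (simp_all add: k_def K.m_assoc)
        have xc: "x \<in> carrier V" using x U by auto
        have ku: "k \<odot>\<^bsub>V\<^esub> u \<in> U" using U k u by auto
        have "x \<ominus>\<^bsub>V\<^esub> k \<odot>\<^bsub>V\<^esub> u \<in> U"
          using x ku U by (auto simp: M.minus_eq)
        moreover have "\<phi> i (x \<ominus>\<^bsub>V\<^esub> k \<odot>\<^bsub>V\<^esub> u) = \<zero>"
          using k uc xc lfc[OF x] lf by (subst linear_functional_minus) (auto simp: linear_functional_def K.r_neg K.minus_eq)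
        ultimately have "x \<ominus>\<^bsub>V\<^esub> k \<odot>\<^bsub>V\<^esub> u \<in> lin_span K V B" using B by (auto simp: U'_def)
        also have "lin_span K V B \<subseteq> lin_span K V (insert u B)"
          by (rule lin_span_subset_submodule[OF lin_span_submodule[OF BU]]) (use lin_span_incl[OF BU] in auto)
        finally have "(x \<ominus>\<^bsub>V\<^esub> k \<odot>\<^bsub>V\<^esub> u) \<oplus>\<^bsub>V\<^esub> k \<odot>\<^bsub>V\<^esub> u \<in> lin_span K V (insert u B)"
          using k lin_span_incl[OF BU] by (intro S) auto
        then show "x \<in> lin_span K V (insert u B)"
          using k uc xc by (simp add: M.minus_eq M.a_assoc M.l_neg)
      qed
    qed
    moreover have "lin_indep K V (insert u B)"
      using B uc u by (intro lin_span_insert_basis) (auto simp: U'_def)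
    moreover have "card (insert u B) \<le> card (insert i I)"
      using B insert(1,2) by (metis Suc_le_mono card_insert_disjoint card_insert_le_m1 card_insert_if le_SucI)
    ultimately show ?thesis using B u by (intro exI[of _ "insert u B"]) (auto simp: U'_def)
  qed
qed

end

section \<open>Cardinality and linear dependence\<close>

lemma UN_lepoll_infinite:
  assumes "infinite B" "lepoll I B" "\<And>i. i \<in> I \<Longrightarrow> lepoll (A i) B"
  shows "lepoll (\<Union>i\<in>I. A i) B"
  using assms card_of_UNION_ordLeq_infinite[of B I A] by (simp add: lepoll_def card_of_ordLeq)

lemma lists_lepoll_infinite:
  assumes S: "infinite S"
  shows "lepoll (lists S) S"
proof -
  have sq: "lepoll (S \<times> S) S"
    using card_of_Times_same_infinite[OF S] by (simp add: eqpoll_imp_lepoll eqpoll_iff_card_of_ordIso)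
  have "lepoll {xs \<in> lists S. length xs = n} (S)" for n
  proof (induction n)
    case 0
    have "{xs \<in> lists S. length xs = 0} = {[]}" by auto
    then show ?case using finite_lepoll_infinite[OF S, of "{[]}"] by simp
  next
    case (Suc n)
    have "{xs \<in> lists S. length xs = Suc n}
        \<subseteq> (\<lambda>(x, xs). x # xs) ` (S \<times> {xs \<in> lists S. length xs = n})"
      by (auto simp: length_Suc_conv image_iff)
    then have "lepoll {xs \<in> lists S. length xs = Suc n} (S \<times> {xs \<in> lists S. length xs = n})"
      by (rule subset_image_lepoll)
    also have "lepoll \<dots> (S \<times> S)" by (intro times_lepoll_mono Suc) simp
    finally show ?case using sq lepoll_trans by blast
  qed
  moreover have "(\<Union>n. {xs \<in> lists S. length xs = n}) = lists S" by auto
  moreover have "lepoll (UNIV :: nat set) S" using S by (simp add: infinite_le_lepoll)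
  ultimately show ?thesis using UN_lepoll_infinite[OF S, of UNIV "\<lambda>n. {xs \<in> lists S. length xs = n}"] by simp
qed

text \<open>An infinite \<open>S\<close> has only $|S|$ finite subsets, so if all fibres were
  finite, \<open>C\<close> would be a union of $|S|$ finite sets and hence no larger than
  \<open>S\<close>. For finite \<open>S\<close> this is the ordinary pigeonhole principle.\<close>

lemma infinite_fibre_of_finite_subsets:
  assumes C: "infinite C" "S \<prec> C" and f: "\<And>c. c \<in> C \<Longrightarrow> finite (f c) \<and> f c \<subseteq> S"
  shows "\<exists>F. infinite {c \<in> C. f c = F}"
proof (cases "finite S")
  case True
  have "f ` C \<subseteq> Pow S" using f by auto
  then have "finite (f ` C)" using True by (meson finite_Pow_iff finite_subset)
  then show ?thesis using pigeonhole_infinite[OF C(1)] by blast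
next
  case False
  show ?thesis
  proof (rule ccontr)
    assume "\<not> ?thesis"
    \<comment> \<open>Fibres are indexed by lists through \<open>set xs\<close>. Many lists name the
      same fibre, which does no harm to an upper bound on the union.\<close>
    then have "lepoll {c \<in> C. f c = set xs} S" for xs
      using finite_lepoll_infinite[OF False] by blast
    then have "lepoll (\<Union>xs\<in>lists S. {c \<in> C. f c = set xs}) S"
      by (intro UN_lepoll_infinite False lists_lepoll_infinite)
    moreover have "C \<subseteq> (\<Union>xs\<in>lists S. {c \<in> C. f c = set xs})"
    proof
      fix c assume c: "c \<in> C"
      then obtain xs where "set xs = f c" using f finite_list by metis
      then show "c \<in> (\<Union>xs\<in>lists S. {c \<in> C. f c = set xs})"
        using c f[OF c] by auto
    qed
    ultimately have "lepoll C S" by (meson lepoll_trans subset_imp_lepoll)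
    then show False using C(2) by (meson lesspoll_not_refl lesspoll_trans1)
  qed
qed

lemma (in algebraically_closed) exists_root:
  assumes p: "p \<in> carrier (poly_ring L)" and d: "degree p > 0"
  shows "\<exists>a\<in>carrier L. eval p a = \<zero>"
proof -
  have "size (roots p) = degree p" using roots_over_carrier[OF p] by (simp add: splitted_def)
  then have "roots p \<noteq> {#}" using d by auto
  then obtain a where "a \<in># roots p" by blast
  moreover have "p \<noteq> []" using d by auto
  ultimately show ?thesis using p roots_mem_iff_is_root[OF p] by (auto simp: is_root_def)
qed

text \<open>On a finite field $a \mapsto a^2 - a$ is not injective, hence not surjective, so some
  $X^2 - X - b$ has no root.\<close>

lemma (in algebraically_closed) infinite_carrier: "infinite (carrier L)"
proof
  assume fin: "finite (carrier L)"
  define f where "f a = a \<otimes> a \<oplus> \<ominus> a" for a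
  have "f \<zero> = f \<one>" by (simp add: f_def r_neg)
  then have inj: "\<not> inj_on f (carrier L)" by (metis inj_onD one_closed zero_closed zero_not_one)
  have sub: "f ` carrier L \<subseteq> carrier L" by (auto simp: f_def)
  have "f ` carrier L \<noteq> carrier L"
    using inj eq_card_imp_inj_on[OF fin, of f] by auto
  then obtain b where b: "b \<in> carrier L" "b \<notin> f ` carrier L" using sub by blast
  let ?p = "[\<one>, \<ominus> \<one>, \<ominus> b]"
  have "polynomial (carrier L) ?p"
    using b(1) by (simp add: polynomial_def)
  then have "?p \<in> carrier (poly_ring L)" by (simp only: univ_poly_carrier)
  then obtain a where a: "a \<in> carrier L" "eval ?p a = \<zero>" using exists_root[of ?p] by auto
  have "eval ?p a = f a \<oplus> \<ominus> b"
    using a(1) b(1) by (simp add: f_def numeral_2_eq_2 l_minus a_assoc)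
  then have "f a \<ominus> b = \<zero>" using a(2) by (simp add: a_minus_def)
  moreover have "f a \<in> carrier L" using a(1) by (simp add: f_def)
  ultimately have "f a = b" using b(1) by (simp add: r_right_minus_eq)
  then show False using a b by blast
qed

context vector_space_over
begin

text \<open>The cardinality assumption acts here. Each \<open>u x\<close> uses finitely many vectors
  of \<open>S\<close>; since \<open>S\<close> is smaller than the field, one finite \<open>F\<close>
  serves infinitely many \<open>x\<close>, and these alone are dependent.\<close>

lemma large_family_dependent:
  assumes K: "infinite (carrier K)" and S: "S \<subseteq> carrier V" "S \<prec> carrier K"
    and u: "u \<in> carrier K \<rightarrow> lin_span K V S"
  shows "family_dependent (carrier K) u"
proof -
  have "\<forall>x\<in>carrier K. \<exists>F. finite F \<and> F \<subseteq> S \<and> u x \<in> lin_span K V F"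
  proof
    fix x assume that: "x \<in> carrier K"
    have "u x \<in> lin_span K V S" using u that by auto
    then obtain F c where F: "finite F" "F \<subseteq> S" "c \<in> F \<rightarrow> carrier K"
      "u x = (\<Oplus>\<^bsub>V\<^esub>b\<in>F. c b \<odot>\<^bsub>V\<^esub> b)" by (auto simp: lin_span_def)
    then have "u x \<in> lin_span K V F" unfolding lin_span_def by blast
    with F show "\<exists>F. finite F \<and> F \<subseteq> S \<and> u x \<in> lin_span K V F" by blast
  qed
  from bchoice[OF this] obtain f where
    f: "\<forall>x\<in>carrier K. finite (f x) \<and> f x \<subseteq> S \<and> u x \<in> lin_span K V (f x)" ..
  have "\<exists>F. infinite {x \<in> carrier K. f x = F}"
    using f by (intro infinite_fibre_of_finite_subsets[OF K S(2)]) auto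
  then obtain F where F: "infinite {x \<in> carrier K. f x = F}" ..
  obtain x where "x \<in> {x \<in> carrier K. f x = F}" using infinite_imp_nonempty[OF F] by (auto simp del: mem_Collect_eq)
  then have "finite F" "F \<subseteq> S" using f by auto
  moreover have "u \<in> {x \<in> carrier K. f x = F} \<rightarrow> lin_span K V F" using f by auto
  ultimately have "family_dependent {x \<in> carrier K. f x = F} u"
    using S(1) by (intro infinite_family_dependent[OF _ _ F]) auto
  then show ?thesis by (rule family_dependent_mono) auto
qed

end

section \<open>Resolvents of a linear endomorphism\<close>

locale linear_endomorphism = vector_space_over K V
  for K :: "('k, 'x) ring_scheme" (structure) and V :: "('k, 'm, 'y) module_scheme" (structure) +
  fixes h :: "'m \<Rightarrow> 'm"
  assumes h_closed: "x \<in> carrier V \<Longrightarrow> h x \<in> carrier V"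
    and h_add: "\<lbrakk>x \<in> carrier V; y \<in> carrier V\<rbrakk> \<Longrightarrow> h (x \<oplus>\<^bsub>V\<^esub> y) = h x \<oplus>\<^bsub>V\<^esub> h y"
    and h_smult: "\<lbrakk>k \<in> carrier K; x \<in> carrier V\<rbrakk> \<Longrightarrow> h (k \<odot>\<^bsub>V\<^esub> x) = k \<odot>\<^bsub>V\<^esub> h x"
begin

lemma h_zero: "h \<zero>\<^bsub>V\<^esub> = \<zero>\<^bsub>V\<^esub>"
  using h_smult[of \<zero> "\<zero>\<^bsub>V\<^esub>"] h_closed by simp

lemma h_finsum:
  assumes "finite I" "f \<in> I \<rightarrow> carrier V"
  shows "h (\<Oplus>\<^bsub>V\<^esub>i\<in>I. f i) = (\<Oplus>\<^bsub>V\<^esub>i\<in>I. h (f i))"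
  using assms by (induction I) (auto simp: h_zero h_add h_closed Pi_def)

lemma funpow_closed: "x \<in> carrier V \<Longrightarrow> (h ^^ n) x \<in> carrier V"
  by (induction n) (auto simp: h_closed)

lemma funpow_add':
  "\<lbrakk>x \<in> carrier V; y \<in> carrier V\<rbrakk> \<Longrightarrow> (h ^^ n) (x \<oplus>\<^bsub>V\<^esub> y) = (h ^^ n) x \<oplus>\<^bsub>V\<^esub> (h ^^ n) y"
  by (induction n) (auto simp: h_add funpow_closed)

lemma funpow_smult:
  "\<lbrakk>k \<in> carrier K; x \<in> carrier V\<rbrakk> \<Longrightarrow> (h ^^ n) (k \<odot>\<^bsub>V\<^esub> x) = k \<odot>\<^bsub>V\<^esub> (h ^^ n) x"
  by (induction n) (auto simp: h_smult funpow_closed)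

text \<open>This is $p(h)x$. Lists carry the leading coefficient first, and \<open>coeff p i\<close>
  is the coefficient of $X^i$. Going through \<open>coeff\<close> gives the right value also for
  lists with leading zeros, which occur inside products before normalisation.\<close>

definition poly_op :: "'k list \<Rightarrow> 'm \<Rightarrow> 'm" where
  "poly_op p x = (\<Oplus>\<^bsub>V\<^esub>i\<in>{..<length p}. coeff p i \<odot>\<^bsub>V\<^esub> (h ^^ i) x)"

context
  fixes p assumes p: "set p \<subseteq> carrier K"
begin

text \<open>\<open>coeff\<close> vanishes beyond the length, so polynomials of different lengths can
  be summed over one range.\<close>

lemma poly_op_upto:
  assumes x: "x \<in> carrier V" and N: "length p \<le> N"
  shows "poly_op p x = (\<Oplus>\<^bsub>V\<^esub>i\<in>{..<N}. coeff p i \<odot>\<^bsub>V\<^esub> (h ^^ i) x)"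
  unfolding poly_op_def using p x N
  by (intro M.add.finprod_mono_neutral_cong_left) (auto simp: coeff_length funpow_closed)

lemma poly_op_closed: "x \<in> carrier V \<Longrightarrow> poly_op p x \<in> carrier V"
  using p unfolding poly_op_def by (auto intro!: M.finsum_closed simp: funpow_closed)

lemma poly_op_add:
  assumes "x \<in> carrier V" "y \<in> carrier V"
  shows "poly_op p (x \<oplus>\<^bsub>V\<^esub> y) = poly_op p x \<oplus>\<^bsub>V\<^esub> poly_op p y"
  using p assms unfolding poly_op_def
  by (subst M.finsum_addf[symmetric]) (auto simp: funpow_closed funpow_add' smult_r_distr)

lemma poly_op_smult:
  assumes k: "k \<in> carrier K" and x: "x \<in> carrier V"
  shows "poly_op p (k \<odot>\<^bsub>V\<^esub> x) = k \<odot>\<^bsub>V\<^esub> poly_op p x"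
proof -
  have "k \<odot>\<^bsub>V\<^esub> poly_op p x = (\<Oplus>\<^bsub>V\<^esub>i\<in>{..<length p}. k \<odot>\<^bsub>V\<^esub> (coeff p i \<odot>\<^bsub>V\<^esub> (h ^^ i) x))"
    unfolding poly_op_def using p assms by (intro finsum_smult_ldistr) (auto simp: funpow_closed)
  also have "\<dots> = poly_op p (k \<odot>\<^bsub>V\<^esub> x)"
    unfolding poly_op_def using p assms
    by (intro M.finsum_cong')
      (auto simp: funpow_closed funpow_smult smult_assoc1[symmetric] K.m_comm)
  finally show ?thesis by simp
qed

lemma poly_op_commute:
  assumes x: "x \<in> carrier V"
  shows "poly_op p (h x) = h (poly_op p x)"
proof -
  have "h (poly_op p x) = (\<Oplus>\<^bsub>V\<^esub>i\<in>{..<length p}. h (coeff p i \<odot>\<^bsub>V\<^esub> (h ^^ i) x))"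
    unfolding poly_op_def using p x by (intro h_finsum) (auto simp: funpow_closed)
  also have "\<dots> = poly_op p (h x)"
    unfolding poly_op_def using p x
    by (intro M.finsum_cong') (auto simp: funpow_closed h_smult h_closed funpow_swap1)
  finally show ?thesis by simp
qed

lemma poly_op_scale:
  assumes k: "k \<in> carrier K" and x: "x \<in> carrier V"
  shows "poly_op (map (\<lambda>b. k \<otimes> b) p) x = k \<odot>\<^bsub>V\<^esub> poly_op p x"
proof -
  have "k \<odot>\<^bsub>V\<^esub> poly_op p x = (\<Oplus>\<^bsub>V\<^esub>i\<in>{..<length p}. k \<odot>\<^bsub>V\<^esub> (coeff p i \<odot>\<^bsub>V\<^esub> (h ^^ i) x))"
    unfolding poly_op_def using p assms by (intro finsum_smult_ldistr) (auto simp: funpow_closed)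
  also have "\<dots> = poly_op (map (\<lambda>b. k \<otimes> b) p) x"
    unfolding poly_op_def using p assms
    by (intro M.finsum_cong') (auto simp: scalar_coeff funpow_closed smult_assoc1)
  finally show ?thesis by simp
qed

text \<open>With the leading coefficient first, appending a zero raises every exponent by one: it is
  multiplication by $X$.\<close>

lemma poly_op_append_zero:
  assumes x: "x \<in> carrier V"
  shows "poly_op (p @ [\<zero>]) x = h (poly_op p x)"
proof -
  have c: "coeff (p @ [\<zero>]) i = (case i of 0 \<Rightarrow> \<zero> | Suc j \<Rightarrow> coeff p j)" for i
    using append_coeff[of p "[\<zero>]"] by (cases i) auto
  have "poly_op (p @ [\<zero>]) x = (\<Oplus>\<^bsub>V\<^esub>i\<in>{..<Suc (length p)}. coeff (p @ [\<zero>]) i \<odot>\<^bsub>V\<^esub> (h ^^ i) x)"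
    unfolding poly_op_def by simp
  also have "\<dots> = (\<Oplus>\<^bsub>V\<^esub>i\<in>Suc ` {..<length p}. coeff (p @ [\<zero>]) i \<odot>\<^bsub>V\<^esub> (h ^^ i) x)"
  proof (rule M.add.finprod_mono_neutral_cong_right)
    show "coeff (p @ [\<zero>]) i \<odot>\<^bsub>V\<^esub> (h ^^ i) x = \<zero>\<^bsub>V\<^esub>"
      if "i \<in> {..<Suc (length p)} - Suc ` {..<length p}" for i
      using that x unfolding c by (cases i) auto
  qed (use p x in \<open>auto simp: c funpow_closed h_closed split: nat.split\<close>)
  also have "\<dots> = (\<Oplus>\<^bsub>V\<^esub>i\<in>{..<length p}. coeff (p @ [\<zero>]) (Suc i) \<odot>\<^bsub>V\<^esub> (h ^^ Suc i) x)"
    using p x by (intro M.finsum_reindex) (auto simp: c funpow_closed h_closed)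
  also have "\<dots> = (\<Oplus>\<^bsub>V\<^esub>i\<in>{..<length p}. h (coeff p i \<odot>\<^bsub>V\<^esub> (h ^^ i) x))"
    using p x by (intro M.finsum_cong') (auto simp: c funpow_closed h_smult h_closed)
  also have "\<dots> = h (poly_op p x)"
    unfolding poly_op_def using p x by (intro h_finsum[symmetric]) (auto simp: funpow_closed)
  finally show ?thesis .
qed

end

lemma poly_op_singleton: "\<lbrakk>a \<in> carrier K; x \<in> carrier V\<rbrakk> \<Longrightarrow> poly_op [a] x = a \<odot>\<^bsub>V\<^esub> x"
  by (simp add: poly_op_def lessThan_Suc)

lemma poly_op_poly_add:
  assumes p: "set p \<subseteq> carrier K" and q: "set q \<subseteq> carrier K" and x: "x \<in> carrier V"
  shows "poly_op (poly_add p q) x = poly_op p x \<oplus>\<^bsub>V\<^esub> poly_op q x"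
proof -
  let ?N = "max (length p) (length q)"
  have pq: "set (poly_add p q) \<subseteq> carrier K" by (rule poly_add_in_carrier[OF p q])
  have "poly_op p x \<oplus>\<^bsub>V\<^esub> poly_op q x =
      (\<Oplus>\<^bsub>V\<^esub>i\<in>{..<?N}. coeff p i \<odot>\<^bsub>V\<^esub> (h ^^ i) x \<oplus>\<^bsub>V\<^esub> coeff q i \<odot>\<^bsub>V\<^esub> (h ^^ i) x)"
    unfolding poly_op_upto[OF p x max.cobounded1[of _ "length q"]]
      poly_op_upto[OF q x max.cobounded2[of _ "length p"]]
    using p q x by (intro M.finsum_addf[symmetric]) (auto simp: funpow_closed)
  also have "\<dots> = (\<Oplus>\<^bsub>V\<^esub>i\<in>{..<?N}. coeff (poly_add p q) i \<odot>\<^bsub>V\<^esub> (h ^^ i) x)"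
    using p q x by (intro M.finsum_cong') (auto simp: poly_add_coeff funpow_closed smult_l_distr simp del: poly_add.simps)
  also have "\<dots> = poly_op (poly_add p q) x"
    by (rule poly_op_upto[OF pq x poly_add_length_le, symmetric])
  finally show ?thesis by simp
qed

lemma poly_op_const_mult:
  assumes p: "set p \<subseteq> carrier K" and k: "k \<in> carrier K" and x: "x \<in> carrier V"
  shows "poly_op (poly_mult [k] p) x = k \<odot>\<^bsub>V\<^esub> poly_op p x"
proof -
  have s: "set (map (\<lambda>b. k \<otimes> b) p) \<subseteq> carrier K" using p k by auto
  have "poly_op (poly_mult [k] p) x = poly_op (poly_add (map (\<lambda>b. k \<otimes> b) p) []) x" by simp
  also have "\<dots> = k \<odot>\<^bsub>V\<^esub> poly_op p x"
    using s poly_op_closed[OF p x] k by (subst poly_op_poly_add) (auto simp: x poly_op_scale[OF p k x] poly_op_def[of "[]"])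
  finally show ?thesis .
qed

text \<open>The operator $h - c$, written with the scalar $-c$ to match the polynomial
  \<open>[\<one>, \<ominus> c]\<close>.\<close>

definition shift_op :: "'k \<Rightarrow> 'm \<Rightarrow> 'm" where
  "shift_op c x = h x \<oplus>\<^bsub>V\<^esub> (\<ominus> c) \<odot>\<^bsub>V\<^esub> x"

lemma shift_op_closed: "\<lbrakk>c \<in> carrier K; x \<in> carrier V\<rbrakk> \<Longrightarrow> shift_op c x \<in> carrier V"
  by (simp add: shift_op_def h_closed)

lemma shift_op_add:
  "\<lbrakk>c \<in> carrier K; x \<in> carrier V; y \<in> carrier V\<rbrakk> \<Longrightarrow>
    shift_op c (x \<oplus>\<^bsub>V\<^esub> y) = shift_op c x \<oplus>\<^bsub>V\<^esub> shift_op c y"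
  by (simp add: shift_op_def h_closed h_add smult_r_distr M.a_ac)

lemma shift_op_smult:
  "\<lbrakk>c \<in> carrier K; k \<in> carrier K; x \<in> carrier V\<rbrakk> \<Longrightarrow>
    shift_op c (k \<odot>\<^bsub>V\<^esub> x) = k \<odot>\<^bsub>V\<^esub> shift_op c x"
  by (simp add: shift_op_def h_closed h_smult smult_r_distr smult_assoc1[symmetric] K.m_comm)

lemma poly_op_shift_op:
  assumes p: "set p \<subseteq> carrier K" and c: "c \<in> carrier K" and x: "x \<in> carrier V"
  shows "poly_op p (shift_op c x) = shift_op c (poly_op p x)"
  using assms by (simp add: shift_op_def poly_op_add poly_op_smult poly_op_commute h_closed)

text \<open>The recursion of \<open>poly_mult\<close> on its first factor splits $(X - c)p$ into $Xp
  + (-c)p$. The two summands act as $h$ after $p(h)$ and as a scalar multiple of $p(h)$.\<close>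

lemma poly_op_linear_mult:
  assumes p: "set p \<subseteq> carrier K" and c: "c \<in> carrier K" and x: "x \<in> carrier V"
  shows "poly_op (poly_mult [\<one>, \<ominus> c] p) x = shift_op c (poly_op p x)"
proof -
  have id: "map (\<lambda>b. \<one> \<otimes> b) p = p" using p by (auto intro!: map_idI)
  have s: "set (poly_mult [\<ominus> c] p) \<subseteq> carrier K" using p c by (intro poly_mult_in_carrier) auto
  have "poly_mult [\<one>, \<ominus> c] p = poly_add (p @ [\<zero>]) (poly_mult [\<ominus> c] p)"
    by (subst poly_mult.simps(2)) (simp only: id list.sel list.size add_0 add_Suc_right add_0_right One_nat_def replicate_0 replicate_Suc diff_Suc_Suc diff_zero)
  then have "poly_op (poly_mult [\<one>, \<ominus> c] p) x = poly_op (p @ [\<zero>]) x \<oplus>\<^bsub>V\<^esub> poly_op (poly_mult [\<ominus> c] p) x"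
    using p s x by (simp del: poly_mult.simps poly_add.simps add: poly_op_poly_add)
  then show ?thesis using p c x
    by (simp add: poly_op_append_zero poly_op_const_mult shift_op_def del: poly_mult.simps)
qed

end

text \<open>The quotient $V/W$ is never formed. Being zero in it is expressed as membership in
  \<open>W\<close>, and equality in it as equality up to an error term in \<open>W\<close>;
  stability of \<open>W\<close> lets operators act on the error terms.\<close>

locale invariant_subspace = linear_endomorphism K V h
  for K :: "('k, 'x) ring_scheme" (structure) and V :: "('k, 'm, 'y) module_scheme" (structure) and h +
  fixes W :: "'m set"
  assumes W: "submodule W K V" and h_W: "x \<in> W \<Longrightarrow> h x \<in> W"
begin

lemmas W_simps = submoduleE(1,4,5)[OF W]

lemma W_carrier: "x \<in> W \<Longrightarrow> x \<in> carrier V"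
  using W_simps(1) by auto

lemma poly_op_W:
  assumes "set p \<subseteq> carrier K" "x \<in> W"
  shows "poly_op p x \<in> W"
proof -
  have "(h ^^ n) x \<in> W" for n using assms(2) by (induction n) (auto simp: h_W)
  then show ?thesis unfolding poly_op_def using assms(1)
    by (intro submodule_finsum[OF W] W_simps) auto
qed

lemma shift_op_W: "\<lbrakk>c \<in> carrier K; x \<in> W\<rbrakk> \<Longrightarrow> shift_op c x \<in> W"
  by (auto simp: shift_op_def intro!: W_simps h_W)

text \<open>Over an algebraically closed field a non-zero \<open>p\<close> is a constant times
  linear factors, and a composition of maps injective modulo \<open>W\<close> is injective modulo
  \<open>W\<close>. The induction removes one root at a time and ends at a non-zero constant, which
  is invertible.\<close>

lemma poly_op_injective_mod:
  assumes alg: "algebraically_closed K"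
    and inj: "\<And>c x. \<lbrakk>c \<in> carrier K; x \<in> carrier V; shift_op c x \<in> W\<rbrakk> \<Longrightarrow> x \<in> W"
    and "p \<in> carrier (poly_ring K)" "p \<noteq> []" "x \<in> carrier V" "poly_op p x \<in> W"
  shows "x \<in> W"
  using assms(3-)
proof (induction "length p" arbitrary: p rule: less_induct)
  case less
  interpret alg: algebraically_closed K by (rule alg)
  have pK: "set p \<subseteq> carrier K" using less(2) by (auto simp: univ_poly_carrier[symmetric] polynomial_def)
  show ?case
  proof (cases "degree p > 0")
    case False
    then obtain a where a: "p = [a]" using less(3) by (cases p) auto
    then have aU: "a \<in> Units K"
      using less(2) by (auto simp: univ_poly_carrier[symmetric] polynomial_def field_Units)
    have aW: "a \<odot>\<^bsub>V\<^esub> x \<in> W" using less(4,5) a pK by (simp add: poly_op_singleton)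
    have "x = (inv\<^bsub>K\<^esub> a \<otimes> a) \<odot>\<^bsub>V\<^esub> x" using less(4) K.Units_l_inv[OF aU] by simp
    also have "\<dots> = inv\<^bsub>K\<^esub> a \<odot>\<^bsub>V\<^esub> (a \<odot>\<^bsub>V\<^esub> x)"
      by (rule smult_assoc1[OF K.Units_inv_closed[OF aU] K.Units_closed[OF aU] less(4)])
    also have "\<dots> \<in> W" by (rule W_simps(2)[OF K.Units_inv_closed[OF aU] aW])
    finally show ?thesis .
  next
    case True
    then obtain d where d: "d \<in> carrier K" "eval p d = \<zero>" using alg.exists_root[OF less(2)] by blast
    then have "[\<one>, \<ominus> d] pdivides p"
      using less(2,3) is_root_imp_pdivides[OF less(2), of d] by (auto simp: is_root_def)
    then obtain q where q: "q \<in> carrier (poly_ring K)" "p = poly_mult [\<one>, \<ominus> d] q"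
      by (auto simp: pdivides_def univ_poly_mult)
    have qn: "q \<noteq> []" using q(2) less(3) by (auto simp: poly_mult_zero)
    have qK: "set q \<subseteq> carrier K" using q by (auto simp: univ_poly_carrier[symmetric] polynomial_def)
    have "polynomial (carrier K) [\<one>, \<ominus> d]" using d by (simp add: polynomial_def)
    moreover have "polynomial (carrier K) q" using q(1) by (simp only: univ_poly_carrier)
    ultimately have "degree p = degree [\<one>, \<ominus> d] + degree q"
      using poly_mult_degree_eq[OF carrier_is_subring] qn unfolding q(2) by (simp del: poly_mult.simps)
    then have "length q < length p" using qn less(3) by (cases "length q"; cases "length p") simp_all
    moreover have "poly_op q x \<in> W"
      \<comment> \<open>Here $p(h)x = (h - d)(q(h)x)$, so injectivity of $h - d$ modulo
        \<open>W\<close> passes the hypothesis on to the shorter polynomial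
        \<open>q\<close>.\<close>
      using less(5) unfolding q(2) poly_op_linear_mult[OF qK d(1) less(4)]
      by (rule inj[OF d(1) poly_op_closed[OF qK less(4)]])
    ultimately show ?thesis using less(1) q(1) qn less(4) by blast
  qed
qed

text \<open>Modulo $W$ the vector $u_c$ plays the role of $(h - c)^{-1} v$.  Here $q = \prod_c (X - c)$,
  and $p/q$ is the partial fraction sum $\sum_c a_c/(X - c)$.\<close>

lemma resolvent_combination:
  assumes C: "finite C" "C \<subseteq> carrier K" and a: "a \<in> C \<rightarrow> carrier K - {\<zero>}"
    and v: "v \<in> carrier V" and u: "u \<in> C \<rightarrow> carrier V"
    and uv: "\<And>c. c \<in> C \<Longrightarrow> \<exists>e\<in>W. shift_op c (u c) = v \<oplus>\<^bsub>V\<^esub> e"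
  shows "\<exists>p q. p \<in> carrier (poly_ring K) \<and> q \<in> carrier (poly_ring K) \<and>
    (\<forall>x\<in>carrier K. eval q x = \<zero> \<longleftrightarrow> x \<in> C) \<and> (\<forall>x\<in>C. eval p x \<noteq> \<zero>) \<and>
    (\<exists>e\<in>W. poly_op q (\<Oplus>\<^bsub>V\<^esub>c\<in>C. a c \<odot>\<^bsub>V\<^esub> u c) = poly_op p v \<oplus>\<^bsub>V\<^esub> e)"
  using C a u uv
proof (induction C)
  case empty
  have "\<zero>\<^bsub>V\<^esub> \<in> W" using submodule.axioms(1)[OF W] subgroup.one_closed by force
  moreover have "[\<one>] \<in> carrier (poly_ring K)" "[] \<in> carrier (poly_ring K)"
    by (auto simp: univ_poly_carrier[symmetric] polynomial_def)
  \<comment> \<open>The empty sum of fractions is $0/1$, with error term zero.\<close>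
  ultimately show ?case
    by (intro exI[of _ "[]"] exI[of _ "[\<one>]"] conjI bexI[of _ "\<zero>\<^bsub>V\<^esub>"])
      (auto simp: poly_op_singleton poly_op_def[of "[]"])
next
  case (insert d C)
  let ?s = "\<Oplus>\<^bsub>V\<^esub>c\<in>C. a c \<odot>\<^bsub>V\<^esub> u c"
  have "\<exists>p q. p \<in> carrier (poly_ring K) \<and> q \<in> carrier (poly_ring K) \<and>
    (\<forall>x\<in>carrier K. eval q x = \<zero> \<longleftrightarrow> x \<in> C) \<and> (\<forall>x\<in>C. eval p x \<noteq> \<zero>) \<and>
    (\<exists>e\<in>W. poly_op q ?s = poly_op p v \<oplus>\<^bsub>V\<^esub> e)"
    using insert by (intro insert.IH) auto
  then obtain p q e where pq: "p \<in> carrier (poly_ring K)" "q \<in> carrier (poly_ring K)"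
    "\<And>x. x \<in> carrier K \<Longrightarrow> eval q x = \<zero> \<longleftrightarrow> x \<in> C" "\<And>x. x \<in> C \<Longrightarrow> eval p x \<noteq> \<zero>"
    and e: "e \<in> W" "poly_op q ?s = poly_op p v \<oplus>\<^bsub>V\<^esub> e" by blast
  obtain e' where e': "e' \<in> W" "shift_op d (u d) = v \<oplus>\<^bsub>V\<^esub> e'" using insert.prems(4)[OF insertI1] by blast
  have d: "d \<in> carrier K" "a d \<in> carrier K" "a d \<noteq> \<zero>" "u d \<in> carrier V" using insert by auto
  have pK: "set p \<subseteq> carrier K" and qK: "set q \<subseteq> carrier K"
    using pq by (auto simp: univ_poly_carrier[symmetric] polynomial_def)
  have s: "?s \<in> carrier V" using insert by (intro M.finsum_closed) auto
  have lin: "polynomial (carrier K) [\<one>, \<ominus> d]" "polynomial (carrier K) [a d]"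
    using d by (auto simp: polynomial_def)
  let ?x = "poly_mult [\<one>, \<ominus> d]"
  \<comment> \<open>The new numerator from $p/q + a_d/(X - d) = ((X - d)p + a_d q)/((X -
    d)q)$.\<close>
  define p' where "p' = poly_add (?x p) (poly_mult [a d] q)"
  have xc: "set [\<one>, \<ominus> d] \<subseteq> carrier K" "set [a d] \<subseteq> carrier K" using d by auto
  have mK: "set (?x p) \<subseteq> carrier K" "set (?x q) \<subseteq> carrier K" "set (poly_mult [a d] q) \<subseteq> carrier K"
    by (rule poly_mult_in_carrier[OF xc(1) pK] poly_mult_in_carrier[OF xc(1) qK]
        poly_mult_in_carrier[OF xc(2) qK])+
  note cis = carrier_is_subring
  have P: "polynomial (carrier K) p" "polynomial (carrier K) q"
    using pq(1,2) by (simp_all only: univ_poly_carrier)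
  have "polynomial (carrier K) p'" "polynomial (carrier K) (?x q)"
    unfolding p'_def
    by (rule poly_add_closed[OF cis poly_mult_closed[OF cis lin(1) P(1)] poly_mult_closed[OF cis lin(2) P(2)]],
        rule poly_mult_closed[OF cis lin(1) P(2)])
  then have "p' \<in> carrier (poly_ring K)" "?x q \<in> carrier (poly_ring K)"
    by (simp_all only: univ_poly_carrier)
  moreover have evq: "eval (?x q) x = (x \<oplus> \<ominus> d) \<otimes> eval q x" if "x \<in> carrier K" for x
    using that xc qK d by (subst eval_poly_mult) auto
  have evp: "eval p' x = (x \<oplus> \<ominus> d) \<otimes> eval p x \<oplus> a d \<otimes> eval q x" if "x \<in> carrier K" for x
    unfolding p'_def using that xc mK pK qK d
    by (subst eval_poly_add, simp_all add: eval_poly_mult del: poly_mult.simps poly_add.simps)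
  have evc: "eval p x \<in> carrier K" "eval q x \<in> carrier K" if "x \<in> carrier K" for x
    using that pK qK by (auto intro: eval_in_carrier)
  have nz: "x \<oplus> \<ominus> d \<noteq> \<zero>" if "x \<in> carrier K" "x \<noteq> d" for x
    using that d by (metis K.minus_eq K.r_right_minus_eq)
  have "\<forall>x\<in>carrier K. eval (?x q) x = \<zero> \<longleftrightarrow> x \<in> insert d C"
    using evq evc nz pq(3) d by (auto simp del: poly_mult.simps simp: integral_iff K.r_neg)
  \<comment> \<open>At $x = d$ only $a_d q(d)$ survives, and $q(d) \<noteq> 0$ because $d$ is a new
    pole. At an old pole $q$ vanishes and only $(x - d)p(x)$ survives.\<close>
  moreover have "\<forall>x\<in>insert d C. eval p' x \<noteq> \<zero>"
  proof
    fix x assume x: "x \<in> insert d C"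
    show "eval p' x \<noteq> \<zero>"
    proof (cases "x = d")
      case True
      then show ?thesis using evp d evc pq(3)[of d] insert(2)
        by (simp add: K.r_neg integral_iff)
    next
      case False
      then have xC: "x \<in> C" "x \<in> carrier K" using x insert by auto
      have "eval p' x = (x \<oplus> \<ominus> d) \<otimes> eval p x \<oplus> a d \<otimes> eval q x" by (rule evp[OF xC(2)])
      moreover have "eval q x = \<zero>" using pq(3) xC by simp
      ultimately show ?thesis using nz xC pq(4) False evc d by (simp add: integral_iff)
    qed
  qed
  \<comment> \<open>The error of \<open>u d\<close> passes through $a_d q(h)$ and the old error
    through $h - d$; both stay in \<open>W\<close>.\<close>
  moreover have "poly_op (?x q) (\<Oplus>\<^bsub>V\<^esub>c\<in>insert d C. a c \<odot>\<^bsub>V\<^esub> u c) =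
      poly_op p' v \<oplus>\<^bsub>V\<^esub> (a d \<odot>\<^bsub>V\<^esub> poly_op q e' \<oplus>\<^bsub>V\<^esub> shift_op d e)"
  proof -
    note cl = poly_op_closed[OF pK] poly_op_closed[OF qK] shift_op_closed[OF d(1)] W_carrier[OF e(1)]
      W_carrier[OF e'(1)] d s v
    have "(\<Oplus>\<^bsub>V\<^esub>c\<in>insert d C. a c \<odot>\<^bsub>V\<^esub> u c) = a d \<odot>\<^bsub>V\<^esub> u d \<oplus>\<^bsub>V\<^esub> ?s"
      using insert by (intro M.finsum_insert) auto
    then have "poly_op (?x q) (\<Oplus>\<^bsub>V\<^esub>c\<in>insert d C. a c \<odot>\<^bsub>V\<^esub> u c) =
        shift_op d (poly_op q (a d \<odot>\<^bsub>V\<^esub> u d \<oplus>\<^bsub>V\<^esub> ?s))"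
      using cl by (simp add: poly_op_linear_mult[OF qK] del: poly_mult.simps)
    also have "\<dots> = a d \<odot>\<^bsub>V\<^esub> poly_op q (shift_op d (u d)) \<oplus>\<^bsub>V\<^esub> shift_op d (poly_op q ?s)"
      using cl by (simp add: poly_op_add[OF qK] poly_op_smult[OF qK] shift_op_add shift_op_smult
          poly_op_shift_op[OF qK])
    also have "\<dots> = a d \<odot>\<^bsub>V\<^esub> poly_op q (v \<oplus>\<^bsub>V\<^esub> e') \<oplus>\<^bsub>V\<^esub> shift_op d (poly_op p v \<oplus>\<^bsub>V\<^esub> e)"
      by (simp only: e(2) e'(2))
    also have "\<dots> = (shift_op d (poly_op p v) \<oplus>\<^bsub>V\<^esub> a d \<odot>\<^bsub>V\<^esub> poly_op q v) \<oplus>\<^bsub>V\<^esub>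
        (a d \<odot>\<^bsub>V\<^esub> poly_op q e' \<oplus>\<^bsub>V\<^esub> shift_op d e)"
      using cl by (simp add: poly_op_add[OF qK] shift_op_add smult_r_distr M.a_ac)
    also have "shift_op d (poly_op p v) \<oplus>\<^bsub>V\<^esub> a d \<odot>\<^bsub>V\<^esub> poly_op q v = poly_op p' v"
      unfolding p'_def using mK cl
      by (simp add: poly_op_poly_add poly_op_linear_mult[OF pK] poly_op_const_mult[OF qK]
          del: poly_mult.simps poly_add.simps)
    finally show ?thesis .
  qed
  moreover have "a d \<odot>\<^bsub>V\<^esub> poly_op q e' \<oplus>\<^bsub>V\<^esub> shift_op d e \<in> W"
    using d e e' qK by (intro W_simps poly_op_W shift_op_W) auto
  ultimately show ?case by blast
qed

text \<open>The alternative is failure of injectivity modulo \<open>W\<close> or failure to reach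
  the single vector \<open>v\<close>: the resolvents are only ever applied to \<open>v\<close>. The
  relation among the chosen vectors is found in $V$ itself, where the small spanning set lives, and
  only its consequence for \<open>v\<close> is read modulo \<open>W\<close>.\<close>

lemma exists_noninvertible_shift:
  assumes alg: "algebraically_closed K"
    and S: "S \<subseteq> carrier V" "lin_span K V S = carrier V" "S \<prec> carrier K"
    and v: "v \<in> carrier V" "v \<notin> W"
  shows "\<exists>c\<in>carrier K. (\<exists>x\<in>carrier V - W. shift_op c x \<in> W) \<or>
    \<not> (\<exists>u\<in>carrier V. \<exists>e\<in>W. shift_op c u = v \<oplus>\<^bsub>V\<^esub> e)"
proof (rule ccontr)
  interpret alg: algebraically_closed K by (rule alg)
  assume neg: "\<not> ?thesis"
  then have neg': "\<forall>c\<in>carrier K. \<not> (\<exists>x\<in>carrier V - W. shift_op c x \<in> W) \<and>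
      (\<exists>u\<in>carrier V. \<exists>e\<in>W. shift_op c u = v \<oplus>\<^bsub>V\<^esub> e)"
    by (simp only: bex_simps ball_simps de_Morgan_disj not_not simp_thms)
  have inj: "x \<in> W" if "c \<in> carrier K" "x \<in> carrier V" "shift_op c x \<in> W" for c x
    using bspec[OF neg' that(1)] that(2,3) by auto
  have "\<forall>c\<in>carrier K. \<exists>u. u \<in> carrier V \<and> (\<exists>e\<in>W. shift_op c u = v \<oplus>\<^bsub>V\<^esub> e)"
  proof
    fix c assume "c \<in> carrier K"
    from bspec[OF neg' this] show "\<exists>u. u \<in> carrier V \<and> (\<exists>e\<in>W. shift_op c u = v \<oplus>\<^bsub>V\<^esub> e)"
      by (auto simp only: Bex_def)
  qed
  from bchoice[OF this] obtain u where
    u: "\<forall>c\<in>carrier K. u c \<in> carrier V \<and> (\<exists>e\<in>W. shift_op c (u c) = v \<oplus>\<^bsub>V\<^esub> e)" ..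
  have "family_dependent (carrier K) u"
    by (rule large_family_dependent[OF alg.infinite_carrier S(1,3)]) (use u S(2) in blast)
  then obtain D c where D: "finite D" "D \<subseteq> carrier K" "c \<in> D \<rightarrow> carrier K"
    "(\<Oplus>\<^bsub>V\<^esub>d\<in>D. c d \<odot>\<^bsub>V\<^esub> u d) = \<zero>\<^bsub>V\<^esub>" "\<exists>d\<in>D. c d \<noteq> \<zero>"
    by (rule family_dependentE)
  \<comment> \<open>Zero coefficients are dropped: every remaining $c$ must be a genuine pole of the
    partial fraction sum. \<open>C\<close> is non-empty since the relation is non-trivial.\<close>
  define C where "C = {d \<in> D. c d \<noteq> \<zero>}"
  have CD: "C \<subseteq> D" "finite C" "C \<subseteq> carrier K" using D by (auto simp: C_def)
  have uD: "u d \<in> carrier V" "c d \<in> carrier K" if "d \<in> D" for d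
    using bspec[OF u subsetD[OF D(2) that]] Pi_mem[OF D(3) that] by simp_all
  have "(\<Oplus>\<^bsub>V\<^esub>d\<in>C. c d \<odot>\<^bsub>V\<^esub> u d) = (\<Oplus>\<^bsub>V\<^esub>d\<in>D. c d \<odot>\<^bsub>V\<^esub> u d)"
    using CD D(1) uD by (intro M.add.finprod_mono_neutral_cong_left) (auto simp: C_def)
  then have sum0: "(\<Oplus>\<^bsub>V\<^esub>d\<in>C. c d \<odot>\<^bsub>V\<^esub> u d) = \<zero>\<^bsub>V\<^esub>" using D(4) by simp
  have "\<exists>p q. p \<in> carrier (poly_ring K) \<and> q \<in> carrier (poly_ring K) \<and>
    (\<forall>x\<in>carrier K. eval q x = \<zero> \<longleftrightarrow> x \<in> C) \<and> (\<forall>x\<in>C. eval p x \<noteq> \<zero>) \<and>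
    (\<exists>e\<in>W. poly_op q (\<Oplus>\<^bsub>V\<^esub>d\<in>C. c d \<odot>\<^bsub>V\<^esub> u d) = poly_op p v \<oplus>\<^bsub>V\<^esub> e)"
  proof (rule resolvent_combination[OF CD(2,3) _ v(1)])
    show "c \<in> C \<rightarrow> carrier K - {\<zero>}" using uD(2) by (simp add: C_def Pi_iff)
    show "u \<in> C \<rightarrow> carrier V" using uD(1) CD(1) by blast
    show "\<exists>e\<in>W. shift_op d (u d) = v \<oplus>\<^bsub>V\<^esub> e" if "d \<in> C" for d
      using bspec[OF u subsetD[OF CD(3) that]] by simp
  qed
  then obtain p q where pq: "p \<in> carrier (poly_ring K)" "q \<in> carrier (poly_ring K)"
    "\<forall>x\<in>C. eval p x \<noteq> \<zero>" and "\<exists>e\<in>W. poly_op q \<zero>\<^bsub>V\<^esub> = poly_op p v \<oplus>\<^bsub>V\<^esub> e"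
    unfolding sum0 by (elim exE conjE) (rule that)
  then obtain e where e: "e \<in> W" "poly_op q \<zero>\<^bsub>V\<^esub> = poly_op p v \<oplus>\<^bsub>V\<^esub> e" by blast
  have pK: "set p \<subseteq> carrier K" and qK: "set q \<subseteq> carrier K"
    using pq by (auto simp: univ_poly_carrier[symmetric] polynomial_def)
  \<comment> \<open>The numerator is non-zero at each pole, and there is at least one pole.\<close>
  have pn: "p \<noteq> []"
  proof
    assume "p = []"
    moreover obtain d where "d \<in> C" using D(5) unfolding C_def by blast
    ultimately show False using bspec[OF pq(3)] by simp
  qed
  have zW: "\<zero>\<^bsub>V\<^esub> \<in> W" using submodule.axioms(1)[OF W] subgroup.one_closed by force
  have "poly_op p v = poly_op q \<zero>\<^bsub>V\<^esub> \<oplus>\<^bsub>V\<^esub> \<ominus>\<^bsub>V\<^esub> e"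
    using poly_op_closed[OF pK v(1)] W_carrier[OF e(1)] by (simp add: e(2) M.a_assoc M.r_neg)
  also have "\<dots> \<in> W"
    by (rule W_simps(3)[OF poly_op_W[OF qK zW] submoduleE(3)[OF W e(1)]])
  finally have "poly_op p v \<in> W" .
  have "v \<in> W"
    by (rule poly_op_injective_mod[OF alg _ pq(1) pn v(1) \<open>poly_op p v \<in> W\<close>]) (rule inj)
  with v(2) show False ..
qed

end

section \<open>Sums, chain unions, preimages and images of submodules\<close>

lemma (in module) submodule_zero:
  assumes "submodule U R M" shows "\<zero>\<^bsub>M\<^esub> \<in> U"
  using submodule.axioms(1)[OF assms] subgroup.one_closed by force

lemma (in module) submoduleI':
  assumes "U \<subseteq> carrier M" "\<zero>\<^bsub>M\<^esub> \<in> U"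
    and "\<And>x y. \<lbrakk>x \<in> U; y \<in> U\<rbrakk> \<Longrightarrow> x \<oplus>\<^bsub>M\<^esub> y \<in> U"
    and sm: "\<And>a x. \<lbrakk>a \<in> carrier R; x \<in> U\<rbrakk> \<Longrightarrow> a \<odot>\<^bsub>M\<^esub> x \<in> U"
  shows "submodule U R M"
proof (rule submoduleI)
  fix x assume x: "x \<in> U"
  have "(\<ominus> \<one>) \<odot>\<^bsub>M\<^esub> x \<in> U" by (rule sm[OF R.a_inv_closed[OF R.one_closed] x])
  then show "\<ominus>\<^bsub>M\<^esub> x \<in> U" using assms(1) x by (simp add: smult_l_minus subset_iff)
qed (use assms in auto)

lemma (in module) zero_submodule: "submodule {\<zero>\<^bsub>M\<^esub>} R M"
  by (rule submoduleI') auto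

lemma (in module) submodule_set_sum:
  assumes A: "submodule A R M" and B: "submodule B R M"
  shows "submodule {a \<oplus>\<^bsub>M\<^esub> b | a b. a \<in> A \<and> b \<in> B} R M"
proof (rule submoduleI')
  note a = submoduleE[OF A] and b = submoduleE[OF B]
  have ac: "x \<in> carrier M" if "x \<in> A" for x using a(1) that by auto
  have bc: "x \<in> carrier M" if "x \<in> B" for x using b(1) that by auto
  show "{a \<oplus>\<^bsub>M\<^esub> b | a b. a \<in> A \<and> b \<in> B} \<subseteq> carrier M" using ac bc by auto
  show "\<zero>\<^bsub>M\<^esub> \<in> {a \<oplus>\<^bsub>M\<^esub> b | a b. a \<in> A \<and> b \<in> B}"
    using submodule_zero[OF A] submodule_zero[OF B]
    by (intro CollectI exI[of _ "\<zero>\<^bsub>M\<^esub>"]) simp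
  show "x \<oplus>\<^bsub>M\<^esub> y \<in> {a \<oplus>\<^bsub>M\<^esub> b | a b. a \<in> A \<and> b \<in> B}"
    if x: "x \<in> {a \<oplus>\<^bsub>M\<^esub> b | a b. a \<in> A \<and> b \<in> B}" and y: "y \<in> {a \<oplus>\<^bsub>M\<^esub> b | a b. a \<in> A \<and> b \<in> B}" for x y
  proof -
    obtain p q where p: "p \<in> A" "q \<in> B" "x = p \<oplus>\<^bsub>M\<^esub> q" using x by blast
    obtain r s where r: "r \<in> A" "s \<in> B" "y = r \<oplus>\<^bsub>M\<^esub> s" using y by blast
    have "x \<oplus>\<^bsub>M\<^esub> y = (p \<oplus>\<^bsub>M\<^esub> r) \<oplus>\<^bsub>M\<^esub> (q \<oplus>\<^bsub>M\<^esub> s)"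
      using p r ac bc by (simp add: M.a_ac)
    then show ?thesis using a(5)[OF p(1) r(1)] b(5)[OF p(2) r(2)] by blast
  qed
  show "k \<odot>\<^bsub>M\<^esub> x \<in> {a \<oplus>\<^bsub>M\<^esub> b | a b. a \<in> A \<and> b \<in> B}"
    if k: "k \<in> carrier R" and x: "x \<in> {a \<oplus>\<^bsub>M\<^esub> b | a b. a \<in> A \<and> b \<in> B}" for k x
  proof -
    obtain p q where p: "p \<in> A" "q \<in> B" "x = p \<oplus>\<^bsub>M\<^esub> q" using x by blast
    have "k \<odot>\<^bsub>M\<^esub> x = k \<odot>\<^bsub>M\<^esub> p \<oplus>\<^bsub>M\<^esub> k \<odot>\<^bsub>M\<^esub> q"
      using p k ac bc by (simp add: smult_r_distr)
    then show ?thesis using a(4)[OF k p(1)] b(4)[OF k p(2)] by blast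
  qed
qed

lemma (in module) submodule_subset_set_sum:
  assumes A: "submodule A R M" and B: "submodule B R M"
  shows "A \<subseteq> {a \<oplus>\<^bsub>M\<^esub> b | a b. a \<in> A \<and> b \<in> B}" "B \<subseteq> {a \<oplus>\<^bsub>M\<^esub> b | a b. a \<in> A \<and> b \<in> B}"
proof -
  note c = subsetD[OF submoduleE(1)[OF A]] subsetD[OF submoduleE(1)[OF B]]
  show "A \<subseteq> {a \<oplus>\<^bsub>M\<^esub> b | a b. a \<in> A \<and> b \<in> B}"
  proof
    fix x assume x: "x \<in> A"
    then have "x = x \<oplus>\<^bsub>M\<^esub> \<zero>\<^bsub>M\<^esub>" using c by simp
    then show "x \<in> {a \<oplus>\<^bsub>M\<^esub> b | a b. a \<in> A \<and> b \<in> B}" using x submodule_zero[OF B] by blast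
  qed
  show "B \<subseteq> {a \<oplus>\<^bsub>M\<^esub> b | a b. a \<in> A \<and> b \<in> B}"
  proof
    fix x assume x: "x \<in> B"
    then have "x = \<zero>\<^bsub>M\<^esub> \<oplus>\<^bsub>M\<^esub> x" using c by simp
    then show "x \<in> {a \<oplus>\<^bsub>M\<^esub> b | a b. a \<in> A \<and> b \<in> B}" using x submodule_zero[OF A] by blast
  qed
qed

lemma (in module) submodule_Union_chain:
  assumes ne: "\<C> \<noteq> {}" and ch: "\<And>A B. \<lbrakk>A \<in> \<C>; B \<in> \<C>\<rbrakk> \<Longrightarrow> A \<subseteq> B \<or> B \<subseteq> A"
    and sub: "\<And>A. A \<in> \<C> \<Longrightarrow> submodule A R M"
  shows "submodule (\<Union>\<C>) R M"
proof (rule submoduleI')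
  show "\<Union>\<C> \<subseteq> carrier M" using submoduleE(1)[OF sub] by blast
  obtain A where "A \<in> \<C>" using ne by blast
  then show "\<zero>\<^bsub>M\<^esub> \<in> \<Union>\<C>" using submodule_zero[OF sub] by blast
  show "x \<oplus>\<^bsub>M\<^esub> y \<in> \<Union>\<C>" if x: "x \<in> \<Union>\<C>" and y: "y \<in> \<Union>\<C>" for x y
  proof -
    obtain A B where AB: "A \<in> \<C>" "x \<in> A" "B \<in> \<C>" "y \<in> B" using x y by blast
    obtain D where D: "D \<in> \<C>" "x \<in> D" "y \<in> D" using ch[OF AB(1,3)] AB by blast
    then show ?thesis using submoduleE(5)[OF sub[OF D(1)] D(2,3)] by blast
  qed
  show "a \<odot>\<^bsub>M\<^esub> x \<in> \<Union>\<C>" if a: "a \<in> carrier R" and x: "x \<in> \<Union>\<C>" for a x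
  proof -
    obtain A where A: "A \<in> \<C>" "x \<in> A" using x by blast
    then show ?thesis using submoduleE(4)[OF sub[OF A(1)] a A(2)] by blast
  qed
qed

context linear_endomorphism
begin

lemma linear_endomorphism_shift_op:
  assumes c: "c \<in> carrier K"
  shows "linear_endomorphism K V (shift_op c)"
  by unfold_locales (simp_all add: c shift_op_closed shift_op_add shift_op_smult)

lemma preimage_submodule:
  assumes U: "submodule U K V"
  shows "submodule {x \<in> carrier V. h x \<in> U} K V"
proof (rule submoduleI')
  note u = submoduleE[OF U]
  show "\<zero>\<^bsub>V\<^esub> \<in> {x \<in> carrier V. h x \<in> U}" using submodule_zero[OF U] by (simp add: h_zero)
  show "x \<oplus>\<^bsub>V\<^esub> y \<in> {x \<in> carrier V. h x \<in> U}"
    if "x \<in> {x \<in> carrier V. h x \<in> U}" "y \<in> {x \<in> carrier V. h x \<in> U}" for x y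
    using that by (simp add: h_add u(5))
  show "k \<odot>\<^bsub>V\<^esub> x \<in> {x \<in> carrier V. h x \<in> U}"
    if "k \<in> carrier K" "x \<in> {x \<in> carrier V. h x \<in> U}" for k x
    using that by (simp add: h_smult u(4))
qed auto

lemma image_submodule: "submodule (h ` carrier V) K V"
proof (rule submoduleI')
  show "h ` carrier V \<subseteq> carrier V" using h_closed by blast
  show "\<zero>\<^bsub>V\<^esub> \<in> h ` carrier V" using h_zero M.zero_closed by (metis imageI)
  show "x \<oplus>\<^bsub>V\<^esub> y \<in> h ` carrier V" if xy: "x \<in> h ` carrier V" "y \<in> h ` carrier V" for x y
  proof -
    obtain p q where "p \<in> carrier V" "q \<in> carrier V" "x = h p" "y = h q" using xy by blast
    then show ?thesis by (intro image_eqI[of _ _ "p \<oplus>\<^bsub>V\<^esub> q"]) (simp_all add: h_add)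
  qed
  show "k \<odot>\<^bsub>V\<^esub> x \<in> h ` carrier V" if k: "k \<in> carrier K" and x: "x \<in> h ` carrier V" for k x
  proof -
    obtain p where "p \<in> carrier V" "x = h p" using x by blast
    then show ?thesis using k by (intro image_eqI[of _ _ "k \<odot>\<^bsub>V\<^esub> p"]) (simp_all add: h_smult)
  qed
qed

end

section \<open>Irreducible representations\<close>

text \<open>The group acts by plain $K$-linear maps, so the argument about subspaces and functionals
  is independent of the convolution product. A simple module enters later through the action of the
  group elements inside the group algebra.\<close>

locale representation = vector_space_over K V + G?: group G
  for K :: "('k, 'x) ring_scheme" (structure) and V :: "('k, 'm, 'y) module_scheme" (structure)
    and G :: "('g, 'z) monoid_scheme" (structure) +
  fixes \<rho> :: "'g \<Rightarrow> 'm \<Rightarrow> 'm"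
  assumes rho_closed: "\<lbrakk>g \<in> carrier G; x \<in> carrier V\<rbrakk> \<Longrightarrow> \<rho> g x \<in> carrier V"
    and rho_add: "\<lbrakk>g \<in> carrier G; x \<in> carrier V; y \<in> carrier V\<rbrakk> \<Longrightarrow> \<rho> g (x \<oplus>\<^bsub>V\<^esub> y) = \<rho> g x \<oplus>\<^bsub>V\<^esub> \<rho> g y"
    and rho_smult: "\<lbrakk>g \<in> carrier G; k \<in> carrier K; x \<in> carrier V\<rbrakk> \<Longrightarrow> \<rho> g (k \<odot>\<^bsub>V\<^esub> x) = k \<odot>\<^bsub>V\<^esub> \<rho> g x"
    and rho_mult: "\<lbrakk>g \<in> carrier G; h \<in> carrier G; x \<in> carrier V\<rbrakk> \<Longrightarrow> \<rho> (g \<otimes>\<^bsub>G\<^esub> h) x = \<rho> g (\<rho> h x)"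
    and rho_one: "x \<in> carrier V \<Longrightarrow> \<rho> \<one>\<^bsub>G\<^esub> x = x"
begin

lemma linear_endomorphism_rho: "g \<in> carrier G \<Longrightarrow> linear_endomorphism K V (\<rho> g)"
  by unfold_locales (simp_all add: rho_closed rho_add rho_smult)

text \<open>\<open>H\<close> is any set of group elements, so stability under the subgroup and under
  all of \<open>G\<close> are instances of one notion.\<close>

definition invariant :: "'g set \<Rightarrow> 'm set \<Rightarrow> bool" where
  "invariant H U \<longleftrightarrow> submodule U K V \<and> (\<forall>h\<in>H. \<forall>x\<in>U. \<rho> h x \<in> U)"

definition irreducible_rep :: bool where
  "irreducible_rep \<longleftrightarrow> carrier V \<noteq> {\<zero>\<^bsub>V\<^esub>} \<and>
     (\<forall>U. invariant (carrier G) U \<longrightarrow> U = {\<zero>\<^bsub>V\<^esub>} \<or> U = carrier V)"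

text \<open>The vectors that \<open>\<rho> h\<close> sends into the span form a subspace containing
  \<open>S\<close>, so they contain its span.\<close>

lemma invariant_span:
  assumes H: "H \<subseteq> carrier G" and S: "S \<subseteq> carrier V" and inv: "\<And>h s. \<lbrakk>h \<in> H; s \<in> S\<rbrakk> \<Longrightarrow> \<rho> h s \<in> S"
  shows "invariant H (lin_span K V S)"
  unfolding invariant_def
proof (intro conjI ballI lin_span_submodule[OF S])
  fix h x assume h: "h \<in> H" and x: "x \<in> lin_span K V S"
  interpret h: linear_endomorphism K V "\<rho> h" by (rule linear_endomorphism_rho) (use h H in auto)
  have "lin_span K V S \<subseteq> {x \<in> carrier V. \<rho> h x \<in> lin_span K V S}"
    using S inv[OF h] lin_span_incl[OF S]
    by (intro lin_span_subset_submodule h.preimage_submodule lin_span_submodule) auto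
  then show "\<rho> h x \<in> lin_span K V S" using x by auto
qed

lemma rho_inv_cancel:
  assumes g: "g \<in> carrier G" and x: "x \<in> carrier V"
  shows "\<rho> (inv\<^bsub>G\<^esub> g) (\<rho> g x) = x"
  using assms by (simp add: rho_mult[symmetric] rho_one)

lemma rho_nonzero:
  assumes g: "g \<in> carrier G" and x: "x \<in> carrier V" "x \<noteq> \<zero>\<^bsub>V\<^esub>"
  shows "\<rho> g x \<noteq> \<zero>\<^bsub>V\<^esub>"
proof
  assume gx: "\<rho> g x = \<zero>\<^bsub>V\<^esub>"
  interpret i: linear_endomorphism K V "\<rho> (inv\<^bsub>G\<^esub> g)"
    by (rule linear_endomorphism_rho) (simp add: g)
  have "x = \<zero>\<^bsub>V\<^esub>" using rho_inv_cancel[OF g x(1)] i.h_zero gx by simp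
  with x show False by simp
qed

text \<open>This provides the small spanning set: an orbit has at most as many elements as
  \<open>G\<close>.\<close>

lemma irreducible_orbit_span:
  assumes irr: "irreducible_rep" and m: "m \<in> carrier V" "m \<noteq> \<zero>\<^bsub>V\<^esub>"
  shows "lin_span K V ((\<lambda>g. \<rho> g m) ` carrier G) = carrier V"
proof -
  let ?S = "(\<lambda>g. \<rho> g m) ` carrier G"
  have S: "?S \<subseteq> carrier V" using rho_closed m by auto
  have "invariant (carrier G) (lin_span K V ?S)"
    by (rule invariant_span[OF order_refl S])
      (auto simp: rho_mult[symmetric] m intro!: image_eqI[OF refl])
  then have "lin_span K V ?S = {\<zero>\<^bsub>V\<^esub>} \<or> lin_span K V ?S = carrier V"
    using irr unfolding irreducible_rep_def by simp
  moreover have "\<rho> \<one>\<^bsub>G\<^esub> m \<in> ?S" by (rule imageI) simp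
  then have "m \<in> lin_span K V ?S" using lin_span_incl[OF S] m by (auto simp: rho_one)
  ultimately show ?thesis using m by auto
qed

text \<open>Zorn's lemma is applied to the stable subspaces not containing \<open>F\<close>.
  Finiteness of \<open>F\<close> is what lets this condition survive unions of chains, and since
  \<open>F\<close> generates, a stable subspace containing it is no longer proper.\<close>

lemma maximal_invariant_subspace:
  assumes F: "finite F" "F \<subseteq> carrier V" "\<not> F \<subseteq> {\<zero>\<^bsub>V\<^esub>}" and H: "H \<subseteq> carrier G"
    and gen: "\<And>U. \<lbrakk>invariant H U; F \<subseteq> U\<rbrakk> \<Longrightarrow> U = carrier V"
  obtains W where "invariant H W" "W \<noteq> carrier V"
    "\<And>U. \<lbrakk>invariant H U; W \<subseteq> U\<rbrakk> \<Longrightarrow> U = W \<or> U = carrier V"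
proof -
  define \<A> where "\<A> = {U. invariant H U \<and> \<not> F \<subseteq> U}"
  have z: "\<rho> h \<zero>\<^bsub>V\<^esub> = \<zero>\<^bsub>V\<^esub>" if "h \<in> H" for h
    by (rule linear_endomorphism.h_zero[OF linear_endomorphism_rho]) (use that H in auto)
  have "{\<zero>\<^bsub>V\<^esub>} \<in> \<A>" using F(3) z zero_submodule by (simp add: \<A>_def invariant_def)
  then have ne: "\<A> \<noteq> {}" by auto
  have "\<exists>W\<in>\<A>. \<forall>U\<in>\<A>. W \<subseteq> U \<longrightarrow> U = W"
  proof (rule subset_Zorn_nonempty[OF ne])
    fix \<C> assume C: "\<C> \<noteq> {}" "subset.chain \<A> \<C>"
    have CA: "\<C> \<subseteq> \<A>" using C(2) by (simp add: subset.chain_def)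
    have ch: "A \<subseteq> B \<or> B \<subseteq> A" if "A \<in> \<C>" "B \<in> \<C>" for A B
      using C(2) that by (rule subset_chain_def[THEN iffD1, THEN conjunct2, rule_format])
    have inv: "invariant H A" if "A \<in> \<C>" for A using that CA by (auto simp: \<A>_def)
    have "submodule (\<Union>\<C>) K V"
      by (rule submodule_Union_chain[OF C(1) ch]) (use inv in \<open>simp_all add: invariant_def\<close>)
    then have "invariant H (\<Union>\<C>)" using inv unfolding invariant_def by blast
    moreover have "\<not> F \<subseteq> \<Union>\<C>"
    proof
      assume "F \<subseteq> \<Union>\<C>"
      then obtain A where "A \<in> \<C>" "F \<subseteq> A" by (rule finite_subset_Union_chain[OF F(1) _ C])
      then show False using CA by (auto simp: \<A>_def)
    qed
    ultimately show "\<Union>\<C> \<in> \<A>" by (simp add: \<A>_def)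
  qed
  then obtain W where W: "W \<in> \<A>" "\<forall>U\<in>\<A>. W \<subseteq> U \<longrightarrow> U = W" by blast
  show thesis
  proof (rule that)
    show "invariant H W" "W \<noteq> carrier V" using W(1) F(2) by (auto simp: \<A>_def)
    fix U assume U: "invariant H U" "W \<subseteq> U"
    show "U = W \<or> U = carrier V"
    proof (cases "F \<subseteq> U")
      case True
      then show ?thesis using gen[OF U(1)] by simp
    next
      case False
      then show ?thesis using W(2) U by (simp add: \<A>_def)
    qed
  qed
qed

text \<open>An argument in the style of Schur's lemma on $V/W$. A shift $h - c$ that fails to be
  injective has a non-zero stable kernel, which must be everything; one that misses \<open>v\<close>
  has a proper stable image, which must be zero. Either way $h - c$ maps $V$ into
  \<open>W\<close>.\<close>

lemma maximal_invariant_scalar: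
  assumes alg: "algebraically_closed K"
    and S: "S \<subseteq> carrier V" "lin_span K V S = carrier V" "S \<prec> carrier K"
    and H: "H \<subseteq> carrier G" and comm: "\<And>h h'. \<lbrakk>h \<in> H; h' \<in> H\<rbrakk> \<Longrightarrow> h \<otimes>\<^bsub>G\<^esub> h' = h' \<otimes>\<^bsub>G\<^esub> h"
    and W: "invariant H W" "W \<noteq> carrier V"
    and max: "\<And>U. \<lbrakk>invariant H U; W \<subseteq> U\<rbrakk> \<Longrightarrow> U = W \<or> U = carrier V"
    and h: "h \<in> H"
  shows "\<exists>c\<in>carrier K. \<forall>x\<in>carrier V. \<rho> h x \<oplus>\<^bsub>V\<^esub> (\<ominus> c) \<odot>\<^bsub>V\<^esub> x \<in> W"
proof -
  have hG: "h \<in> carrier G" using h H by auto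
  have sW: "submodule W K V" and iW: "\<And>g x. \<lbrakk>g \<in> H; x \<in> W\<rbrakk> \<Longrightarrow> \<rho> g x \<in> W"
    using W(1) by (simp_all add: invariant_def)
  note WV = submoduleE(1)[OF sW]
  interpret h: linear_endomorphism K V "\<rho> h" by (rule linear_endomorphism_rho[OF hG])
  interpret hW: invariant_subspace K V "\<rho> h" W
    by (intro invariant_subspace.intro invariant_subspace_axioms.intro
        linear_endomorphism_rho[OF hG] sW iW[OF h])
  have "W \<subset> carrier V" using WV W(2) by (rule psubsetI)
  then obtain v where v: "v \<in> carrier V" "v \<notin> W" by (elim psubset_imp_ex_mem[elim_format] exE DiffE)
  obtain c where c: "c \<in> carrier K" and alt: "(\<exists>x\<in>carrier V - W. h.shift_op c x \<in> W) \<or>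
    \<not> (\<exists>u\<in>carrier V. \<exists>e\<in>W. h.shift_op c u = v \<oplus>\<^bsub>V\<^esub> e)"
    by (rule bexE[OF hW.exists_noninvertible_shift[OF alg S v]])
  interpret s: linear_endomorphism K V "h.shift_op c" by (rule h.linear_endomorphism_shift_op[OF c])
  \<comment> \<open>Commutativity of \<open>H\<close> enters here; it makes \<open>?P\<close> and
    \<open>?Q\<close> below stable under \<open>H\<close>.\<close>
  have rc: "h.shift_op c (\<rho> g x) = \<rho> g (h.shift_op c x)" if g: "g \<in> H" and x: "x \<in> carrier V" for g x
  proof -
    have gG: "g \<in> carrier G" using g H by auto
    have "\<rho> h (\<rho> g x) = \<rho> (h \<otimes>\<^bsub>G\<^esub> g) x" by (rule rho_mult[OF hG gG x, symmetric])
    also have "\<dots> = \<rho> (g \<otimes>\<^bsub>G\<^esub> h) x" by (simp only: comm[OF h g])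
    also have "\<dots> = \<rho> g (\<rho> h x)" by (rule rho_mult[OF gG hG x])
    finally have swap: "\<rho> h (\<rho> g x) = \<rho> g (\<rho> h x)" .
    have nc: "\<ominus> c \<in> carrier K" using c by simp
    show ?thesis
      unfolding h.shift_op_def swap rho_smult[OF gG nc x, symmetric]
      by (rule rho_add[OF gG rho_closed[OF hG x] smult_closed[OF nc x], symmetric])
  qed
  \<comment> \<open>\<open>?P\<close> is the preimage in $V$ of the kernel of $h - c$ on $V/W$, and
    \<open>?Q\<close> that of its image. Both contain \<open>W\<close>, so maximality applies to
    them.\<close>
  let ?P = "{x \<in> carrier V. h.shift_op c x \<in> W}"
  let ?Q = "{a \<oplus>\<^bsub>V\<^esub> b | a b. a \<in> h.shift_op c ` carrier V \<and> b \<in> W}"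
  have goal: "h.shift_op c x \<in> W" if x: "x \<in> carrier V" for x
    using alt
  proof
    assume "\<exists>x\<in>carrier V - W. h.shift_op c x \<in> W"
    then have "?P \<noteq> W" by blast
    moreover have "invariant H ?P"
      unfolding invariant_def
    proof (intro conjI ballI s.preimage_submodule[OF sW])
      fix g x assume g: "g \<in> H" and "x \<in> ?P"
      then have x: "x \<in> carrier V" "h.shift_op c x \<in> W" by simp_all
      show "\<rho> g x \<in> ?P"
        using iW[OF g x(2)] rho_closed[OF subsetD[OF H g] x(1)] by (simp add: rc[OF g x(1)])
    qed
    moreover have "W \<subseteq> ?P" using WV hW.shift_op_W[OF c] by auto
    ultimately have "?P = carrier V" using max[of ?P] by simp
    then show ?thesis using x by auto
  next
    assume nv: "\<not> (\<exists>u\<in>carrier V. \<exists>e\<in>W. h.shift_op c u = v \<oplus>\<^bsub>V\<^esub> e)"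
    have "v \<notin> ?Q"
    proof
      assume "v \<in> ?Q"
      then obtain u e where u: "u \<in> carrier V" "e \<in> W" "v = h.shift_op c u \<oplus>\<^bsub>V\<^esub> e" by blast
      have "h.shift_op c u = v \<oplus>\<^bsub>V\<^esub> \<ominus>\<^bsub>V\<^esub> e"
        using s.h_closed[OF u(1)] subsetD[OF WV u(2)] by (simp add: u(3) M.a_assoc M.r_neg)
      moreover have "\<ominus>\<^bsub>V\<^esub> e \<in> W" by (rule submoduleE(3)[OF sW u(2)])
      ultimately show False using nv u(1) by blast
    qed
    then have "?Q \<noteq> carrier V" using v(1) by blast
    moreover have "invariant H ?Q"
      unfolding invariant_def
    proof (intro conjI ballI submodule_set_sum[OF s.image_submodule sW])
      fix g x assume g: "g \<in> H" and "x \<in> ?Q"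
      then obtain u e where u: "u \<in> carrier V" "e \<in> W" "x = h.shift_op c u \<oplus>\<^bsub>V\<^esub> e" by blast
      have gG: "g \<in> carrier G" using g H by auto
      have "\<rho> g x = h.shift_op c (\<rho> g u) \<oplus>\<^bsub>V\<^esub> \<rho> g e"
        using s.h_closed[OF u(1)] subsetD[OF WV u(2)] gG by (simp add: u(3) rho_add rc[OF g u(1)])
      moreover have "h.shift_op c (\<rho> g u) \<in> h.shift_op c ` carrier V"
        by (rule imageI[OF rho_closed[OF gG u(1)]])
      ultimately show "\<rho> g x \<in> ?Q" using iW[OF g u(2)] by blast
    qed
    moreover note QW = submodule_subset_set_sum[OF s.image_submodule sW]
    ultimately have "?Q = W" using max[of ?Q] by simp
    then show ?thesis using QW(1) x by blast
  qed
  then show ?thesis using c by (auto simp: h.shift_op_def)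
qed

text \<open>All of \<open>H\<close> acts on $V/W$ by scalars, so every line there is stable, and
  maximality makes $V/W$ itself a line. The functional \<open>l\<close> is the coordinate along a
  fixed \<open>v\<close> outside \<open>W\<close>, and \<chi> records the scalars.\<close>

lemma exists_weight_functional:
  assumes alg: "algebraically_closed K"
    and S: "S \<subseteq> carrier V" "lin_span K V S = carrier V" "S \<prec> carrier K"
    and H: "H \<subseteq> carrier G" and comm: "\<And>h h'. \<lbrakk>h \<in> H; h' \<in> H\<rbrakk> \<Longrightarrow> h \<otimes>\<^bsub>G\<^esub> h' = h' \<otimes>\<^bsub>G\<^esub> h"
    and W: "invariant H W" "W \<noteq> carrier V"
    and max: "\<And>U. \<lbrakk>invariant H U; W \<subseteq> U\<rbrakk> \<Longrightarrow> U = W \<or> U = carrier V"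
  obtains l \<chi> where "linear_functional l" "\<exists>v\<in>carrier V. l v \<noteq> \<zero>"
    "\<forall>h\<in>H. \<chi> h \<in> carrier K \<and> (\<forall>x\<in>carrier V. l (\<rho> h x) = \<chi> h \<otimes> l x)"
proof -
  have "\<forall>h\<in>H. \<exists>c. c \<in> carrier K \<and> (\<forall>x\<in>carrier V. \<rho> h x \<oplus>\<^bsub>V\<^esub> (\<ominus> c) \<odot>\<^bsub>V\<^esub> x \<in> W)"
  proof
    fix h assume h: "h \<in> H"
    show "\<exists>c. c \<in> carrier K \<and> (\<forall>x\<in>carrier V. \<rho> h x \<oplus>\<^bsub>V\<^esub> (\<ominus> c) \<odot>\<^bsub>V\<^esub> x \<in> W)"
      using maximal_invariant_scalar[OF alg S H comm W max h] by (simp only: Bex_def)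
  qed
  from bchoice[OF this] obtain \<chi> where
    \<chi>: "\<forall>h\<in>H. \<chi> h \<in> carrier K \<and> (\<forall>x\<in>carrier V. \<rho> h x \<oplus>\<^bsub>V\<^esub> (\<ominus> \<chi> h) \<odot>\<^bsub>V\<^esub> x \<in> W)" ..
  have \<chi>K: "\<chi> h \<in> carrier K" if "h \<in> H" for h using bspec[OF \<chi> that] by simp
  have sW: "submodule W K V" using W(1) by (simp add: invariant_def)
  note w = submoduleE(1,4,5)[OF sW]
  have wc: "x \<in> carrier V" if "x \<in> W" for x using w(1) that by auto
  have "W \<subset> carrier V" using w(1) W(2) by (rule psubsetI)
  then obtain v where v: "v \<in> carrier V" "v \<notin> W" by (elim psubset_imp_ex_mem[elim_format] exE DiffE)
  have \<rho>h: "\<exists>w\<in>W. \<rho> h x = \<chi> h \<odot>\<^bsub>V\<^esub> x \<oplus>\<^bsub>V\<^esub> w" if h: "h \<in> H" and x: "x \<in> carrier V" for h x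
  proof
    show "\<rho> h x \<oplus>\<^bsub>V\<^esub> (\<ominus> \<chi> h) \<odot>\<^bsub>V\<^esub> x \<in> W" using bspec[OF \<chi> h] x by simp
    show "\<rho> h x = \<chi> h \<odot>\<^bsub>V\<^esub> x \<oplus>\<^bsub>V\<^esub> (\<rho> h x \<oplus>\<^bsub>V\<^esub> (\<ominus> \<chi> h) \<odot>\<^bsub>V\<^esub> x)"
      using \<chi>K[OF h] x rho_closed[OF subsetD[OF H h] x]
      by (simp add: smult_l_minus M.a_lcomm[of "\<chi> h \<odot>\<^bsub>V\<^esub> x"] M.r_neg)
  qed
  have vV: "{v} \<subseteq> carrier V" using v(1) by simp
  \<comment> \<open>The preimage of the line through \<open>v\<close> in $V/W$.\<close>
  let ?U = "{a \<oplus>\<^bsub>V\<^esub> b | a b. a \<in> lin_span K V {v} \<and> b \<in> W}"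
  have sU: "submodule ?U K V" by (rule submodule_set_sum[OF lin_span_submodule[OF vV] sW])
  note sub = submodule_subset_set_sum[OF lin_span_submodule[OF vV] sW]
  have "invariant H ?U" unfolding invariant_def
  proof (intro conjI sU ballI)
    fix h x assume h: "h \<in> H" and x: "x \<in> ?U"
    have xc: "x \<in> carrier V" using submoduleE(1)[OF sU] x by blast
    obtain w where w: "w \<in> W" "\<rho> h x = \<chi> h \<odot>\<^bsub>V\<^esub> x \<oplus>\<^bsub>V\<^esub> w" using \<rho>h[OF h xc] by blast
    show "\<rho> h x \<in> ?U" unfolding w(2)
      by (rule submoduleE(5)[OF sU submoduleE(4)[OF sU \<chi>K[OF h] x] subsetD[OF sub(2) w(1)]])
  qed
  moreover have "v \<in> ?U" using subsetD[OF sub(1)] lin_span_incl[OF vV] by blast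
  then have "?U \<noteq> W" using v(2) by blast
  ultimately have U: "?U = carrier V" using max[of ?U] sub(2) by simp
  have ex: "\<exists>k w. k \<in> carrier K \<and> w \<in> W \<and> x = k \<odot>\<^bsub>V\<^esub> v \<oplus>\<^bsub>V\<^esub> w" if x: "x \<in> carrier V" for x
  proof -
    have "x \<in> ?U" using U x by simp
    then obtain a b where ab: "a \<in> lin_span K V {v}" "b \<in> W" "x = a \<oplus>\<^bsub>V\<^esub> b" by blast
    obtain k where k: "k \<in> {v} \<rightarrow> carrier K" "a = (\<Oplus>\<^bsub>V\<^esub>b\<in>{v}. k b \<odot>\<^bsub>V\<^esub> b)"
      using ab(1) vV by (auto simp: lin_span_finite)
    then have "a = k v \<odot>\<^bsub>V\<^esub> v" "k v \<in> carrier K" using v(1) by (auto simp: Pi_iff)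
    then show ?thesis using ab by blast
  qed
  \<comment> \<open>Two different coordinates would put a non-zero multiple of \<open>v\<close>, and
    hence \<open>v\<close>, into \<open>W\<close>. This makes the choice defining \<open>l\<close>
    unambiguous.\<close>
  have uniq: "k = k'" if k: "k \<in> carrier K" "k' \<in> carrier K" "w \<in> W" "w' \<in> W"
    and e: "k \<odot>\<^bsub>V\<^esub> v \<oplus>\<^bsub>V\<^esub> w = k' \<odot>\<^bsub>V\<^esub> v \<oplus>\<^bsub>V\<^esub> w'" for k k' w w'
  proof (rule ccontr)
    assume "k \<noteq> k'"
    then have "k \<ominus> k' \<noteq> \<zero>" using k by simp
    then have u: "k \<ominus> k' \<in> Units K" using k by (simp add: field_Units)
    have wk: "w' \<oplus>\<^bsub>V\<^esub> \<ominus>\<^bsub>V\<^esub> w \<in> W" by (rule w(3)[OF k(4) submoduleE(3)[OF sW k(3)]])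
    have kv: "k \<odot>\<^bsub>V\<^esub> v \<in> carrier V" "k' \<odot>\<^bsub>V\<^esub> v \<in> carrier V" using k v by auto
    have "k \<odot>\<^bsub>V\<^esub> v = (k \<odot>\<^bsub>V\<^esub> v \<oplus>\<^bsub>V\<^esub> w) \<oplus>\<^bsub>V\<^esub> \<ominus>\<^bsub>V\<^esub> w"
      using kv wc[OF k(3)] by (simp add: M.a_assoc M.r_neg)
    also have "\<dots> = k' \<odot>\<^bsub>V\<^esub> v \<oplus>\<^bsub>V\<^esub> (w' \<oplus>\<^bsub>V\<^esub> \<ominus>\<^bsub>V\<^esub> w)"
      unfolding e using kv wc[OF k(3)] wc[OF k(4)] by (simp add: M.a_assoc)
    finally have "(k \<ominus> k') \<odot>\<^bsub>V\<^esub> v = w' \<oplus>\<^bsub>V\<^esub> \<ominus>\<^bsub>V\<^esub> w"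
      using k v wc[OF wk] kv
      by (simp add: K.minus_eq smult_l_distr smult_l_minus M.a_comm[of "k' \<odot>\<^bsub>V\<^esub> v"] M.a_assoc M.r_neg)
    then have kW: "(k \<ominus> k') \<odot>\<^bsub>V\<^esub> v \<in> W" using wk by simp
    have "v = (inv\<^bsub>K\<^esub> (k \<ominus> k') \<otimes> (k \<ominus> k')) \<odot>\<^bsub>V\<^esub> v" using K.Units_l_inv[OF u] v by simp
    also have "\<dots> = inv\<^bsub>K\<^esub> (k \<ominus> k') \<odot>\<^bsub>V\<^esub> ((k \<ominus> k') \<odot>\<^bsub>V\<^esub> v)"
      by (rule smult_assoc1[OF K.Units_inv_closed[OF u] K.Units_closed[OF u] v(1)])
    also have "\<dots> \<in> W" by (rule w(2)[OF K.Units_inv_closed[OF u] kW])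
    finally show False using v(2) by simp
  qed
  define l where "l x = (SOME k. k \<in> carrier K \<and> (\<exists>w\<in>W. x = k \<odot>\<^bsub>V\<^esub> v \<oplus>\<^bsub>V\<^esub> w))" for x
  have l: "l x = k" if "k \<in> carrier K" "w \<in> W" "x = k \<odot>\<^bsub>V\<^esub> v \<oplus>\<^bsub>V\<^esub> w" for x k w
    unfolding l_def
  proof (rule some_equality)
    show "k \<in> carrier K \<and> (\<exists>w\<in>W. x = k \<odot>\<^bsub>V\<^esub> v \<oplus>\<^bsub>V\<^esub> w)" using that by blast
    fix k' assume "k' \<in> carrier K \<and> (\<exists>w\<in>W. x = k' \<odot>\<^bsub>V\<^esub> v \<oplus>\<^bsub>V\<^esub> w)"
    then obtain w' where "k' \<in> carrier K" "w' \<in> W" "x = k' \<odot>\<^bsub>V\<^esub> v \<oplus>\<^bsub>V\<^esub> w'" by blast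
    then show "k' = k" using uniq[of k' k w' w] that by simp
  qed
  have le: "l x \<in> carrier K \<and> (\<exists>w\<in>W. x = l x \<odot>\<^bsub>V\<^esub> v \<oplus>\<^bsub>V\<^esub> w)" if x: "x \<in> carrier V" for x
  proof -
    obtain k w where kw: "k \<in> carrier K" "w \<in> W" "x = k \<odot>\<^bsub>V\<^esub> v \<oplus>\<^bsub>V\<^esub> w" using ex[OF x] by blast
    have "l x = k" by (rule l[OF kw])
    with kw(1,3) show ?thesis by (intro conjI bexI[OF _ kw(2)]) simp_all
  qed
  show thesis
  proof (rule that)
    show "linear_functional l" unfolding linear_functional_def
    proof (intro conjI ballI)
      show "l \<in> carrier V \<rightarrow> carrier K" using le by blast
      fix x y assume x: "x \<in> carrier V" and y: "y \<in> carrier V"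
      obtain a where a: "a \<in> W" "x = l x \<odot>\<^bsub>V\<^esub> v \<oplus>\<^bsub>V\<^esub> a" using le[OF x] by blast
      obtain b where b: "b \<in> W" "y = l y \<odot>\<^bsub>V\<^esub> v \<oplus>\<^bsub>V\<^esub> b" using le[OF y] by blast
      have c: "l x \<in> carrier K" "l y \<in> carrier K" using le x y by blast+
      have "(l x \<odot>\<^bsub>V\<^esub> v \<oplus>\<^bsub>V\<^esub> a) \<oplus>\<^bsub>V\<^esub> (l y \<odot>\<^bsub>V\<^esub> v \<oplus>\<^bsub>V\<^esub> b) = (l x \<oplus> l y) \<odot>\<^bsub>V\<^esub> v \<oplus>\<^bsub>V\<^esub> (a \<oplus>\<^bsub>V\<^esub> b)"
        using c v wc[OF a(1)] wc[OF b(1)] by (simp add: smult_l_distr M.a_ac)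
      then have "x \<oplus>\<^bsub>V\<^esub> y = (l x \<oplus> l y) \<odot>\<^bsub>V\<^esub> v \<oplus>\<^bsub>V\<^esub> (a \<oplus>\<^bsub>V\<^esub> b)"
        by (simp only: a(2)[symmetric] b(2)[symmetric])
      then show "l (x \<oplus>\<^bsub>V\<^esub> y) = l x \<oplus> l y"
        by (rule l[OF K.a_closed[OF c] w(3)[OF a(1) b(1)]])
    next
      fix k x assume k: "k \<in> carrier K" and x: "x \<in> carrier V"
      obtain a where a: "a \<in> W" "x = l x \<odot>\<^bsub>V\<^esub> v \<oplus>\<^bsub>V\<^esub> a" using le[OF x] by blast
      have c: "l x \<in> carrier K" using le x by blast
      have "k \<odot>\<^bsub>V\<^esub> (l x \<odot>\<^bsub>V\<^esub> v \<oplus>\<^bsub>V\<^esub> a) = (k \<otimes> l x) \<odot>\<^bsub>V\<^esub> v \<oplus>\<^bsub>V\<^esub> k \<odot>\<^bsub>V\<^esub> a"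
        using c v k wc[OF a(1)] by (simp add: smult_r_distr smult_assoc1)
      then have "k \<odot>\<^bsub>V\<^esub> x = (k \<otimes> l x) \<odot>\<^bsub>V\<^esub> v \<oplus>\<^bsub>V\<^esub> k \<odot>\<^bsub>V\<^esub> a"
        by (simp only: a(2)[symmetric])
      then show "l (k \<odot>\<^bsub>V\<^esub> x) = k \<otimes> l x"
        by (rule l[OF K.m_closed[OF k c] w(2)[OF k a(1)]])
    qed
    have "l v = \<one>" by (rule l[OF K.one_closed submodule_zero[OF sW]]) (use v in simp)
    then show "\<exists>v\<in>carrier V. l v \<noteq> \<zero>" using v(1) by (intro bexI[of _ v]) simp_all
    have "l (\<rho> h x) = \<chi> h \<otimes> l x" if h: "h \<in> H" and x: "x \<in> carrier V" for h x
    proof -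
      obtain a where a: "a \<in> W" "x = l x \<odot>\<^bsub>V\<^esub> v \<oplus>\<^bsub>V\<^esub> a" using le[OF x] by blast
      obtain b where b: "b \<in> W" "\<rho> h x = \<chi> h \<odot>\<^bsub>V\<^esub> x \<oplus>\<^bsub>V\<^esub> b" using \<rho>h[OF h x] by blast
      have c: "l x \<in> carrier K" using le x by blast
      have "\<chi> h \<odot>\<^bsub>V\<^esub> (l x \<odot>\<^bsub>V\<^esub> v \<oplus>\<^bsub>V\<^esub> a) \<oplus>\<^bsub>V\<^esub> b = (\<chi> h \<otimes> l x) \<odot>\<^bsub>V\<^esub> v \<oplus>\<^bsub>V\<^esub> (\<chi> h \<odot>\<^bsub>V\<^esub> a \<oplus>\<^bsub>V\<^esub> b)"
        using c v \<chi>K[OF h] wc[OF a(1)] wc[OF b(1)] by (simp add: smult_r_distr smult_assoc1 M.a_assoc)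
      then have "\<rho> h x = (\<chi> h \<otimes> l x) \<odot>\<^bsub>V\<^esub> v \<oplus>\<^bsub>V\<^esub> (\<chi> h \<odot>\<^bsub>V\<^esub> a \<oplus>\<^bsub>V\<^esub> b)"
        by (simp only: a(2)[symmetric] b(2)[symmetric])
      then show ?thesis
        by (rule l[OF K.m_closed[OF \<chi>K[OF h] c] w(3)[OF w(2)[OF \<chi>K[OF h] a(1)] b(1)]])
    qed
    then show "\<forall>h\<in>H. \<chi> h \<in> carrier K \<and> (\<forall>x\<in>carrier V. l (\<rho> h x) = \<chi> h \<otimes> l x)"
      using \<chi>K by (intro ballI conjI)
  qed
qed

theorem irreducible_rep_dim_at_most:
  assumes alg: "algebraically_closed K" and card: "carrier G \<prec> carrier K"
    and H: "subgroup H G" and comm: "\<And>h h'. \<lbrakk>h \<in> H; h' \<in> H\<rbrakk> \<Longrightarrow> h \<otimes>\<^bsub>G\<^esub> h' = h' \<otimes>\<^bsub>G\<^esub> h"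
    and fin: "finite (rcosets\<^bsub>G\<^esub> H)" and irr: "irreducible_rep"
  shows "dim_at_most K V (card (rcosets\<^bsub>G\<^esub> H))"
proof -
  have HG: "H \<subseteq> carrier G" by (rule subgroup.subset[OF H])
  obtain m where m: "m \<in> carrier V" "m \<noteq> \<zero>\<^bsub>V\<^esub>"
    using irr M.zero_closed unfolding irreducible_rep_def by blast
  let ?S = "(\<lambda>g. \<rho> g m) ` carrier G"
  have S: "?S \<subseteq> carrier V" using rho_closed m by auto
  note span = irreducible_orbit_span[OF irr m]
  have SK: "?S \<prec> carrier K" by (rule lesspoll_trans1[OF image_lepoll card])
  \<comment> \<open>A representative of each right coset $Hg$. Right cosets put the factor from
    \<open>H\<close> on the left, next to \<open>l\<close>.\<close>
  define r where "r C = (SOME t. t \<in> C)" for C :: "'g set"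
  have r: "r (H #>\<^bsub>G\<^esub> g) \<in> carrier G \<and> (\<exists>h\<in>H. g = h \<otimes>\<^bsub>G\<^esub> r (H #>\<^bsub>G\<^esub> g))" if g: "g \<in> carrier G" for g
  proof -
    have "g \<in> H #>\<^bsub>G\<^esub> g" by (rule rcos_self[OF g H])
    then have "r (H #>\<^bsub>G\<^esub> g) \<in> H #>\<^bsub>G\<^esub> g" unfolding r_def by (rule someI)
    then obtain h where h: "h \<in> H" "r (H #>\<^bsub>G\<^esub> g) = h \<otimes>\<^bsub>G\<^esub> g" by (auto simp: r_coset_def)
    have hG: "h \<in> carrier G" using h HG by auto
    have "g = inv\<^bsub>G\<^esub> h \<otimes>\<^bsub>G\<^esub> r (H #>\<^bsub>G\<^esub> g)"
      unfolding h(2) using hG g by (simp add: m_assoc[symmetric])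
    moreover have "inv\<^bsub>G\<^esub> h \<in> H" by (rule subgroup.m_inv_closed[OF H h(1)])
    ultimately show ?thesis using hG g h(2) by auto
  qed
  have rG: "r C \<in> carrier G" if "C \<in> rcosets\<^bsub>G\<^esub> H" for C
    using that r by (auto simp: RCOSETS_def)
  have decomp: "\<exists>h\<in>H. \<exists>C\<in>rcosets\<^bsub>G\<^esub> H. g = h \<otimes>\<^bsub>G\<^esub> r C" if g: "g \<in> carrier G" for g
  proof -
    have "H #>\<^bsub>G\<^esub> g \<in> rcosets\<^bsub>G\<^esub> H" using g by (auto simp: RCOSETS_def)
    then show ?thesis using r[OF g] by blast
  qed
  \<comment> \<open>The finite generating set over \<open>H\<close>: the vector \<open>m\<close>
    moved by one representative per coset.\<close>
  let ?F = "(\<lambda>C. \<rho> (r C) m) ` (rcosets\<^bsub>G\<^esub> H)"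
  have F: "finite ?F" "?F \<subseteq> carrier V" using fin rG rho_closed m by auto
  obtain C0 where C0: "C0 \<in> rcosets\<^bsub>G\<^esub> H" using decomp[OF one_closed] by blast
  have "\<rho> (r C0) m \<noteq> \<zero>\<^bsub>V\<^esub>" by (rule rho_nonzero[OF rG[OF C0] m])
  then have F0: "\<not> ?F \<subseteq> {\<zero>\<^bsub>V\<^esub>}" using C0 by blast
  have gen: "U = carrier V" if U: "invariant H U" "?F \<subseteq> U" for U
  proof -
    have sU: "submodule U K V" using U(1) by (simp add: invariant_def)
    have "?S \<subseteq> U"
    proof
      fix x assume "x \<in> ?S"
      then obtain g where g: "g \<in> carrier G" "x = \<rho> g m" by blast
      obtain h C where hC: "h \<in> H" "C \<in> rcosets\<^bsub>G\<^esub> H" "g = h \<otimes>\<^bsub>G\<^esub> r C" using decomp[OF g(1)] by blast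
      have "x = \<rho> h (\<rho> (r C) m)"
        unfolding g(2) hC(3) by (rule rho_mult[OF subsetD[OF HG hC(1)] rG[OF hC(2)] m(1)])
      moreover have "\<rho> (r C) m \<in> U" using U(2) hC(2) by blast
      ultimately show "x \<in> U" using U(1) hC(1) by (simp add: invariant_def)
    qed
    then have "carrier V \<subseteq> U" using lin_span_subset_submodule[OF sU] span by blast
    then show ?thesis using submoduleE(1)[OF sU] by blast
  qed
  obtain W where W: "invariant H W" "W \<noteq> carrier V"
    and max: "\<And>U. \<lbrakk>invariant H U; W \<subseteq> U\<rbrakk> \<Longrightarrow> U = W \<or> U = carrier V"
    using maximal_invariant_subspace[OF F F0 HG gen] by blast
  obtain l \<chi> where l: "linear_functional l" "\<exists>v\<in>carrier V. l v \<noteq> \<zero>"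
    and \<chi>l: "\<forall>h\<in>H. \<chi> h \<in> carrier K \<and> (\<forall>x\<in>carrier V. l (\<rho> h x) = \<chi> h \<otimes> l x)"
    by (rule exists_weight_functional[OF alg S span SK HG comm W max])
  have lh: "l (\<rho> h x) = \<chi> h \<otimes> l x" if "h \<in> H" "x \<in> carrier V" for h x
    using bspec[OF \<chi>l that(1)] that(2) by simp
  have \<chi>: "\<chi> h \<in> carrier K" if "h \<in> H" for h using bspec[OF \<chi>l that] by simp
  have lc: "l x \<in> carrier K" if "x \<in> carrier V" for x
    using l(1) that unfolding linear_functional_def by (simp add: Pi_iff)
  have la: "l (x \<oplus>\<^bsub>V\<^esub> y) = l x \<oplus> l y" if "x \<in> carrier V" "y \<in> carrier V" for x y
    using l(1) that unfolding linear_functional_def by simp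
  have ls: "l (k \<odot>\<^bsub>V\<^esub> x) = k \<otimes> l x" if "k \<in> carrier K" "x \<in> carrier V" for k x
    using l(1) that unfolding linear_functional_def by simp
  have lfun: "linear_functional (\<lambda>x. l (\<rho> (r C) x))" if C: "C \<in> rcosets\<^bsub>G\<^esub> H" for C
    using rG[OF C] unfolding linear_functional_def
    by (intro conjI ballI Pi_I) (simp_all add: lc la ls rho_closed rho_add rho_smult)
  \<comment> \<open>Letting \<open>g\<close> run over all of \<open>G\<close> makes stability
    immediate; \<open>sep\<close> below reduces membership to the coset representatives.\<close>
  define N where "N = {x \<in> carrier V. \<forall>g\<in>carrier G. l (\<rho> g x) = \<zero>}"
  have l0: "l \<zero>\<^bsub>V\<^esub> = \<zero>"
    using ls[OF K.zero_closed M.zero_closed] lc[OF M.zero_closed] by simp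
  have rz: "\<rho> g \<zero>\<^bsub>V\<^esub> = \<zero>\<^bsub>V\<^esub>" if "g \<in> carrier G" for g
    by (rule linear_endomorphism.h_zero[OF linear_endomorphism_rho[OF that]])
  have "submodule N K V"
    by (rule submoduleI') (auto simp: N_def rz l0 la ls rho_add rho_smult rho_closed)
  moreover have "\<rho> g x \<in> N" if g: "g \<in> carrier G" and x: "x \<in> N" for g x
    using g x by (auto simp: N_def rho_closed rho_mult[symmetric])
  ultimately have "invariant (carrier G) N" by (simp add: invariant_def)
  then have "N = {\<zero>\<^bsub>V\<^esub>} \<or> N = carrier V" using irr by (simp add: irreducible_rep_def)
  moreover obtain v where v: "v \<in> carrier V" "l v \<noteq> \<zero>" using l(2) by blast
  have "v \<notin> N"
  proof
    assume "v \<in> N"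
    then have "l (\<rho> \<one>\<^bsub>G\<^esub> v) = \<zero>" unfolding N_def using G.one_closed by blast
    then show False using v by (simp add: rho_one)
  qed
  ultimately have N: "N = {\<zero>\<^bsub>V\<^esub>}" using v(1) by blast
  have sep: "x = \<zero>\<^bsub>V\<^esub>" if x: "x \<in> carrier V" and z: "\<And>C. C \<in> rcosets\<^bsub>G\<^esub> H \<Longrightarrow> l (\<rho> (r C) x) = \<zero>" for x
  proof -
    have "l (\<rho> g x) = \<zero>" if g: "g \<in> carrier G" for g
    proof -
      obtain h C where hC: "h \<in> H" "C \<in> rcosets\<^bsub>G\<^esub> H" "g = h \<otimes>\<^bsub>G\<^esub> r C" using decomp[OF g] by blast
      have "l (\<rho> g x) = l (\<rho> h (\<rho> (r C) x))"
        unfolding hC(3) by (simp only: rho_mult[OF subsetD[OF HG hC(1)] rG[OF hC(2)] x])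
      also have "\<dots> = \<chi> h \<otimes> l (\<rho> (r C) x)" by (rule lh[OF hC(1) rho_closed[OF rG[OF hC(2)] x]])
      finally show ?thesis using z[OF hC(2)] \<chi>[OF hC(1)] by simp
    qed
    then have "x \<in> N" using x by (simp add: N_def)
    then show ?thesis using N by simp
  qed
  have "\<exists>B. finite B \<and> card B \<le> card (rcosets\<^bsub>G\<^esub> H) \<and> B \<subseteq> carrier V \<and> lin_indep K V B \<and>
      lin_span K V B = carrier V"
    by (rule basis_of_separating_functionals[OF fin lfun carrier_is_submodule sep])
  then show ?thesis unfolding dim_at_most_def lin_basis_def by blast
qed

end

section \<open>Rings with a simple module\<close>

lemma (in abelian_group) eq_if_minus_eq_zero:
  assumes "x \<in> carrier G" "y \<in> carrier G" "x \<ominus> y = \<zero>"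
  shows "x = y"
proof -
  have "x = (x \<ominus> y) \<oplus> y" using assms(1,2) by (simp add: minus_eq a_assoc l_neg)
  then show ?thesis using assms by simp
qed

section \<open>Submodules and annihilators for modules that need not be unital\<close>

context left_module
begin

lemma smult_l_null: "x \<in> carrier M \<Longrightarrow> \<zero> \<odot>\<^bsub>M\<^esub> x = \<zero>\<^bsub>M\<^esub>"
  using smult_l_distr[of \<zero> \<zero> x] smult_closed[of \<zero> x]
  by (metis M.add.l_cancel_one R.l_zero R.zero_closed)

lemma smult_r_null: "r \<in> carrier R \<Longrightarrow> r \<odot>\<^bsub>M\<^esub> \<zero>\<^bsub>M\<^esub> = \<zero>\<^bsub>M\<^esub>"
  using smult_r_distr[of r "\<zero>\<^bsub>M\<^esub>" "\<zero>\<^bsub>M\<^esub>"] smult_closed[of r "\<zero>\<^bsub>M\<^esub>"]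
  by (metis M.add.l_cancel_one M.l_zero M.zero_closed)

lemma smult_l_minus:
  assumes "r \<in> carrier R" "x \<in> carrier M"
  shows "(\<ominus> r) \<odot>\<^bsub>M\<^esub> x = \<ominus>\<^bsub>M\<^esub> (r \<odot>\<^bsub>M\<^esub> x)"
  using smult_l_distr[of "\<ominus> r" r x] assms
  by (intro M.minus_equality[symmetric]) (simp_all add: smult_closed R.l_neg smult_l_null)

lemma smult_r_minus:
  assumes "r \<in> carrier R" "x \<in> carrier M"
  shows "r \<odot>\<^bsub>M\<^esub> (\<ominus>\<^bsub>M\<^esub> x) = \<ominus>\<^bsub>M\<^esub> (r \<odot>\<^bsub>M\<^esub> x)"
  using smult_r_distr[of r "\<ominus>\<^bsub>M\<^esub> x" x] assms
  by (intro M.minus_equality[symmetric]) (simp_all add: smult_closed M.l_neg smult_r_null)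

text \<open>Closure under negation is a separate condition: with no unit law, $-x$ need not be
  $(-1)x$.\<close>

lemma left_submoduleI:
  assumes sub: "N \<subseteq> carrier M" and z: "\<zero>\<^bsub>M\<^esub> \<in> N"
    and add: "\<And>x y. \<lbrakk>x \<in> N; y \<in> N\<rbrakk> \<Longrightarrow> x \<oplus>\<^bsub>M\<^esub> y \<in> N"
    and neg: "\<And>x. x \<in> N \<Longrightarrow> \<ominus>\<^bsub>M\<^esub> x \<in> N"
    and sm: "\<And>r x. \<lbrakk>r \<in> carrier R; x \<in> N\<rbrakk> \<Longrightarrow> r \<odot>\<^bsub>M\<^esub> x \<in> N"
  shows "submodule N R M"
  by (intro submodule.intro subgroup.intro submodule_axioms.intro)
    (use assms in \<open>simp_all add: a_inv_def\<close>)

text \<open>Stated for left ideals \<open>J\<close>, since it is applied both to two-sided ideals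
  and to submodules of an annihilator.\<close>

lemma ideal_smult_submodule:
  assumes J: "additive_subgroup J R" and l: "\<And>r j. \<lbrakk>r \<in> carrier R; j \<in> J\<rbrakk> \<Longrightarrow> r \<otimes> j \<in> J"
    and x: "x \<in> carrier M"
  shows "submodule ((\<lambda>j. j \<odot>\<^bsub>M\<^esub> x) ` J) R M"
proof -
  interpret J: additive_subgroup J R by (rule J)
  have JR: "j \<in> carrier R" if "j \<in> J" for j using J.a_subset that by blast
  show ?thesis
  proof (rule left_submoduleI)
    show "(\<lambda>j. j \<odot>\<^bsub>M\<^esub> x) ` J \<subseteq> carrier M" using JR x smult_closed by blast
    show "\<zero>\<^bsub>M\<^esub> \<in> (\<lambda>j. j \<odot>\<^bsub>M\<^esub> x) ` J"
      using smult_l_null[OF x] J.zero_closed by (intro image_eqI[of _ _ \<zero>]) simp_all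
    show "y \<oplus>\<^bsub>M\<^esub> z \<in> (\<lambda>j. j \<odot>\<^bsub>M\<^esub> x) ` J"
      if yz: "y \<in> (\<lambda>j. j \<odot>\<^bsub>M\<^esub> x) ` J" "z \<in> (\<lambda>j. j \<odot>\<^bsub>M\<^esub> x) ` J" for y z
    proof -
      obtain a b where "a \<in> J" "b \<in> J" "y = a \<odot>\<^bsub>M\<^esub> x" "z = b \<odot>\<^bsub>M\<^esub> x" using yz by blast
      then show ?thesis
        by (intro image_eqI[of _ _ "a \<oplus> b"]) (simp_all add: smult_l_distr JR x J.a_closed)
    qed
    show "\<ominus>\<^bsub>M\<^esub> y \<in> (\<lambda>j. j \<odot>\<^bsub>M\<^esub> x) ` J" if y: "y \<in> (\<lambda>j. j \<odot>\<^bsub>M\<^esub> x) ` J" for y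
    proof -
      obtain a where "a \<in> J" "y = a \<odot>\<^bsub>M\<^esub> x" using y by blast
      then show ?thesis
        by (intro image_eqI[of _ _ "\<ominus> a"]) (simp_all add: smult_l_minus JR x J.a_inv_closed)
    qed
    show "r \<odot>\<^bsub>M\<^esub> y \<in> (\<lambda>j. j \<odot>\<^bsub>M\<^esub> x) ` J" if r: "r \<in> carrier R" and y: "y \<in> (\<lambda>j. j \<odot>\<^bsub>M\<^esub> x) ` J" for r y
    proof -
      obtain a where "a \<in> J" "y = a \<odot>\<^bsub>M\<^esub> x" using y by blast
      then show ?thesis using r
        by (intro image_eqI[of _ _ "r \<otimes> a"]) (simp_all add: smult_assoc JR x l)
    qed
  qed
qed

text \<open>Stability rests on $j(rx) = (jr)x$, so \<open>J\<close> must absorb multiplication on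
  the right.\<close>

lemma annihilated_submodule:
  assumes J: "J \<subseteq> carrier R" and r: "\<And>r j. \<lbrakk>r \<in> carrier R; j \<in> J\<rbrakk> \<Longrightarrow> j \<otimes> r \<in> J"
  shows "submodule {x \<in> carrier M. \<forall>j\<in>J. j \<odot>\<^bsub>M\<^esub> x = \<zero>\<^bsub>M\<^esub>} R M"
proof (rule left_submoduleI)
  have JR: "j \<in> carrier R" if "j \<in> J" for j using J that by blast
  show "\<zero>\<^bsub>M\<^esub> \<in> {x \<in> carrier M. \<forall>j\<in>J. j \<odot>\<^bsub>M\<^esub> x = \<zero>\<^bsub>M\<^esub>}" by (simp add: smult_r_null JR)
  show "x \<oplus>\<^bsub>M\<^esub> y \<in> {x \<in> carrier M. \<forall>j\<in>J. j \<odot>\<^bsub>M\<^esub> x = \<zero>\<^bsub>M\<^esub>}"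
    if "x \<in> {x \<in> carrier M. \<forall>j\<in>J. j \<odot>\<^bsub>M\<^esub> x = \<zero>\<^bsub>M\<^esub>}" "y \<in> {x \<in> carrier M. \<forall>j\<in>J. j \<odot>\<^bsub>M\<^esub> x = \<zero>\<^bsub>M\<^esub>}" for x y
    using that by (simp add: smult_r_distr JR)
  show "\<ominus>\<^bsub>M\<^esub> x \<in> {x \<in> carrier M. \<forall>j\<in>J. j \<odot>\<^bsub>M\<^esub> x = \<zero>\<^bsub>M\<^esub>}"
    if "x \<in> {x \<in> carrier M. \<forall>j\<in>J. j \<odot>\<^bsub>M\<^esub> x = \<zero>\<^bsub>M\<^esub>}" for x
    using that by (simp add: smult_r_minus JR)
  show "a \<odot>\<^bsub>M\<^esub> x \<in> {x \<in> carrier M. \<forall>j\<in>J. j \<odot>\<^bsub>M\<^esub> x = \<zero>\<^bsub>M\<^esub>}"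
    if "a \<in> carrier R" "x \<in> {x \<in> carrier M. \<forall>j\<in>J. j \<odot>\<^bsub>M\<^esub> x = \<zero>\<^bsub>M\<^esub>}" for a x
    using that by (simp add: smult_closed smult_assoc[symmetric] JR r)
qed auto

end

locale simple_left_module = left_module R M
  for R :: "('a, 'x) ring_scheme" (structure) and M :: "('a, 'm, 'y) module_scheme" (structure) +
  assumes simple: "simple_module R M"
begin

lemma submodule_trivial: "submodule N R M \<Longrightarrow> N = {\<zero>\<^bsub>M\<^esub>} \<or> N = carrier M"
  using simple unfolding simple_module_def by blast

lemma nontrivial_action:
  obtains r x where "r \<in> carrier R" "x \<in> carrier M" "r \<odot>\<^bsub>M\<^esub> x \<noteq> \<zero>\<^bsub>M\<^esub>"
  using simple unfolding simple_module_def by blast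

text \<open>The vectors killed by all of \<open>R\<close> form a submodule, proper because $RM
  \<noteq> 0$, hence zero. The vector $x - 1x$ is one of them, as $r(1x) = rx$.\<close>

lemma smult_one:
  assumes x: "x \<in> carrier M" shows "\<one> \<odot>\<^bsub>M\<^esub> x = x"
proof -
  let ?N = "{x \<in> carrier M. \<forall>r\<in>carrier R. r \<odot>\<^bsub>M\<^esub> x = \<zero>\<^bsub>M\<^esub>}"
  have "submodule ?N R M" by (rule annihilated_submodule) simp_all
  moreover obtain r y where "r \<in> carrier R" "y \<in> carrier M" "r \<odot>\<^bsub>M\<^esub> y \<noteq> \<zero>\<^bsub>M\<^esub>"
    by (rule nontrivial_action)
  then have "?N \<noteq> carrier M" by blast
  ultimately have N: "?N = {\<zero>\<^bsub>M\<^esub>}" using submodule_trivial by blast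
  have c: "\<one> \<odot>\<^bsub>M\<^esub> x \<in> carrier M" by (rule smult_closed[OF R.one_closed x])
  have "x \<ominus>\<^bsub>M\<^esub> \<one> \<odot>\<^bsub>M\<^esub> x \<in> ?N"
    using x c by (simp add: M.minus_eq smult_r_distr smult_r_minus smult_assoc[symmetric] M.r_neg smult_closed)
  then have "x \<ominus>\<^bsub>M\<^esub> \<one> \<odot>\<^bsub>M\<^esub> x = \<zero>\<^bsub>M\<^esub>" unfolding N by simp
  then show ?thesis by (rule M.eq_if_minus_eq_zero[OF x c, symmetric])
qed

lemma carrier_nonzero: "carrier M \<noteq> {\<zero>\<^bsub>M\<^esub>}"
proof -
  obtain r y where "r \<in> carrier R" "y \<in> carrier M" "r \<odot>\<^bsub>M\<^esub> y \<noteq> \<zero>\<^bsub>M\<^esub>"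
    by (rule nontrivial_action)
  then show ?thesis using smult_closed[of r y] by blast
qed

text \<open>The vectors killed by \<open>J\<close> form a submodule that is proper because of
  \<open>j\<close> and \<open>y\<close>, hence zero. So $Jx$ is a non-zero submodule, and by
  simplicity it is all of \<open>M\<close>.\<close>

lemma ideal_smult_eq_carrier:
  assumes J: "ideal J R" and j: "j \<in> J" "y \<in> carrier M" "j \<odot>\<^bsub>M\<^esub> y \<noteq> \<zero>\<^bsub>M\<^esub>"
    and x: "x \<in> carrier M" "x \<noteq> \<zero>\<^bsub>M\<^esub>"
  shows "(\<lambda>j. j \<odot>\<^bsub>M\<^esub> x) ` J = carrier M"
proof -
  interpret J: ideal J R by (rule J)
  let ?N = "{x \<in> carrier M. \<forall>j\<in>J. j \<odot>\<^bsub>M\<^esub> x = \<zero>\<^bsub>M\<^esub>}"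
  have "submodule ?N R M" by (rule annihilated_submodule[OF J.a_subset]) (rule J.I_r_closed)
  moreover have "?N \<noteq> carrier M" using j by blast
  ultimately have "?N = {\<zero>\<^bsub>M\<^esub>}" using submodule_trivial by blast
  then have "x \<notin> ?N" using x by simp
  then have "(\<lambda>j. j \<odot>\<^bsub>M\<^esub> x) ` J \<noteq> {\<zero>\<^bsub>M\<^esub>}" using x by blast
  moreover have "submodule ((\<lambda>j. j \<odot>\<^bsub>M\<^esub> x) ` J) R M"
    by (rule ideal_smult_submodule[OF J.additive_subgroup_axioms _ x(1)]) (rule J.I_l_closed)
  ultimately show ?thesis using submodule_trivial by blast
qed

text \<open>If $e$ and $f$ act as the identity on $F$ and on $m - em$ respectively, then
  $e + f - fe$ acts as the identity on $F \<union> \{m\}$.\<close>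

lemma ideal_local_unit:
  assumes J: "ideal J R" and j: "j \<in> J" "y \<in> carrier M" "j \<odot>\<^bsub>M\<^esub> y \<noteq> \<zero>\<^bsub>M\<^esub>"
    and F: "finite F" "F \<subseteq> carrier M"
  shows "\<exists>e\<in>J. \<forall>b\<in>F. e \<odot>\<^bsub>M\<^esub> b = b"
  using F
proof (induction F)
  case empty
  then show ?case using j(1) by blast
next
  case (insert m F)
  interpret J: ideal J R by (rule J)
  have JR: "j \<in> carrier R" if "j \<in> J" for j using J.a_subset that by blast
  obtain e where e: "e \<in> J" "\<forall>b\<in>F. e \<odot>\<^bsub>M\<^esub> b = b" using insert by blast
  have m: "m \<in> carrier M" using insert by blast
  have Fc: "b \<in> carrier M" if "b \<in> F" for b using insert.prems that by blast
  have em: "e \<odot>\<^bsub>M\<^esub> m \<in> carrier M" by (rule smult_closed[OF JR[OF e(1)] m])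
  let ?x = "m \<ominus>\<^bsub>M\<^esub> e \<odot>\<^bsub>M\<^esub> m"
  show ?case
  proof (cases "?x = \<zero>\<^bsub>M\<^esub>")
    case True
    then have "e \<odot>\<^bsub>M\<^esub> m = m" by (rule M.eq_if_minus_eq_zero[OF m em, symmetric])
    then show ?thesis using e by blast
  next
    case False
    have xc: "?x \<in> carrier M" using m em by simp
    have "?x \<in> (\<lambda>j. j \<odot>\<^bsub>M\<^esub> ?x) ` J" using ideal_smult_eq_carrier[OF J j xc False] xc by simp
    then obtain f where f: "f \<in> J" "?x = f \<odot>\<^bsub>M\<^esub> ?x" by (rule imageE)
    have fR: "f \<in> carrier R" and eR: "e \<in> carrier R" using JR e f by simp_all
    let ?e = "e \<oplus> (f \<oplus> \<ominus> (f \<otimes> e))"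
    have act: "?e \<odot>\<^bsub>M\<^esub> b = e \<odot>\<^bsub>M\<^esub> b \<oplus>\<^bsub>M\<^esub> f \<odot>\<^bsub>M\<^esub> (b \<ominus>\<^bsub>M\<^esub> e \<odot>\<^bsub>M\<^esub> b)" if b: "b \<in> carrier M" for b
      using b fR eR by (simp add: smult_l_distr smult_l_minus smult_r_distr smult_r_minus
          smult_assoc smult_closed M.minus_eq)
    have "?e \<odot>\<^bsub>M\<^esub> b = b" if b: "b \<in> F" for b
    proof -
      have eb: "e \<odot>\<^bsub>M\<^esub> b = b" using e(2) b by simp
      show ?thesis
        using Fc[OF b] fR by (simp only: act[OF Fc[OF b]] eb) (simp add: M.minus_eq M.r_neg smult_r_null)
    qed
    moreover have "?e \<odot>\<^bsub>M\<^esub> m = m"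
      unfolding act[OF m] f(2)[symmetric] using m em
      by (simp add: M.minus_eq M.a_lcomm[of "e \<odot>\<^bsub>M\<^esub> m"] M.r_neg)
    moreover have "?e \<in> J" using e(1) f(1) fR by (simp add: J.a_closed J.a_inv_closed J.I_l_closed)
    ultimately show ?thesis by blast
  qed
qed

definition annihilator :: "'m set \<Rightarrow> 'a set" where
  "annihilator F = {r \<in> carrier R. \<forall>b\<in>F. r \<odot>\<^bsub>M\<^esub> b = \<zero>\<^bsub>M\<^esub>}"

lemma one_nonzero: "\<one> \<noteq> \<zero>"
proof
  assume z: "\<one> = \<zero>"
  obtain r y where r: "r \<in> carrier R" "y \<in> carrier M" "r \<odot>\<^bsub>M\<^esub> y \<noteq> \<zero>\<^bsub>M\<^esub>"
    by (rule nontrivial_action)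
  have "y = \<zero>\<^bsub>M\<^esub>" using smult_one[OF r(2)] smult_l_null[OF r(2)] z by simp
  then show False using r smult_r_null by simp
qed

lemma simple_ring_if_finite_annihilator_zero:
  assumes B: "finite B" "B \<subseteq> carrier M" and ann: "annihilator B = {\<zero>}"
  shows "simple_ring R"
  unfolding simple_ring_def
proof (intro conjI allI impI)
  show "ring R" ..
  show "\<exists>x\<in>carrier R. \<exists>y\<in>carrier R. x \<otimes> y \<noteq> \<zero>"
    using one_nonzero by (intro bexI[of _ \<one>]) simp_all
  fix J assume J: "ideal J R"
  interpret J: ideal J R by (rule J)
  have JR: "j \<in> carrier R" if "j \<in> J" for j using J.a_subset that by blast
  show "J = {\<zero>} \<or> J = carrier R"
  proof (cases "J = {\<zero>}")
    case False
    then obtain j where j: "j \<in> J" "j \<noteq> \<zero>" using J.zero_closed by blast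
    \<comment> \<open>A non-zero \<open>j\<close> must move some member of \<open>B\<close>; this
      witnesses that \<open>J\<close> does not annihilate \<open>M\<close>.\<close>
    then have "j \<notin> annihilator B" unfolding ann by simp
    then obtain y where y: "y \<in> B" "j \<odot>\<^bsub>M\<^esub> y \<noteq> \<zero>\<^bsub>M\<^esub>" using JR[OF j(1)] unfolding annihilator_def by blast
    obtain e where e: "e \<in> J" "\<forall>b\<in>B. e \<odot>\<^bsub>M\<^esub> b = b"
      using ideal_local_unit[OF J j(1) subsetD[OF B(2) y(1)] y(2) B] by blast
    have eR: "e \<in> carrier R" by (rule JR[OF e(1)])
    have "(\<one> \<ominus> e) \<odot>\<^bsub>M\<^esub> b = \<zero>\<^bsub>M\<^esub>" if b: "b \<in> B" for b
    proof -
      have bc: "b \<in> carrier M" using B b by blast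
      have "(\<one> \<ominus> e) \<odot>\<^bsub>M\<^esub> b = \<one> \<odot>\<^bsub>M\<^esub> b \<oplus>\<^bsub>M\<^esub> \<ominus>\<^bsub>M\<^esub> (e \<odot>\<^bsub>M\<^esub> b)"
        using bc eR by (simp add: R.minus_eq smult_l_distr smult_l_minus)
      also have "\<dots> = \<zero>\<^bsub>M\<^esub>" using e(2) b bc by (simp add: smult_one M.r_neg)
      finally show ?thesis .
    qed
    then have "\<one> \<ominus> e \<in> annihilator B" using eR by (simp add: annihilator_def)
    then have "\<one> = e" using ann eR by simp
    then show ?thesis using J.one_imp_carrier e(1) by simp
  qed simp
qed

text \<open>The annihilator of the empty set is the whole ring, which is non-zero. Adding the
  elements of \<open>B\<close> one by one, the annihilator becomes zero at some step;
  \<open>F\<close> and \<open>b\<close> are taken there.\<close>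

lemma annihilator_step:
  assumes "finite B" "annihilator B = {\<zero>}"
  shows "\<exists>F b. F \<subseteq> B \<and> b \<in> B \<and> annihilator F \<noteq> {\<zero>} \<and> annihilator (insert b F) = {\<zero>}"
  using assms
proof (induction B)
  case empty
  have "\<one> \<in> annihilator {}" by (simp add: annihilator_def)
  then show ?case using one_nonzero unfolding empty by simp
next
  case (insert b B)
  show ?case
  proof (cases "annihilator B = {\<zero>}")
    case True
    then obtain F c where "F \<subseteq> B" "c \<in> B" "annihilator F \<noteq> {\<zero>}" "annihilator (insert c F) = {\<zero>}"
      by (elim insert.IH[elim_format] exE conjE)
    then show ?thesis by (intro exI[of _ F] exI[of _ c] conjI) (simp_all add: subset_insertI2)
  next
    case False
    then show ?thesis using insert.prems by (intro exI[of _ B] exI[of _ b]) (simp add: subset_insertI)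
  qed
qed

lemma annihilator_left_ideal: "F \<subseteq> carrier M \<Longrightarrow> additive_subgroup (annihilator F) R"
  "\<lbrakk>F \<subseteq> carrier M; r \<in> carrier R; a \<in> annihilator F\<rbrakk> \<Longrightarrow> r \<otimes> a \<in> annihilator F"
proof -
  assume F: "F \<subseteq> carrier M"
  then have Fc: "b \<in> carrier M" if "b \<in> F" for b using that by blast
  show "additive_subgroup (annihilator F) R"
    by (intro additive_subgroup.intro subgroup.intro)
      (auto simp: annihilator_def smult_l_null smult_l_distr smult_l_minus Fc simp flip: a_inv_def)
  show "r \<otimes> a \<in> annihilator F" if "r \<in> carrier R" "a \<in> annihilator F"
    using that by (simp add: annihilator_def smult_assoc Fc smult_r_null)
qed

end

lemma (in ring) regular_submodule_left_module:
  assumes L: "additive_subgroup L R" and l: "\<And>r a. \<lbrakk>r \<in> carrier R; a \<in> L\<rbrakk> \<Longrightarrow> r \<otimes> a \<in> L"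
  shows "submodule L R (regular_module R)" "left_module R ((regular_module R)\<lparr>carrier := L\<rparr>)"
proof -
  interpret L: additive_subgroup L R by (rule L)
  have LR: "a \<in> carrier R" if "a \<in> L" for a using L.a_subset that by blast
  have inv: "inv\<^bsub>add_monoid (regular_module R)\<^esub> x = \<ominus> x" for x
    by (simp add: regular_module_def a_inv_def m_inv_def)
  show "submodule L R (regular_module R)"
    by (intro submodule.intro submodule_axioms.intro subgroup.intro)
      (simp_all add: inv L.a_inv_closed, simp_all add: regular_module_def l LR L.a_closed L.zero_closed subsetI)
  show "left_module R ((regular_module R)\<lparr>carrier := L\<rparr>)"
  proof (intro left_module.intro left_module_axioms.intro abelian_groupI)
    show "ring R" ..
    show "\<exists>y\<in>carrier ((regular_module R)\<lparr>carrier := L\<rparr>).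
        y \<oplus>\<^bsub>(regular_module R)\<lparr>carrier := L\<rparr>\<^esub> x = \<zero>\<^bsub>(regular_module R)\<lparr>carrier := L\<rparr>\<^esub>"
      if "x \<in> carrier ((regular_module R)\<lparr>carrier := L\<rparr>)" for x
      using that L.a_inv_closed[of x]
      by (intro bexI[of _ "\<ominus> x"]) (simp_all add: regular_module_def l_neg LR)
  qed (simp_all add: regular_module_def l LR L.a_closed L.zero_closed add.m_ac l_distr r_distr m_assoc)
qed

context simple_left_module
begin

text \<open>With $\operatorname{ann}(F) \neq 0$ and $\operatorname{ann}(F \cup \{b\}) = 0$, the map
  $a \mapsto ab$ embeds the left ideal $\operatorname{ann}(F)$ into the simple module $M$.\<close>

lemma annihilator_minimal_left_ideal:
  assumes F: "F \<subseteq> carrier M" "b \<in> carrier M"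
    and ann: "annihilator F \<noteq> {\<zero>}" "annihilator (insert b F) = {\<zero>}"
  shows "minimal_left_ideal (annihilator F) R"
proof -
  let ?L = "annihilator F"
  let ?LM = "(regular_module R)\<lparr>carrier := ?L\<rparr>"
  note left = annihilator_left_ideal[OF F(1)]
  interpret L: additive_subgroup ?L R by (rule left(1))
  have LR: "a \<in> carrier R" if "a \<in> ?L" for a using L.a_subset that by blast
  note lm = R.regular_submodule_left_module[OF left]
  have "{\<zero>} \<subset> ?L" using ann(1) L.zero_closed by (intro psubsetI) simp_all
  then obtain a where a: "a \<in> ?L" "a \<noteq> \<zero>" by (elim psubset_imp_ex_mem[elim_format] exE DiffE) simp
  have inj: "c = \<zero>" if c: "c \<in> ?L" "c \<odot>\<^bsub>M\<^esub> b = \<zero>\<^bsub>M\<^esub>" for c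
  proof -
    have "c \<in> annihilator (insert b F)"
      using c unfolding annihilator_def by blast
    then have "c \<in> {\<zero>}" by (simp only: ann(2))
    then show ?thesis by (rule singletonD)
  qed
  have triv: "N = {\<zero>\<^bsub>?LM\<^esub>} \<or> N = carrier ?LM" if N: "submodule N R ?LM" for N
  proof -
    interpret N: submodule N R ?LM by (rule N)
    have NL: "N \<subseteq> ?L" using N.subset by simp
    have NR: "c \<in> carrier R" if "c \<in> N" for c using NL LR that by blast
    have zN: "\<zero> \<in> N" using N.one_closed by (simp add: regular_module_def)
    have aN: "c \<oplus> d \<in> N" if "c \<in> N" "d \<in> N" for c d
      using N.m_closed[OF that] by (simp add: regular_module_def)
    have sN: "r \<otimes> c \<in> N" if "r \<in> carrier R" "c \<in> N" for r c
      using N.smult_closed[OF that] by (simp add: regular_module_def)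
    have nN: "\<ominus> c \<in> N" if "c \<in> N" for c
      using sN[of "\<ominus> \<one>" c] that NR by (simp add: R.l_minus)
    have N': "additive_subgroup N R"
      by (intro additive_subgroup.intro subgroup.intro)
        (use NR zN aN nN in \<open>auto simp flip: a_inv_def\<close>)
    show ?thesis
    proof (cases "N = {\<zero>}")
      case True
      then show ?thesis by (simp add: regular_module_def)
    next
      case False
      then have "{\<zero>} \<subset> N" using zN by (intro psubsetI) simp_all
      then obtain c where c: "c \<in> N" "c \<noteq> \<zero>" by (elim psubset_imp_ex_mem[elim_format] exE DiffE) simp
      then have "c \<odot>\<^bsub>M\<^esub> b \<noteq> \<zero>\<^bsub>M\<^esub>" using inj NL by blast
      then have "(\<lambda>j. j \<odot>\<^bsub>M\<^esub> b) ` N \<noteq> {\<zero>\<^bsub>M\<^esub>}" using c(1) by blast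
      \<comment> \<open>Since \<open>N\<close> already reaches all of \<open>M\<close> from
        \<open>b\<close>, each \<open>d\<close> in the annihilator agrees on \<open>b\<close> with
        some \<open>e\<close> in \<open>N\<close>, and injectivity on \<open>b\<close> gives $d =
        e$.\<close>
      then have Nb: "(\<lambda>j. j \<odot>\<^bsub>M\<^esub> b) ` N = carrier M"
        using submodule_trivial[OF ideal_smult_submodule[OF N' sN F(2)]] by blast
      have "?L \<subseteq> N"
      proof
        fix d assume d: "d \<in> ?L"
        have "d \<odot>\<^bsub>M\<^esub> b \<in> (\<lambda>j. j \<odot>\<^bsub>M\<^esub> b) ` N" unfolding Nb by (rule smult_closed[OF LR[OF d] F(2)])
        then obtain e where e: "e \<in> N" "d \<odot>\<^bsub>M\<^esub> b = e \<odot>\<^bsub>M\<^esub> b" by (rule imageE)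
        have eb: "e \<odot>\<^bsub>M\<^esub> b \<in> carrier M" by (rule smult_closed[OF NR[OF e(1)] F(2)])
        have "d \<ominus> e \<in> ?L" unfolding R.minus_eq using d e(1) NL by (intro L.a_closed L.a_inv_closed) auto
        moreover have "(d \<ominus> e) \<odot>\<^bsub>M\<^esub> b = \<zero>\<^bsub>M\<^esub>"
          using LR[OF d] NR[OF e(1)] F(2) eb
          by (simp add: R.minus_eq smult_l_distr smult_l_minus e(2) M.r_neg)
        ultimately have "d \<ominus> e = \<zero>" by (rule inj)
        then have "d = e" using LR[OF d] NR[OF e(1)] by simp
        then show "d \<in> N" using e(1) by simp
      qed
      then show ?thesis using NL by simp
    qed
  qed
  have "simple_module R ?LM"
    unfolding simple_module_def
  proof (intro conjI allI impI)
    show "left_module R ?LM" by (rule lm(2))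
    have "\<one> \<odot>\<^bsub>?LM\<^esub> a \<noteq> \<zero>\<^bsub>?LM\<^esub>" using a LR by (simp add: regular_module_def)
    moreover have "a \<in> carrier ?LM" using a by simp
    ultimately show "\<exists>r\<in>carrier R. \<exists>x\<in>carrier ?LM. r \<odot>\<^bsub>?LM\<^esub> x \<noteq> \<zero>\<^bsub>?LM\<^esub>"
      by (intro bexI[of _ \<one>] bexI[of _ a] R.one_closed)
  qed (rule triv)
  then show ?thesis using lm(1) by (simp add: minimal_left_ideal_def)
qed

theorem simple_ring_and_minimal_left_ideal:
  assumes B: "finite B" "B \<subseteq> carrier M" and ann: "annihilator B = {\<zero>}"
  shows "simple_ring R \<and> (\<exists>L. minimal_left_ideal L R)"
proof
  show "simple_ring R" by (rule simple_ring_if_finite_annihilator_zero[OF assms])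
  obtain F b where "F \<subseteq> B" "b \<in> B" "annihilator F \<noteq> {\<zero>}" "annihilator (insert b F) = {\<zero>}"
    using annihilator_step[OF B(1) ann] by blast
  then have "minimal_left_ideal (annihilator F) R"
    using B(2) by (intro annihilator_minimal_left_ideal) auto
  then show "\<exists>L. minimal_left_ideal L R" ..
qed

end

section \<open>Modules over the group algebra\<close>

context group_algebra_loc
begin

text \<open>The monomial $kg$. Scalars are the case of the identity of \<open>G\<close>, and group
  elements the case $k = 1$.\<close>

definition single :: "'g \<Rightarrow> 'k \<Rightarrow> 'g \<Rightarrow> 'k" where
  "single g k = (\<lambda>x\<in>carrier G. if x = g then k else \<zero>\<^bsub>K\<^esub>)"

lemma ga_scalar_eq_single: "ga_scalar K G k = single \<one>\<^bsub>G\<^esub> k"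
  by (simp add: ga_scalar_def single_def)

lemma ga_one_eq_single: "\<one>\<^bsub>KG\<^esub> = single \<one>\<^bsub>G\<^esub> \<one>\<^bsub>K\<^esub>"
  by (simp add: group_algebra_def single_def)

lemma single_apply: "x \<in> carrier G \<Longrightarrow> single g k x = (if x = g then k else \<zero>\<^bsub>K\<^esub>)"
  by (simp add: single_def)

lemma single_closed: "k \<in> carrier K \<Longrightarrow> single g k \<in> carrier KG"
  unfolding single_def by (rule ga_memI[of _ "{g}"]) auto

lemma single_mult_apply:
  assumes g: "g \<in> carrier G" and k: "k \<in> carrier K" and f: "f \<in> carrier KG" and x: "x \<in> carrier G"
  shows "(single g k \<otimes>\<^bsub>KG\<^esub> f) x = k \<otimes>\<^bsub>K\<^esub> f (inv\<^bsub>G\<^esub> g \<otimes>\<^bsub>G\<^esub> x)"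
proof -
  have "(single g k \<otimes>\<^bsub>KG\<^esub> f) x = (\<Oplus>\<^bsub>K\<^esub>y\<in>{g}. single g k y \<otimes>\<^bsub>K\<^esub> f (inv\<^bsub>G\<^esub> y \<otimes>\<^bsub>G\<^esub> x))"
    by (rule ga_mult[OF single_closed[OF k] f x]) (auto simp: g ga_support_def single_apply split: if_splits)
  also have "\<dots> = k \<otimes>\<^bsub>K\<^esub> f (inv\<^bsub>G\<^esub> g \<otimes>\<^bsub>G\<^esub> x)"
    using g k x ga_closed[OF f, of "inv\<^bsub>G\<^esub> g \<otimes>\<^bsub>G\<^esub> x"] by (simp add: single_apply)
  finally show ?thesis .
qed

lemma single_mult_single:
  assumes g: "g \<in> carrier G" and k: "k \<in> carrier K" and h: "h \<in> carrier G" and l: "l \<in> carrier K"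
  shows "single g k \<otimes>\<^bsub>KG\<^esub> single h l = single (g \<otimes>\<^bsub>G\<^esub> h) (k \<otimes>\<^bsub>K\<^esub> l)"
proof (rule ga_ext)
  show "single g k \<otimes>\<^bsub>KG\<^esub> single h l \<in> carrier KG"
    by (rule ga_mult_closed[OF single_closed[OF k] single_closed[OF l]])
  show "single (g \<otimes>\<^bsub>G\<^esub> h) (k \<otimes>\<^bsub>K\<^esub> l) \<in> carrier KG"
    using k l by (intro single_closed) simp
  fix x assume x: "x \<in> carrier G"
  have "inv\<^bsub>G\<^esub> g \<otimes>\<^bsub>G\<^esub> x = h \<longleftrightarrow> x = g \<otimes>\<^bsub>G\<^esub> h"
    using G.inv_solve_left'[OF h g x] by (metis)
  then show "(single g k \<otimes>\<^bsub>KG\<^esub> single h l) x = single (g \<otimes>\<^bsub>G\<^esub> h) (k \<otimes>\<^bsub>K\<^esub> l) x"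
    using g k x by (simp add: single_mult_apply[OF g k single_closed[OF l] x] single_apply)
qed

lemma single_add:
  assumes k: "k \<in> carrier K" and l: "l \<in> carrier K"
  shows "single g k \<oplus>\<^bsub>KG\<^esub> single g l = single g (k \<oplus>\<^bsub>K\<^esub> l)"
  by (rule ga_ext) (use k l in \<open>simp_all add: single_closed ga_add_closed ga_add single_apply\<close>)

lemma scalar_mult_apply:
  assumes k: "k \<in> carrier K" and f: "f \<in> carrier KG" and x: "x \<in> carrier G"
  shows "(ga_scalar K G k \<otimes>\<^bsub>KG\<^esub> f) x = k \<otimes>\<^bsub>K\<^esub> f x"
  unfolding ga_scalar_eq_single using single_mult_apply[OF G.one_closed k f x] x by simp

lemma mult_scalar_apply:
  assumes k: "k \<in> carrier K" and f: "f \<in> carrier KG" and x: "x \<in> carrier G"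
  shows "(f \<otimes>\<^bsub>KG\<^esub> ga_scalar K G k) x = f x \<otimes>\<^bsub>K\<^esub> k"
proof -
  \<comment> \<open>The only term that can be non-zero sits at index \<open>x\<close>, which may lie
    outside the support; it is adjoined so that the singleton sum applies.\<close>
  have S: "finite (insert x (supp f))" "supp f \<subseteq> insert x (supp f)" "insert x (supp f) \<subseteq> carrier G"
    using x ga_finite[OF f] supp_sub by auto
  have "(f \<otimes>\<^bsub>KG\<^esub> ga_scalar K G k) x =
      (\<Oplus>\<^bsub>K\<^esub>y\<in>insert x (supp f). f y \<otimes>\<^bsub>K\<^esub> single \<one>\<^bsub>G\<^esub> k (inv\<^bsub>G\<^esub> y \<otimes>\<^bsub>G\<^esub> x))"
    unfolding ga_scalar_eq_single by (rule ga_mult[OF f single_closed[OF k] x S])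
  also have "\<dots> = (\<Oplus>\<^bsub>K\<^esub>y\<in>insert x (supp f). if x = y then f y \<otimes>\<^bsub>K\<^esub> k else \<zero>\<^bsub>K\<^esub>)"
  proof (rule K.finsum_cong')
    fix y assume "y \<in> insert x (supp f)"
    then have y: "y \<in> carrier G" using S by auto
    have "inv\<^bsub>G\<^esub> y \<otimes>\<^bsub>G\<^esub> x = \<one>\<^bsub>G\<^esub> \<longleftrightarrow> x = y"
      using G.inv_solve_left'[OF G.one_closed y x] y by auto
    then show "f y \<otimes>\<^bsub>K\<^esub> single \<one>\<^bsub>G\<^esub> k (inv\<^bsub>G\<^esub> y \<otimes>\<^bsub>G\<^esub> x) = (if x = y then f y \<otimes>\<^bsub>K\<^esub> k else \<zero>\<^bsub>K\<^esub>)"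
      using x y k by (simp add: single_apply ga_closed[OF f])
  qed (use S k in \<open>auto simp: ga_closed[OF f]\<close>)
  also have "\<dots> = f x \<otimes>\<^bsub>K\<^esub> k"
    using S x k by (intro K.finsum_singleton) (auto simp: ga_closed[OF f])
  finally show ?thesis .
qed

text \<open>Splitting off one monomial strictly shrinks the support; this drives the induction from
  monomials to all elements.\<close>

lemma ga_eq_single_add:
  assumes f: "f \<in> carrier KG" and s: "s \<in> carrier G"
  shows "\<exists>f'\<in>carrier KG. f = single s (f s) \<oplus>\<^bsub>KG\<^esub> f' \<and> supp f' \<subseteq> supp f - {s}"
proof
  let ?f = "\<lambda>x\<in>carrier G. if x = s then \<zero>\<^bsub>K\<^esub> else f x"
  show f': "?f \<in> carrier KG"
    by (rule ga_memI[OF _ ga_finite[OF f]]) (auto simp: ga_closed[OF f] ga_support_def)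
  have "f = single s (f s) \<oplus>\<^bsub>KG\<^esub> ?f"
    by (rule ga_ext[OF f ga_add_closed[OF single_closed[OF ga_closed[OF f s]] f']])
      (simp add: ga_add single_apply ga_closed[OF f] ga_closed[OF f s])
  moreover have "supp ?f \<subseteq> supp f - {s}" by (auto simp: ga_support_def split: if_splits)
  ultimately show "f = single s (f s) \<oplus>\<^bsub>KG\<^esub> ?f \<and> supp ?f \<subseteq> supp f - {s}" ..
qed

end

section \<open>The vector space and the representation carried by a simple module\<close>

locale simple_group_algebra_module = group_algebra_loc K G + F: field K +
    S: simple_left_module "group_algebra K G" M
  for K :: "('k, 'x) ring_scheme" (structure) and G :: "('g, 'y) monoid_scheme" (structure)
    and M :: "('g \<Rightarrow> 'k, 'm, 'z) module_scheme" (structure)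
begin

abbreviation "V \<equiv> underlying_space K G M"

lemma V_simps: "carrier V = carrier M" "\<zero>\<^bsub>V\<^esub> = \<zero>\<^bsub>M\<^esub>" "x \<oplus>\<^bsub>V\<^esub> y = x \<oplus>\<^bsub>M\<^esub> y"
  "k \<odot>\<^bsub>V\<^esub> x = ga_scalar K G k \<odot>\<^bsub>M\<^esub> x"
  by (simp_all add: underlying_space_def)

text \<open>Scalars are central because \<open>K\<close> is commutative. Hence group elements act
  $K$-linearly, and kernels of algebra elements are $K$-subspaces.\<close>

lemma scalar_commute:
  assumes k: "k \<in> carrier K" and f: "f \<in> carrier KG"
  shows "f \<otimes>\<^bsub>KG\<^esub> ga_scalar K G k = ga_scalar K G k \<otimes>\<^bsub>KG\<^esub> f"
proof -
  have s: "ga_scalar K G k \<in> carrier KG" unfolding ga_scalar_eq_single by (rule single_closed[OF k])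
  show ?thesis
    by (rule ga_ext[OF ga_mult_closed[OF f s] ga_mult_closed[OF s f]])
      (simp add: mult_scalar_apply[OF k f] scalar_mult_apply[OF k f] F.m_comm[OF ga_closed[OF f] k])
qed

lemma vector_space_over_V: "vector_space_over K V"
proof -
  have "module K V"
  proof (rule moduleI)
    show "cring K" ..
    show "abelian_group V"
    proof (rule abelian_groupI)
      show "\<exists>y\<in>carrier V. y \<oplus>\<^bsub>V\<^esub> x = \<zero>\<^bsub>V\<^esub>" if "x \<in> carrier V" for x
        using that by (intro bexI[of _ "\<ominus>\<^bsub>M\<^esub> x"]) (simp_all add: V_simps S.M.l_neg)
    qed (simp_all add: V_simps S.M.add.m_ac)
    have sc: "ga_scalar K G a \<in> carrier KG" if "a \<in> carrier K" for a
      unfolding ga_scalar_eq_single by (rule single_closed[OF that])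
    show "a \<odot>\<^bsub>V\<^esub> x \<in> carrier V" if "a \<in> carrier K" "x \<in> carrier V" for a x
      using that S.smult_closed[OF sc] by (simp add: V_simps)
    show "(a \<oplus> b) \<odot>\<^bsub>V\<^esub> x = a \<odot>\<^bsub>V\<^esub> x \<oplus>\<^bsub>V\<^esub> b \<odot>\<^bsub>V\<^esub> x"
      if ab: "a \<in> carrier K" "b \<in> carrier K" and x: "x \<in> carrier V" for a b x
      using x S.smult_l_distr[OF sc[OF ab(1)] sc[OF ab(2)]] single_add[OF ab]
      by (simp add: V_simps ga_scalar_eq_single)
    show "a \<odot>\<^bsub>V\<^esub> (x \<oplus>\<^bsub>V\<^esub> y) = a \<odot>\<^bsub>V\<^esub> x \<oplus>\<^bsub>V\<^esub> a \<odot>\<^bsub>V\<^esub> y"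
      if "a \<in> carrier K" "x \<in> carrier V" "y \<in> carrier V" for a x y
      using that S.smult_r_distr[OF sc] by (simp add: V_simps)
    show "a \<otimes> b \<odot>\<^bsub>V\<^esub> x = a \<odot>\<^bsub>V\<^esub> (b \<odot>\<^bsub>V\<^esub> x)"
      if ab: "a \<in> carrier K" "b \<in> carrier K" and x: "x \<in> carrier V" for a b x
      using x S.smult_assoc[OF sc[OF ab(1)] sc[OF ab(2)]]
        single_mult_single[OF G.one_closed ab(1) G.one_closed ab(2)]
      by (simp add: V_simps ga_scalar_eq_single)
    \<comment> \<open>A $K$-space must be unital; simplicity of \<open>M\<close> supplies this
      law.\<close>
    show "\<one> \<odot>\<^bsub>V\<^esub> x = x" if "x \<in> carrier V" for x
      using that S.smult_one by (simp add: V_simps ga_scalar_eq_single ga_one_eq_single)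
  qed
  then show ?thesis by (intro vector_space_over.intro F.field_axioms)
qed

sublocale V: vector_space_over K V by (rule vector_space_over_V)

lemma representation_V: "representation K V G (\<lambda>g x. single g \<one>\<^bsub>K\<^esub> \<odot>\<^bsub>M\<^esub> x)"
proof (intro representation.intro representation_axioms.intro vector_space_over_V G.group_axioms)
  fix g h k x y
  assume g: "g \<in> carrier G" and x: "x \<in> carrier V"
  have sg: "single g \<one>\<^bsub>K\<^esub> \<in> carrier KG" by (rule single_closed[OF K.one_closed])
  show "single g \<one>\<^bsub>K\<^esub> \<odot>\<^bsub>M\<^esub> x \<in> carrier V" using x S.smult_closed[OF sg] by (simp add: V_simps)
  show "single g \<one>\<^bsub>K\<^esub> \<odot>\<^bsub>M\<^esub> (x \<oplus>\<^bsub>V\<^esub> y) = single g \<one>\<^bsub>K\<^esub> \<odot>\<^bsub>M\<^esub> x \<oplus>\<^bsub>V\<^esub> single g \<one>\<^bsub>K\<^esub> \<odot>\<^bsub>M\<^esub> y"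
    if "y \<in> carrier V" using x that S.smult_r_distr[OF sg] by (simp add: V_simps)
  show "single g \<one>\<^bsub>K\<^esub> \<odot>\<^bsub>M\<^esub> (k \<odot>\<^bsub>V\<^esub> x) = k \<odot>\<^bsub>V\<^esub> (single g \<one>\<^bsub>K\<^esub> \<odot>\<^bsub>M\<^esub> x)" if k: "k \<in> carrier K"
  proof -
    have sk: "ga_scalar K G k \<in> carrier KG" unfolding ga_scalar_eq_single by (rule single_closed[OF k])
    have xM: "x \<in> carrier M" using x by (simp add: V_simps)
    show ?thesis unfolding V_simps
      by (simp only: S.smult_assoc[OF sg sk xM, symmetric] S.smult_assoc[OF sk sg xM, symmetric]
          scalar_commute[OF k sg])
  qed
  show "single (g \<otimes>\<^bsub>G\<^esub> h) \<one>\<^bsub>K\<^esub> \<odot>\<^bsub>M\<^esub> x = single g \<one>\<^bsub>K\<^esub> \<odot>\<^bsub>M\<^esub> (single h \<one>\<^bsub>K\<^esub> \<odot>\<^bsub>M\<^esub> x)"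
    if h: "h \<in> carrier G"
    using x S.smult_assoc[OF sg single_closed[OF K.one_closed, of h]]
      single_mult_single[OF g K.one_closed h K.one_closed] by (simp add: V_simps)
next
  fix x assume "x \<in> carrier V"
  then show "single \<one>\<^bsub>G\<^esub> \<one>\<^bsub>K\<^esub> \<odot>\<^bsub>M\<^esub> x = x"
    using S.smult_one by (simp add: V_simps ga_one_eq_single)
qed

sublocale rep: representation K V G "\<lambda>g x. single g \<one>\<^bsub>K\<^esub> \<odot>\<^bsub>M\<^esub> x"
  by (rule representation_V)

text \<open>Every algebra element is a finite sum of monomials $kg$, and a $G$-stable subspace is
  closed under each of these. This identifies stable subspaces with submodules.\<close>

lemma invariant_smult_closed:
  assumes U: "rep.invariant (carrier G) U" and x: "x \<in> U" and f: "f \<in> carrier KG"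
  shows "f \<odot>\<^bsub>M\<^esub> x \<in> U"
proof -
  have sU: "submodule U K V" using U by (simp add: rep.invariant_def)
  note u = V.submoduleE[OF sU]
  have xM: "x \<in> carrier M" using u(1) x by (auto simp: V_simps)
  have single: "single g k \<odot>\<^bsub>M\<^esub> x \<in> U" if g: "g \<in> carrier G" and k: "k \<in> carrier K" for g k
  proof -
    have sg: "single g \<one>\<^bsub>K\<^esub> \<in> carrier KG" and sk: "single \<one>\<^bsub>G\<^esub> k \<in> carrier KG"
      by (rule single_closed[OF K.one_closed], rule single_closed[OF k])
    have "single \<one>\<^bsub>G\<^esub> k \<otimes>\<^bsub>KG\<^esub> single g \<one>\<^bsub>K\<^esub> = single g k"
      using single_mult_single[OF G.one_closed k g K.one_closed] g k by simp
    then have "single g k \<odot>\<^bsub>M\<^esub> x = k \<odot>\<^bsub>V\<^esub> (single g \<one>\<^bsub>K\<^esub> \<odot>\<^bsub>M\<^esub> x)"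
      using S.smult_assoc[OF sk sg xM] by (simp add: V_simps ga_scalar_eq_single)
    moreover have "single g \<one>\<^bsub>K\<^esub> \<odot>\<^bsub>M\<^esub> x \<in> U" using U x g by (simp add: rep.invariant_def)
    ultimately show ?thesis using u(4)[OF k] by simp
  qed
  \<comment> \<open>The induction runs over a finite set bounding the support, with \<open>f\<close>
    quantified inside, since the remainder is a different element.\<close>
  have "\<forall>f\<in>carrier KG. supp f \<subseteq> T \<longrightarrow> f \<odot>\<^bsub>M\<^esub> x \<in> U" if "finite T" for T
    using that
  proof (induction T)
    case empty
    show ?case
    proof (intro ballI impI)
      fix f assume f: "f \<in> carrier KG" "supp f \<subseteq> {}"
      have "f = \<zero>\<^bsub>KG\<^esub>"
        by (rule ga_ext[OF f(1) ga_zero_closed]) (use f(2) in \<open>auto simp: ga_zero ga_support_def\<close>)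
      then show "f \<odot>\<^bsub>M\<^esub> x \<in> U"
        using V.submodule_zero[OF sU] by (simp add: S.smult_l_null[OF xM] V_simps)
    qed
  next
    case (insert s T)
    show ?case
    proof (intro ballI impI)
      fix f assume f: "f \<in> carrier KG" "supp f \<subseteq> insert s T"
      show "f \<odot>\<^bsub>M\<^esub> x \<in> U"
      proof (cases "s \<in> carrier G")
        \<comment> \<open>\<open>T\<close> is an arbitrary finite set; members outside the group
          never meet a support.\<close>
        case False
        then have "supp f \<subseteq> T" using f(2) supp_sub[of f] by blast
        then show ?thesis using insert.IH f(1) by simp
      next
        case True
        obtain f' where f': "f' \<in> carrier KG" "f = single s (f s) \<oplus>\<^bsub>KG\<^esub> f'" "supp f' \<subseteq> supp f - {s}"
          using ga_eq_single_add[OF f(1) True] by blast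
        have fs: "f s \<in> carrier K" by (rule ga_closed[OF f(1) True])
        have "supp f' \<subseteq> T" using f'(3) f(2) by blast
        then have "f' \<odot>\<^bsub>M\<^esub> x \<in> U" using insert.IH f'(1) by simp
        then have "single s (f s) \<odot>\<^bsub>M\<^esub> x \<oplus>\<^bsub>V\<^esub> f' \<odot>\<^bsub>M\<^esub> x \<in> U"
          by (rule u(5)[OF single[OF True fs]])
        moreover have "f \<odot>\<^bsub>M\<^esub> x = single s (f s) \<odot>\<^bsub>M\<^esub> x \<oplus>\<^bsub>M\<^esub> f' \<odot>\<^bsub>M\<^esub> x"
          by (subst f'(2)) (rule S.smult_l_distr[OF single_closed[OF fs] f'(1) xM])
        ultimately show ?thesis by (simp add: V_simps)
      qed
    qed
  qed
  from this[OF ga_finite[OF f]] f show ?thesis by simp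
qed

lemma irreducible_rep_V: "rep.irreducible_rep"
  unfolding rep.irreducible_rep_def
proof (intro conjI allI impI)
  show "carrier V \<noteq> {\<zero>\<^bsub>V\<^esub>}" using S.carrier_nonzero by (simp add: V_simps)
  fix U assume U: "rep.invariant (carrier G) U"
  have sU: "submodule U K V" using U by (simp add: rep.invariant_def)
  note u = V.submoduleE[OF sU]
  have UM: "x \<in> carrier M" if "x \<in> U" for x using u(1) that by (auto simp: V_simps)
  have "submodule U KG M"
  proof (rule S.left_submoduleI)
    show "U \<subseteq> carrier M" using UM by blast
    show "\<zero>\<^bsub>M\<^esub> \<in> U" using V.submodule_zero[OF sU] by (simp add: V_simps)
    show "x \<oplus>\<^bsub>M\<^esub> y \<in> U" if "x \<in> U" "y \<in> U" for x y using u(5)[OF that] by (simp add: V_simps)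
    show "f \<odot>\<^bsub>M\<^esub> x \<in> U" if "f \<in> carrier KG" "x \<in> U" for f x
      by (rule invariant_smult_closed[OF U that(2,1)])
    show "\<ominus>\<^bsub>M\<^esub> x \<in> U" if x: "x \<in> U" for x
    proof -
      have "(\<ominus>\<^bsub>KG\<^esub> \<one>\<^bsub>KG\<^esub>) \<odot>\<^bsub>M\<^esub> x \<in> U"
        by (rule invariant_smult_closed[OF U x S.R.a_inv_closed[OF S.R.one_closed]])
      then show ?thesis
        by (simp add: S.smult_l_minus[OF S.R.one_closed UM[OF x]] S.smult_one[OF UM[OF x]])
    qed
  qed
  then show "U = {\<zero>\<^bsub>V\<^esub>} \<or> U = carrier V" using S.submodule_trivial by (simp add: V_simps)
qed

text \<open>The kernel of \<open>f\<close> on \<open>M\<close> is a $K$-subspace because scalars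
  commute with \<open>f\<close>, so containing a basis it is everything.\<close>

lemma annihilates_basis_annihilates:
  assumes B: "lin_basis K V B" and f: "f \<in> carrier KG" and z: "\<And>b. b \<in> B \<Longrightarrow> f \<odot>\<^bsub>M\<^esub> b = \<zero>\<^bsub>M\<^esub>"
    and x: "x \<in> carrier M"
  shows "f \<odot>\<^bsub>M\<^esub> x = \<zero>\<^bsub>M\<^esub>"
proof -
  let ?N = "{x \<in> carrier M. f \<odot>\<^bsub>M\<^esub> x = \<zero>\<^bsub>M\<^esub>}"
  have "submodule ?N K V"
  proof (rule V.submoduleI')
    show "?N \<subseteq> carrier V" by (auto simp: V_simps)
    show "\<zero>\<^bsub>V\<^esub> \<in> ?N" by (simp add: V_simps S.smult_r_null[OF f])
    show "x \<oplus>\<^bsub>V\<^esub> y \<in> ?N" if "x \<in> ?N" "y \<in> ?N" for x y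
      using that by (simp add: V_simps S.smult_r_distr[OF f])
    show "k \<odot>\<^bsub>V\<^esub> x \<in> ?N" if k: "k \<in> carrier K" and x: "x \<in> ?N" for k x
    proof -
      have sk: "ga_scalar K G k \<in> carrier KG" unfolding ga_scalar_eq_single by (rule single_closed[OF k])
      have xM: "x \<in> carrier M" "f \<odot>\<^bsub>M\<^esub> x = \<zero>\<^bsub>M\<^esub>" using x by simp_all
      have "f \<odot>\<^bsub>M\<^esub> (ga_scalar K G k \<odot>\<^bsub>M\<^esub> x) = ga_scalar K G k \<odot>\<^bsub>M\<^esub> (f \<odot>\<^bsub>M\<^esub> x)"
        by (simp only: S.smult_assoc[OF f sk xM(1), symmetric] S.smult_assoc[OF sk f xM(1), symmetric]
            scalar_commute[OF k f])
      then show ?thesis using S.smult_closed[OF sk xM(1)] by (simp add: V_simps xM(2) S.smult_r_null[OF sk])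
    qed
  qed
  moreover have "B \<subseteq> ?N" using B z by (auto simp: lin_basis_def V_simps)
  ultimately have "lin_span K V B \<subseteq> ?N" by (rule V.lin_span_subset_submodule)
  then show ?thesis using B x by (auto simp: lin_basis_def V_simps)
qed

end

text \<open>Restriction of scalars along \<phi>. It makes a module over a quotient of $KG$ into a
  $KG$-module, to which the dimension bound applies.\<close>

definition pullback_module ::
  "('a \<Rightarrow> 'b) \<Rightarrow> ('b, 'm, 'z) module_scheme \<Rightarrow> ('a, 'm) module" where
  "pullback_module \<phi> M =
     \<lparr>carrier = carrier M, monoid.mult = monoid.mult M, one = one M,
      ring.zero = ring.zero M, ring.add = ring.add M, smult = (\<lambda>r x. \<phi> r \<odot>\<^bsub>M\<^esub> x)\<rparr>"

text \<open>Surjectivity of \<phi> means that both rings act through the same maps, so the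
  submodules coincide.\<close>

lemma simple_module_pullback:
  assumes R: "ring R" and M: "simple_module S M" and \<phi>: "\<phi> \<in> ring_hom R S" "\<phi> ` carrier R = carrier S"
  shows "simple_module R (pullback_module \<phi> M)"
proof -
  interpret R: ring R by (rule R)
  interpret M: simple_left_module S M
    using M by (intro simple_left_module.intro simple_left_module_axioms.intro) (simp_all add: simple_module_def)
  let ?M = "pullback_module \<phi> M"
  have ms: "carrier ?M = carrier M" "\<zero>\<^bsub>?M\<^esub> = \<zero>\<^bsub>M\<^esub>" "x \<oplus>\<^bsub>?M\<^esub> y = x \<oplus>\<^bsub>M\<^esub> y"
    "r \<odot>\<^bsub>?M\<^esub> x = \<phi> r \<odot>\<^bsub>M\<^esub> x" for x y r
    by (simp_all add: pullback_module_def)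
  have \<phi>S: "\<phi> r \<in> carrier S" if "r \<in> carrier R" for r using \<phi>(2) that by blast
  have minv: "inv\<^bsub>add_monoid ?M\<^esub> x = inv\<^bsub>add_monoid M\<^esub> x" for x
    by (simp add: m_inv_def pullback_module_def)
  have "left_module R ?M"
  proof (intro left_module.intro left_module_axioms.intro abelian_groupI)
    show "\<exists>y\<in>carrier ?M. y \<oplus>\<^bsub>?M\<^esub> x = \<zero>\<^bsub>?M\<^esub>" if "x \<in> carrier ?M" for x
      using that by (intro bexI[of _ "\<ominus>\<^bsub>M\<^esub> x"]) (simp_all add: ms M.M.l_neg)
  qed (simp_all add: R ms M.M.add.m_ac M.smult_closed M.smult_l_distr M.smult_r_distr M.smult_assoc \<phi>S
      ring_hom_add[OF \<phi>(1)] ring_hom_mult[OF \<phi>(1)])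
  moreover obtain s x where s: "s \<in> carrier S" "x \<in> carrier M" "s \<odot>\<^bsub>M\<^esub> x \<noteq> \<zero>\<^bsub>M\<^esub>"
    by (rule M.nontrivial_action)
  moreover obtain r where "r \<in> carrier R" "s = \<phi> r" using s(1) \<phi>(2) by blast
  ultimately have act: "\<exists>r\<in>carrier R. \<exists>x\<in>carrier ?M. r \<odot>\<^bsub>?M\<^esub> x \<noteq> \<zero>\<^bsub>?M\<^esub>" and lm: "left_module R ?M"
    by (auto simp: ms)
  have triv: "N = {\<zero>\<^bsub>?M\<^esub>} \<or> N = carrier ?M" if N: "submodule N R ?M" for N
  proof -
    interpret N: submodule N R ?M by (rule N)
    have "submodule N S M"
    proof (intro submodule.intro subgroup.intro submodule_axioms.intro)
      show "N \<subseteq> carrier (add_monoid M)" using N.subset by (simp add: ms)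
      show "x \<otimes>\<^bsub>add_monoid M\<^esub> y \<in> N" if "x \<in> N" "y \<in> N" for x y
        using N.m_closed[OF that] by (simp add: ms)
      show "\<one>\<^bsub>add_monoid M\<^esub> \<in> N" using N.one_closed by (simp add: ms)
      show "inv\<^bsub>add_monoid M\<^esub> x \<in> N" if "x \<in> N" for x
        using N.m_inv_closed[OF that] by (simp only: minv)
      show "s \<odot>\<^bsub>M\<^esub> x \<in> N" if s: "s \<in> carrier S" and x: "x \<in> N" for s x
      proof -
        obtain r where "r \<in> carrier R" "s = \<phi> r" using s \<phi>(2) by blast
        then show ?thesis using N.smult_closed[OF _ x, of r] by (simp add: ms)
      qed
    qed
    then show ?thesis using M.submodule_trivial by (simp add: ms)
  qed
  show ?thesis unfolding simple_module_def by (intro conjI lm act allI impI triv)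
qed

section \<open>The dimension bound and the CCR property\<close>

lemma simple_group_algebra_moduleI:
  assumes "field K" "group G" "simple_module (group_algebra K G) M"
  shows "simple_group_algebra_module K G M"
  using assms
  by (intro simple_group_algebra_module.intro group_algebra_loc.intro simple_left_module.intro
      simple_left_module_axioms.intro)
    (simp_all add: simple_module_def field.is_ring)

theorem simple_group_algebra_module_dim:
  fixes M :: "('g \<Rightarrow> 'k, 'm, 'z) module_scheme"
  assumes alg: "algebraically_closed K" and G: "group G" and card: "carrier G \<prec> carrier K"
    and H: "commutative_subgroup H G" and fin: "finite (rcosets\<^bsub>G\<^esub> H)"
    and M: "simple_module (group_algebra K G) M"
  shows "dim_at_most K (underlying_space K G M) (card (rcosets\<^bsub>G\<^esub> H))"
proof -
  interpret alg: algebraically_closed K by (rule alg)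
  interpret simple_group_algebra_module K G M
    by (rule simple_group_algebra_moduleI[OF alg.field_axioms G M])
  have sH: "subgroup H G" and cH: "comm_group (G\<lparr>carrier := H\<rparr>)"
    using H by (simp_all add: commutative_subgroup_def)
  have "h \<otimes>\<^bsub>G\<^esub> h' = h' \<otimes>\<^bsub>G\<^esub> h" if "h \<in> H" "h' \<in> H" for h h'
    using comm_monoid.m_comm[OF comm_group.axioms(1)[OF cH], of h h'] that by simp
  then show ?thesis
    by (rule rep.irreducible_rep_dim_at_most[OF alg card sH _ fin irreducible_rep_V])
qed

theorem group_algebra_CCR:
  fixes K :: "('k, 'x) ring_scheme" and G :: "('g, 'y) monoid_scheme"
  assumes alg: "algebraically_closed K" and G: "group G" and card: "carrier G \<prec> carrier K"
    and H: "commutative_subgroup H G" and fin: "finite (rcosets\<^bsub>G\<^esub> H)"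
  shows "CCR_ring (group_algebra K G)"
  unfolding CCR_ring_def
proof (intro conjI allI impI; (elim conjE)?)
  interpret alg: algebraically_closed K by (rule alg)
  interpret GA: group_algebra_loc K G
    by (intro group_algebra_loc.intro alg.is_ring G)
  let ?R = "group_algebra K G"
  show "ring ?R" by (rule GA.group_algebra_ring)
  have main: "simple_ring (?R Quot I) \<and> (\<exists>L. minimal_left_ideal L (?R Quot I))"
    if I: "ideal I ?R" and prim: "primitive_ring (?R Quot I)" for I
  proof -
    interpret I: ideal I ?R by (rule I)
    let ?Q = "?R Quot I" and ?\<phi> = "(+>\<^bsub>?R\<^esub>) I"
    \<comment> \<open>\<open>primitive_ring\<close> fixes this element type; the dimension theorem
      is polymorphic in it and applies after pulling back.\<close>
    obtain M :: "(('g \<Rightarrow> 'k) set, ('g \<Rightarrow> 'k) set set) module"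
      where M: "simple_module ?Q M" "faithful_module ?Q M"
      using prim unfolding primitive_ring_def by blast
    interpret M: simple_left_module ?Q M
      using M(1) by (intro simple_left_module.intro simple_left_module_axioms.intro)
        (simp_all add: simple_module_def)
    let ?M = "pullback_module ?\<phi> M"
    have surj: "?\<phi> ` carrier ?R = carrier ?Q"
      by (auto simp: FactRing_def A_RCOSETS_def')
    have sM: "simple_module ?R ?M"
      by (rule simple_module_pullback[OF GA.group_algebra_ring M(1) I.rcos_ring_hom surj])
    interpret P: simple_group_algebra_module K G ?M
      by (rule simple_group_algebra_moduleI[OF alg.field_axioms G sM])
    obtain B where B: "lin_basis K P.V B" "finite B"
      using simple_group_algebra_module_dim[OF alg G card H fin sM] unfolding dim_at_most_def by blast
    have ms: "carrier ?M = carrier M" "\<zero>\<^bsub>?M\<^esub> = \<zero>\<^bsub>M\<^esub>" "r \<odot>\<^bsub>?M\<^esub> x = ?\<phi> r \<odot>\<^bsub>M\<^esub> x" for x r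
      by (simp_all add: pullback_module_def)
    have BM: "B \<subseteq> carrier M" using B(1) by (simp add: lin_basis_def P.V_simps ms)
    \<comment> \<open>A lift \<open>f\<close> of \<open>q\<close> kills the basis, hence all of
      \<open>M\<close>, and faithfulness over the quotient gives $q = 0$.\<close>
    have zero: "q = \<zero>\<^bsub>?Q\<^esub>" if q: "q \<in> carrier ?Q" and z: "\<forall>b\<in>B. q \<odot>\<^bsub>M\<^esub> b = \<zero>\<^bsub>M\<^esub>" for q
    proof -
      obtain f where f: "f \<in> carrier ?R" "q = ?\<phi> f" using q surj by blast
      have "q \<odot>\<^bsub>M\<^esub> x = \<zero>\<^bsub>M\<^esub>" if x: "x \<in> carrier M" for x
        using P.annihilates_basis_annihilates[OF B(1) f(1), of x] z x by (simp add: ms f(2))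
      then show ?thesis using M(2) q unfolding faithful_module_def by blast
    qed
    have "\<zero>\<^bsub>?Q\<^esub> \<in> M.annihilator B"
      using BM by (auto simp: M.annihilator_def intro!: M.smult_l_null)
    then have "M.annihilator B = {\<zero>\<^bsub>?Q\<^esub>}"
      using zero unfolding M.annihilator_def by blast
    then show ?thesis by (rule M.simple_ring_and_minimal_left_ideal[OF B(2) BM])
  qed
  fix I assume I: "ideal I ?R" "primitive_ring (?R Quot I)"
  show "simple_ring (?R Quot I)" using main[OF I] ..
  show "\<exists>L. minimal_left_ideal L (?R Quot I)" using main[OF I] ..
qed

theorem corollary4p2:
  fixes K :: "('k, 'x) ring_scheme" and G :: "('g, 'y) monoid_scheme"
    and H :: "'g set" and n :: nat
  assumes "algebraically_closed K"
    and "virtually_abelian G"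
    and "carrier G \<prec> carrier K"
    and "H \<lhd> G" and "commutative_subgroup H G"
    and "finite (rcosets\<^bsub>G\<^esub> H)" and "card (rcosets\<^bsub>G\<^esub> H) = n"
  shows "(\<forall>M :: ('g \<Rightarrow> 'k, 'm) module.
            simple_module (group_algebra K G) M \<longrightarrow> dim_at_most K (underlying_space K G M) n) \<and>
         CCR_ring (group_algebra K G)"
proof -
  have G: "group G" using assms(2) by (simp add: virtually_abelian_def)
  show ?thesis
    unfolding assms(7)[symmetric]
    by (intro conjI allI impI group_algebra_CCR[OF assms(1) G assms(3,5,6)]
        simple_group_algebra_module_dim[OF assms(1) G assms(3,5,6)])
qed

end
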